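(* Let $\Omega\subset\mathbb{R}^n$, $n\ge1$, be an open, bounded Lipschitz domain. Let $g\in H^1(\Omega)\cap C(\overline\Omega)$ satisfy $\min_{\partial\Omega}g|_{\partial\Omega}>0$, and let $K=\{v\in H^1_g(\Omega)\mid v\ge0\text{ a.e.}\}$. Given $f\in L^\infty(\Omega)$, set $$E(v)=\frac12\int_\Omega|\nabla v|^2\,\mathrm{d}x-\int_\Omega fv\,\mathrm{d}x,$$ and for $w\in\operatorname{int}L^\infty_+(\Omega)$ set $$D(v,w)=\int_\Omega v\ln(v/w)-v+w\,\mathrm{d}x.$$ Then, for any step size $\alpha>0$ (and any $w\in\operatorname{int}L^\infty_+(\Omega)$), the minimization problem $$\min_{v\in K}\ E(v)+\alpha^{-1}D(v,w)$$ has a unique solution $u$; it satisfies $u\in H^1_g(\Omega)\cap\operatorname{int}L^\infty_+(\Omega)$, and it is uniquely characterized by the weak form of the entropic Poisson equation: $u$ is the unique element of $H^1_g(\Omega)\cap\operatorname{int}L^\infty_+(\Omega)$ such that $$(\alpha\nabla u,\nabla v)+(\ln u,v)=(\alpha f,v)+(\ln w,v)\qquad\text{for all }v\in H^1_0(\Omega).$$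
   Context: $H^1_g(\Omega)=g+H^1_0(\Omega)$. $\operatorname{int}L^\infty_+(\Omega)=\{w\in L^\infty(\Omega)\mid\operatorname{ess\,inf}w>0\}$. $(\cdot,\cdot)$ is the $L^2(\Omega)$ inner product (for scalar or vector-valued functions). Convention: $0\ln0:=0$. *)

theory Defs
  imports "HOL-Analysis.Analysis" "HOL-Probability.Essential_Supremum"
begin

text \<open>
  Elements of Lebesgue and Sobolev spaces on \<open>\<Omega>\<close> are represented by functions on the whole type;
  only their values almost everywhere on \<open>\<Omega>\<close> matter. Equality of such elements is therefore
  \<open>AE x in lebesgue_on \<Omega>. u x = v x\<close>.
\<close>

text \<open>
  Near each boundary point, \<open>\<Omega>\<close> is the strict epigraph of a Lipschitz function over a
  hyperplane through the origin: \<open>e\<close> is the unit vector in the vertical direction and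
  \<open>x - (x \<bullet> e) *\<^sub>R e\<close> is the horizontal part of \<open>x\<close>. In dimension one the hyperplane is \<open>{0}\<close>.
\<close>

definition lipschitz_boundary :: "'a::euclidean_space set \<Rightarrow> bool" where
  "lipschitz_boundary \<Omega> \<longleftrightarrow>
     (\<forall>p \<in> frontier \<Omega>. \<exists>r > 0. \<exists>e L. \<exists>\<gamma> :: 'a \<Rightarrow> real.
        norm e = 1 \<and> L-lipschitz_on {y. y \<bullet> e = 0} \<gamma> \<and>
        \<Omega> \<inter> ball p r = {x \<in> ball p r. \<gamma> (x - (x \<bullet> e) *\<^sub>R e) < x \<bullet> e})"

definition L2 :: "'a::euclidean_space set \<Rightarrow> ('a \<Rightarrow> 'b::euclidean_space) set" where
  "L2 \<Omega> = {v \<in> borel_measurable (lebesgue_on \<Omega>). integrable (lebesgue_on \<Omega>) (\<lambda>x. (norm (v x))\<^sup>2)}"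

definition L2_inner ::
    "'a::euclidean_space set \<Rightarrow> ('a \<Rightarrow> 'b::euclidean_space) \<Rightarrow> ('a \<Rightarrow> 'b) \<Rightarrow> real" where
  "L2_inner \<Omega> u v = (\<integral>x. u x \<bullet> v x \<partial>lebesgue_on \<Omega>)"

definition Linfty :: "'a::euclidean_space set \<Rightarrow> ('a \<Rightarrow> real) set" where
  "Linfty \<Omega> = {v \<in> borel_measurable (lebesgue_on \<Omega>).
     esssup (lebesgue_on \<Omega>) (\<lambda>x. ereal \<bar>v x\<bar>) < \<infinity>}"

definition ess_inf :: "'a::euclidean_space set \<Rightarrow> ('a \<Rightarrow> real) \<Rightarrow> ereal" where
  "ess_inf \<Omega> v = - esssup (lebesgue_on \<Omega>) (\<lambda>x. - ereal (v x))"

definition int_Linfty_plus :: "'a::euclidean_space set \<Rightarrow> ('a \<Rightarrow> real) set" where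
  "int_Linfty_plus \<Omega> = {w \<in> Linfty \<Omega>. ess_inf \<Omega> w > 0}"

definition partial_deriv :: "'a::euclidean_space \<Rightarrow> ('a \<Rightarrow> real) \<Rightarrow> 'a \<Rightarrow> real" where
  "partial_deriv i f x = frechet_derivative f (at x) i"

primrec Ck :: "nat \<Rightarrow> ('a::euclidean_space \<Rightarrow> real) \<Rightarrow> bool" where
  "Ck 0 f \<longleftrightarrow> continuous_on UNIV f"
| "Ck (Suc k) f \<longleftrightarrow> (\<forall>x. f differentiable (at x)) \<and> (\<forall>i \<in> Basis. Ck k (partial_deriv i f))"

definition test_functions :: "'a::euclidean_space set \<Rightarrow> ('a \<Rightarrow> real) set" where
  "test_functions \<Omega> = {\<phi>. (\<forall>k. Ck k \<phi>) \<and>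
     compact (closure {x. \<phi> x \<noteq> 0}) \<and> closure {x. \<phi> x \<noteq> 0} \<subseteq> \<Omega>}"

definition is_weak_grad ::
    "'a::euclidean_space set \<Rightarrow> ('a \<Rightarrow> real) \<Rightarrow> ('a \<Rightarrow> 'a) \<Rightarrow> bool" where
  "is_weak_grad \<Omega> v G \<longleftrightarrow> G \<in> L2 \<Omega> \<and>
     (\<forall>\<phi> \<in> test_functions \<Omega>. \<forall>i \<in> Basis.
        (\<integral>x. v x * partial_deriv i \<phi> x \<partial>lebesgue_on \<Omega>) = - (\<integral>x. (G x \<bullet> i) * \<phi> x \<partial>lebesgue_on \<Omega>))"

definition H1 :: "'a::euclidean_space set \<Rightarrow> ('a \<Rightarrow> real) set" where
  "H1 \<Omega> = {v \<in> L2 \<Omega>. \<exists>G. is_weak_grad \<Omega> v G}"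

text \<open>On an open set, the weak gradient is unique almost everywhere; \<open>weak_grad\<close> picks a representative.\<close>

definition weak_grad :: "'a::euclidean_space set \<Rightarrow> ('a \<Rightarrow> real) \<Rightarrow> 'a \<Rightarrow> 'a" where
  "weak_grad \<Omega> v = (SOME G. is_weak_grad \<Omega> v G)"

definition H1_norm :: "'a::euclidean_space set \<Rightarrow> ('a \<Rightarrow> real) \<Rightarrow> real" where
  "H1_norm \<Omega> v = sqrt (L2_inner \<Omega> v v + L2_inner \<Omega> (weak_grad \<Omega> v) (weak_grad \<Omega> v))"

definition H10 :: "'a::euclidean_space set \<Rightarrow> ('a \<Rightarrow> real) set" where
  "H10 \<Omega> = {v \<in> H1 \<Omega>. \<exists>\<phi>. (\<forall>k. \<phi> k \<in> test_functions \<Omega>) \<and>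
     (\<lambda>k. H1_norm \<Omega> (\<lambda>x. v x - \<phi> k x)) \<longlonglongrightarrow> 0}"

definition H1g :: "'a::euclidean_space set \<Rightarrow> ('a \<Rightarrow> real) \<Rightarrow> ('a \<Rightarrow> real) set" where
  "H1g \<Omega> g = {\<lambda>x. g x + z x | z. z \<in> H10 \<Omega>}"

definition obstacle_set :: "'a::euclidean_space set \<Rightarrow> ('a \<Rightarrow> real) \<Rightarrow> ('a \<Rightarrow> real) set" where
  "obstacle_set \<Omega> g = {v \<in> H1g \<Omega> g. AE x in lebesgue_on \<Omega>. 0 \<le> v x}"

definition dirichlet_energy ::
    "'a::euclidean_space set \<Rightarrow> ('a \<Rightarrow> real) \<Rightarrow> ('a \<Rightarrow> real) \<Rightarrow> real" where
  "dirichlet_energy \<Omega> f v =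
     1 / 2 * (\<integral>x. (norm (weak_grad \<Omega> v x))\<^sup>2 \<partial>lebesgue_on \<Omega>) - (\<integral>x. f x * v x \<partial>lebesgue_on \<Omega>)"

text \<open>The convention \<open>0 ln 0 = 0\<close> is built in, since \<open>0 * y = 0\<close> for every real \<open>y\<close>.\<close>

definition entropy_divergence ::
    "'a::euclidean_space set \<Rightarrow> ('a \<Rightarrow> real) \<Rightarrow> ('a \<Rightarrow> real) \<Rightarrow> real" where
  "entropy_divergence \<Omega> v w = (\<integral>x. v x * ln (v x / w x) - v x + w x \<partial>lebesgue_on \<Omega>)"

definition entropic_poisson_weak ::
    "'a::euclidean_space set \<Rightarrow> real \<Rightarrow> ('a \<Rightarrow> real) \<Rightarrow> ('a \<Rightarrow> real) \<Rightarrow> ('a \<Rightarrow> real) \<Rightarrow> bool" where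
  "entropic_poisson_weak \<Omega> \<alpha> f w u \<longleftrightarrow>
     (\<forall>v \<in> H10 \<Omega>.
        L2_inner \<Omega> (\<lambda>x. \<alpha> *\<^sub>R weak_grad \<Omega> u x) (weak_grad \<Omega> v) + L2_inner \<Omega> (\<lambda>x. ln (u x)) v
        = L2_inner \<Omega> (\<lambda>x. \<alpha> * f x) v + L2_inner \<Omega> (\<lambda>x. ln (w x)) v)"

end

theory Submission
  imports Defs
begin

text \<open>
  Write \<open>h(x, t) = (t ln (t / w x) - t + w x) / \<alpha> - f x * t\<close>, so that the functional to be minimized is the
  integral of \<open>\<bar>\<nabla>v\<bar>\<^sup>2 / 2 + h(x, v)\<close>. For fixed \<open>x\<close> the function \<open>h(x, \<cdot>)\<close> is strictly convex on
  \<open>[0, \<infinity>)\<close> with slope \<open>ln (t / w x) / \<alpha> - f x\<close>; it decreases below \<open>w x * exp (\<alpha> * f x)\<close> and increases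
  above. As \<open>f\<close> and \<open>ln w\<close> are bounded, these turning points lie in a fixed interval \<open>[a, b]\<close> with
  \<open>0 < a\<close>. Making \<open>a\<close> smaller and \<open>b\<close> larger, one also has \<open>a < g\<close> on the boundary and \<open>g \<le> b\<close>. Pushing
  the values of a competitor towards \<open>[a, b]\<close> by a contraction lowers \<open>h\<close> pointwise, does not increase
  the gradient and keeps the boundary values. This maximum principle is the heart of the proof: it
  gives \<open>a / 2 \<le> u \<le> 2 * b\<close> for the minimizer, hence the bound on \<open>ln u\<close>.

  \<^emph>\<open>Truncation.\<close> The contraction is a smooth \<open>T\<close> with \<open>0 \<le> T' \<le> 1\<close> and \<open>T t = t\<close> on \<open>[a, b]\<close>
  (\<open>smooth_truncation_exists\<close>). It is only applied to \<open>g + \<phi>\<close> with a test function \<open>\<phi>\<close>. Since \<open>g\<close> is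
  continuous up to the boundary, \<open>T (g + \<phi>) - g\<close> vanishes outside a compact subset of the domain, and
  replacing \<open>g\<close> by its mollifications there yields test functions that converge to it in \<open>H\<^sup>1\<close>; so the
  boundary values are kept and the chain rule holds (\<open>smooth_truncation_H10\<close>).

  \<^emph>\<open>Existence.\<close> On the band \<open>a / 2 \<le> v \<le> 2 * b\<close> the functional is uniformly convex with respect to the
  \<open>H\<^sup>1\<close> norm, because the second derivative \<open>1 / t\<close> of \<open>t ln t\<close> is bounded below there. A minimizing
  sequence in the band is therefore Cauchy in \<open>H\<^sup>1\<close>, and its limit \<open>u\<close> minimizes over the band
  (\<open>band_minimizer_exists\<close>). If \<open>v = g + z\<close> is any competitor and test functions \<open>\<phi>\<^sub>k\<close> converge to \<open>z\<close>,
  then the functions \<open>T (g + \<phi>\<^sub>k)\<close> lie in the band and their energies are bounded by quantities that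
  converge to at most the energy of \<open>v\<close>; hence \<open>u\<close> is a global minimizer (\<open>band_minimizer_global\<close>).

  \<^emph>\<open>Weak form.\<close> As \<open>u\<close> is bounded away from zero, \<open>u + t * \<phi>\<close> is a competitor for small \<open>t\<close> of either
  sign, and the first variation must vanish; density of the test functions extends the equation to
  \<open>H\<^sup>1\<^sub>0\<close> (\<open>minimizer_weak_solution\<close>).

  \<^emph>\<open>Uniqueness.\<close> Two minimizers coincide by strict convexity of \<open>h(x, \<cdot>)\<close> (\<open>minimizer_unique\<close>), and two
  weak solutions coincide since the logarithm is strictly increasing
  (\<open>weak_solution_unique\<close>).
\<close>

section \<open>Square-integrable functions on a bounded open set\<close>

definition L2norm :: "'a::euclidean_space set \<Rightarrow> ('a \<Rightarrow> 'b::euclidean_space) \<Rightarrow> real" where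
  "L2norm \<Omega> u = sqrt (L2_inner \<Omega> u u)"

locale bounded_open =
  fixes \<Omega> :: "'a::euclidean_space set"
  assumes open_domain: "open \<Omega>" and bounded_domain: "bounded \<Omega>"
begin

lemma domain_lmeasurable: "\<Omega> \<in> lmeasurable"
  using open_domain bounded_domain by (rule lmeasurable_open[rotated])

lemma domain_sets[measurable]: "\<Omega> \<in> sets lebesgue" "\<Omega> \<in> sets borel"
  using open_domain by auto

lemma finite_measure_domain: "finite_measure (lebesgue_on \<Omega>)"
  by (rule finite_measure_lebesgue_on[OF domain_lmeasurable])

lemma integrable_const_domain[simp]: "integrable (lebesgue_on \<Omega>) (\<lambda>x. c)"
  using finite_measure.integrable_const[OF finite_measure_domain] .

lemma L2_measurable[measurable_dest]: "u \<in> L2 \<Omega> \<Longrightarrow> u \<in> borel_measurable (lebesgue_on \<Omega>)"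
  by (simp add: L2_def)

lemma L2_square_integrable: "u \<in> L2 \<Omega> \<Longrightarrow> integrable (lebesgue_on \<Omega>) (\<lambda>x. (norm (u x))\<^sup>2)"
  by (simp add: L2_def)

lemma L2_inner_integrable:
  fixes u v :: "'a \<Rightarrow> 'b::euclidean_space"
  assumes u: "u \<in> L2 \<Omega>" and v: "v \<in> L2 \<Omega>"
  shows "integrable (lebesgue_on \<Omega>) (\<lambda>x. u x \<bullet> v x)"
proof (rule Bochner_Integration.integrable_bound)
  show "integrable (lebesgue_on \<Omega>) (\<lambda>x. (norm (u x))\<^sup>2 + (norm (v x))\<^sup>2)"
    using L2_square_integrable[OF u] L2_square_integrable[OF v] by simp
  show "(\<lambda>x. u x \<bullet> v x) \<in> borel_measurable (lebesgue_on \<Omega>)"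
    using u v by measurable
  have "\<bar>u x \<bullet> v x\<bar> \<le> (norm (u x))\<^sup>2 + (norm (v x))\<^sup>2" for x
  proof -
    have "\<bar>u x \<bullet> v x\<bar> \<le> norm (u x) * norm (v x)" by (rule Cauchy_Schwarz_ineq2)
    moreover have "0 \<le> (norm (u x) - norm (v x))\<^sup>2" "0 \<le> norm (u x) * norm (v x)" by auto
    ultimately show ?thesis by (simp add: power2_diff)
  qed
  then show "AE x in lebesgue_on \<Omega>. norm (u x \<bullet> v x) \<le> norm ((norm (u x))\<^sup>2 + (norm (v x))\<^sup>2)"
    by simp
qed

lemma L2_mult_integrable:
  fixes u v :: "'a \<Rightarrow> real"
  shows "u \<in> L2 \<Omega> \<Longrightarrow> v \<in> L2 \<Omega> \<Longrightarrow> integrable (lebesgue_on \<Omega>) (\<lambda>x. u x * v x)"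
  using L2_inner_integrable[of u v] by simp

lemma L2_dominated:
  fixes u :: "'a \<Rightarrow> 'b::euclidean_space" and v :: "'a \<Rightarrow> 'c::euclidean_space"
  assumes v: "v \<in> L2 \<Omega>" and u: "u \<in> borel_measurable (lebesgue_on \<Omega>)"
    and le: "AE x in lebesgue_on \<Omega>. norm (u x) \<le> norm (v x)"
  shows "u \<in> L2 \<Omega>"
proof -
  have "integrable (lebesgue_on \<Omega>) (\<lambda>x. (norm (u x))\<^sup>2)"
  proof (rule Bochner_Integration.integrable_bound[OF L2_square_integrable[OF v]])
    show "(\<lambda>x. (norm (u x))\<^sup>2) \<in> borel_measurable (lebesgue_on \<Omega>)" using u by measurable
    show "AE x in lebesgue_on \<Omega>. norm ((norm (u x))\<^sup>2) \<le> norm ((norm (v x))\<^sup>2)"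
      using le by eventually_elim (simp add: power_mono)
  qed
  with u show ?thesis by (simp add: L2_def)
qed

lemma L2_const[simp]: "(\<lambda>x. c) \<in> L2 \<Omega>"
  by (simp add: L2_def)

lemma L2_bounded:
  fixes u :: "'a \<Rightarrow> 'b::euclidean_space"
  assumes u: "u \<in> borel_measurable (lebesgue_on \<Omega>)"
    and le: "AE x in lebesgue_on \<Omega>. norm (u x) \<le> C"
  shows "u \<in> L2 \<Omega>"
  by (rule L2_dominated[OF L2_const[of C] u]) (use le in \<open>eventually_elim, simp\<close>)

lemma L2_scaleR:
  fixes u :: "'a \<Rightarrow> 'b::euclidean_space"
  assumes u: "u \<in> L2 \<Omega>" shows "(\<lambda>x. c *\<^sub>R u x) \<in> L2 \<Omega>"
proof -
  have "(\<lambda>x. c *\<^sub>R u x) \<in> borel_measurable (lebesgue_on \<Omega>)" using u by measurable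
  moreover have "integrable (lebesgue_on \<Omega>) (\<lambda>x. c\<^sup>2 * (norm (u x))\<^sup>2)"
    using L2_square_integrable[OF u] by simp
  ultimately show ?thesis by (simp add: L2_def power_mult_distrib)
qed

lemma L2_add:
  fixes u v :: "'a \<Rightarrow> 'b::euclidean_space"
  assumes u: "u \<in> L2 \<Omega>" and v: "v \<in> L2 \<Omega>"
  shows "(\<lambda>x. u x + v x) \<in> L2 \<Omega>"
proof -
  have m: "(\<lambda>x. u x + v x) \<in> borel_measurable (lebesgue_on \<Omega>)"
    using u v by measurable
  have "integrable (lebesgue_on \<Omega>) (\<lambda>x. (norm (u x))\<^sup>2 + 2 * (u x \<bullet> v x) + (norm (v x))\<^sup>2)"
    using L2_square_integrable[OF u] L2_square_integrable[OF v] L2_inner_integrable[OF u v] by simp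
  moreover have "(norm (u x + v x))\<^sup>2 = (norm (u x))\<^sup>2 + 2 * (u x \<bullet> v x) + (norm (v x))\<^sup>2" for x
    by (simp add: power2_norm_eq_inner inner_add inner_commute)
  ultimately show ?thesis using m by (simp add: L2_def)
qed

lemma L2_diff:
  fixes u v :: "'a \<Rightarrow> 'b::euclidean_space"
  assumes u: "u \<in> L2 \<Omega>" and v: "v \<in> L2 \<Omega>"
  shows "(\<lambda>x. u x - v x) \<in> L2 \<Omega>"
  using L2_add[OF u L2_scaleR[OF v, of "-1"]] by simp

lemma L2_mult_const: "u \<in> L2 \<Omega> \<Longrightarrow> (\<lambda>x. c * u x :: real) \<in> L2 \<Omega>"
  using L2_scaleR[of u c] by simp

lemma L2_sum:
  fixes u :: "'i \<Rightarrow> 'a \<Rightarrow> 'b::euclidean_space"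
  shows "(\<And>i. i \<in> I \<Longrightarrow> u i \<in> L2 \<Omega>) \<Longrightarrow> (\<lambda>x. \<Sum>i\<in>I. u i x) \<in> L2 \<Omega>"
  by (induction I rule: infinite_finite_induct) (auto intro: L2_add)

lemma L2_component:
  fixes u :: "'a \<Rightarrow> 'b::euclidean_space"
  assumes "u \<in> L2 \<Omega>" "i \<in> Basis" shows "(\<lambda>x. u x \<bullet> i) \<in> L2 \<Omega>"
  by (rule L2_dominated[OF assms(1)])
    (use assms in \<open>auto intro: Basis_le_norm intro!: borel_measurable_inner L2_measurable\<close>)

lemma L2_integrable:
  fixes u :: "'a \<Rightarrow> 'b::euclidean_space"
  assumes u: "u \<in> L2 \<Omega>" shows "integrable (lebesgue_on \<Omega>) u"
proof (rule Bochner_Integration.integrable_bound)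
  show "integrable (lebesgue_on \<Omega>) (\<lambda>x. 1 + (norm (u x))\<^sup>2)"
    using L2_square_integrable[OF u] by simp
  have "norm (u x) \<le> 1 + (norm (u x))\<^sup>2" for x
    using zero_le_power2[of "norm (u x) - 1"] norm_ge_zero[of "u x"]
    unfolding power2_diff one_power2 mult_1_right by linarith
  then show "AE x in lebesgue_on \<Omega>. norm (u x) \<le> norm (1 + (norm (u x))\<^sup>2)" by simp
qed (use u in measurable)

lemma L2norm_nonneg[simp]: "0 \<le> L2norm \<Omega> u"
  by (simp add: L2norm_def L2_inner_def)

lemma L2norm_square: "(L2norm \<Omega> u)\<^sup>2 = (\<integral>x. (norm (u x))\<^sup>2 \<partial>lebesgue_on \<Omega>)"
  by (simp add: L2norm_def L2_inner_def power2_norm_eq_inner)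

lemma L2_inner_self: "L2_inner \<Omega> u u = (L2norm \<Omega> u)\<^sup>2"
  by (simp add: L2norm_def L2_inner_def)

lemma L2norm_cong_AE:
  fixes u v :: "'a \<Rightarrow> 'b::euclidean_space"
  assumes "u \<in> borel_measurable (lebesgue_on \<Omega>)" "v \<in> borel_measurable (lebesgue_on \<Omega>)"
    "AE x in lebesgue_on \<Omega>. norm (u x) = norm (v x)"
  shows "L2norm \<Omega> u = L2norm \<Omega> v"
proof -
  have "(\<integral>x. (norm (u x))\<^sup>2 \<partial>lebesgue_on \<Omega>) = (\<integral>x. (norm (v x))\<^sup>2 \<partial>lebesgue_on \<Omega>)"
  proof (rule integral_cong_AE)
    show "AE x in lebesgue_on \<Omega>. (norm (u x))\<^sup>2 = (norm (v x))\<^sup>2"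
      using assms(3) by eventually_elim simp
  qed (use assms in measurable)
  then show ?thesis
    using L2norm_square[of u] L2norm_square[of v] by (metis L2norm_nonneg power2_eq_imp_eq)
qed

lemma L2norm_mono:
  fixes u :: "'a \<Rightarrow> 'b::euclidean_space" and v :: "'a \<Rightarrow> 'c::euclidean_space"
  assumes v: "v \<in> L2 \<Omega>" and u: "u \<in> borel_measurable (lebesgue_on \<Omega>)"
    and le: "AE x in lebesgue_on \<Omega>. norm (u x) \<le> norm (v x)"
  shows "L2norm \<Omega> u \<le> L2norm \<Omega> v"
proof -
  have "(\<integral>x. (norm (u x))\<^sup>2 \<partial>lebesgue_on \<Omega>) \<le> (\<integral>x. (norm (v x))\<^sup>2 \<partial>lebesgue_on \<Omega>)"
  proof (rule integral_mono_AE)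
    show "AE x in lebesgue_on \<Omega>. (norm (u x))\<^sup>2 \<le> (norm (v x))\<^sup>2"
      using le by eventually_elim (simp add: power_mono)
  qed (use L2_square_integrable v L2_dominated[OF v u le] in auto)
  then show ?thesis
    using L2norm_square[of u] L2norm_square[of v] by (metis L2norm_nonneg power2_le_imp_le)
qed

lemma L2norm_eq_0_iff:
  fixes u :: "'a \<Rightarrow> 'b::euclidean_space"
  assumes u: "u \<in> L2 \<Omega>"
  shows "L2norm \<Omega> u = 0 \<longleftrightarrow> (AE x in lebesgue_on \<Omega>. u x = 0)"
proof -
  have "L2norm \<Omega> u = 0 \<longleftrightarrow> (\<integral>x. (norm (u x))\<^sup>2 \<partial>lebesgue_on \<Omega>) = 0"
    using L2norm_square[of u] by (metis zero_eq_power2)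
  also have "\<dots> \<longleftrightarrow> (AE x in lebesgue_on \<Omega>. (norm (u x))\<^sup>2 = 0)"
    using L2_square_integrable[OF u] by (intro integral_nonneg_eq_0_iff_AE) auto
  finally show ?thesis by simp
qed

lemma L2_inner_commute: "L2_inner \<Omega> u v = L2_inner \<Omega> v u"
  by (simp add: L2_inner_def inner_commute)

lemma L2_inner_add_left:
  fixes u v z :: "'a \<Rightarrow> 'b::euclidean_space"
  assumes "u \<in> L2 \<Omega>" "v \<in> L2 \<Omega>" "z \<in> L2 \<Omega>"
  shows "L2_inner \<Omega> (\<lambda>x. u x + v x) z = L2_inner \<Omega> u z + L2_inner \<Omega> v z"
  unfolding L2_inner_def inner_add_left using assms
  by (intro Bochner_Integration.integral_add L2_inner_integrable)

lemma L2_inner_diff_left: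
  fixes u v z :: "'a \<Rightarrow> 'b::euclidean_space"
  assumes "u \<in> L2 \<Omega>" "v \<in> L2 \<Omega>" "z \<in> L2 \<Omega>"
  shows "L2_inner \<Omega> (\<lambda>x. u x - v x) z = L2_inner \<Omega> u z - L2_inner \<Omega> v z"
  unfolding L2_inner_def inner_diff_left using assms
  by (intro Bochner_Integration.integral_diff L2_inner_integrable)

lemma L2_inner_scaleR_left: "L2_inner \<Omega> (\<lambda>x. c *\<^sub>R u x) v = c * L2_inner \<Omega> u v"
  by (simp add: L2_inner_def)

lemma L2_inner_add_right:
  fixes u v z :: "'a \<Rightarrow> 'b::euclidean_space"
  assumes "u \<in> L2 \<Omega>" "v \<in> L2 \<Omega>" "z \<in> L2 \<Omega>"
  shows "L2_inner \<Omega> z (\<lambda>x. u x + v x) = L2_inner \<Omega> z u + L2_inner \<Omega> z v"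
  using L2_inner_add_left[OF assms] by (simp add: L2_inner_commute)

lemma L2_inner_scaleR_right: "L2_inner \<Omega> u (\<lambda>x. c *\<^sub>R v x) = c * L2_inner \<Omega> u v"
  by (simp add: L2_inner_def)

lemma L2norm_add_scaleR_square:
  fixes u v :: "'a \<Rightarrow> 'b::euclidean_space"
  assumes "u \<in> L2 \<Omega>" "v \<in> L2 \<Omega>"
  shows "(L2norm \<Omega> (\<lambda>x. u x + c *\<^sub>R v x))\<^sup>2 = (L2norm \<Omega> u)\<^sup>2 + 2 * c * L2_inner \<Omega> u v + c\<^sup>2 * (L2norm \<Omega> v)\<^sup>2"
proof -
  note cv = L2_scaleR[OF assms(2), of c]
  have "(L2norm \<Omega> (\<lambda>x. u x + c *\<^sub>R v x))\<^sup>2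
      = L2_inner \<Omega> u u + c * L2_inner \<Omega> u v + (c * L2_inner \<Omega> v u + c * (c * L2_inner \<Omega> v v))"
    unfolding L2_inner_self[symmetric]
    by (simp add: L2_inner_add_left L2_inner_add_right L2_add assms cv
        L2_inner_scaleR_left L2_inner_scaleR_right distrib_left)
  then show ?thesis
    by (simp add: L2_inner_self L2_inner_commute[of v u] power2_eq_square algebra_simps)
qed

lemma L2norm_scaleR: "L2norm \<Omega> (\<lambda>x. c *\<^sub>R u x) = \<bar>c\<bar> * L2norm \<Omega> u"
  by (simp add: L2norm_def L2_inner_scaleR_left L2_inner_scaleR_right real_sqrt_mult)

lemma L2_Cauchy_Schwarz:
  fixes u v :: "'a \<Rightarrow> 'b::euclidean_space"
  assumes u: "u \<in> L2 \<Omega>" and v: "v \<in> L2 \<Omega>"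
  shows "\<bar>L2_inner \<Omega> u v\<bar> \<le> L2norm \<Omega> u * L2norm \<Omega> v"
proof (cases "L2norm \<Omega> v = 0")
  case True
  then have "AE x in lebesgue_on \<Omega>. u x \<bullet> v x = 0"
    using L2norm_eq_0_iff[OF v] by (auto elim: eventually_mono)
  then have "L2_inner \<Omega> u v = 0"
    unfolding L2_inner_def by (rule integral_eq_zero_AE)
  then show ?thesis using True by simp
next
  case False
  \<comment> \<open>the value of \<open>t\<close> at which the norm of \<open>u + t * v\<close> is smallest\<close>
  define t where "t = - L2_inner \<Omega> u v / (L2norm \<Omega> v)\<^sup>2"
  have "0 \<le> (L2norm \<Omega> u)\<^sup>2 + 2 * t * L2_inner \<Omega> u v + t\<^sup>2 * (L2norm \<Omega> v)\<^sup>2"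
    unfolding L2norm_add_scaleR_square[OF u v, symmetric] by simp
  also have "\<dots> = (L2norm \<Omega> u)\<^sup>2 - (L2_inner \<Omega> u v)\<^sup>2 / (L2norm \<Omega> v)\<^sup>2"
    using False by (simp add: t_def field_simps power2_eq_square)
  finally have "(L2_inner \<Omega> u v)\<^sup>2 \<le> (L2norm \<Omega> u * L2norm \<Omega> v)\<^sup>2"
    using False by (simp add: field_simps power_mult_distrib)
  then show ?thesis
    using abs_le_square_iff[of "L2_inner \<Omega> u v" "L2norm \<Omega> u * L2norm \<Omega> v"] by simp
qed

lemma L2norm_triangle:
  fixes u v :: "'a \<Rightarrow> 'b::euclidean_space"
  assumes u: "u \<in> L2 \<Omega>" and v: "v \<in> L2 \<Omega>"
  shows "L2norm \<Omega> (\<lambda>x. u x + v x) \<le> L2norm \<Omega> u + L2norm \<Omega> v"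
proof (rule power2_le_imp_le)
  have "L2_inner \<Omega> u v \<le> L2norm \<Omega> u * L2norm \<Omega> v"
    using L2_Cauchy_Schwarz[OF u v] by simp
  then show "(L2norm \<Omega> (\<lambda>x. u x + v x))\<^sup>2 \<le> (L2norm \<Omega> u + L2norm \<Omega> v)\<^sup>2"
    using L2norm_add_scaleR_square[OF u v, of 1] by (simp add: power2_sum)
qed simp

lemma L2norm_minus_commute: "L2norm \<Omega> (\<lambda>x. u x - v x) = L2norm \<Omega> (\<lambda>x. v x - u x)"
  using L2norm_scaleR[of "-1" "\<lambda>x. u x - v x"] by simp

lemma L2norm_triangle_diff:
  fixes u v z :: "'a \<Rightarrow> 'b::euclidean_space"
  assumes u: "u \<in> L2 \<Omega>" and v: "v \<in> L2 \<Omega>" and z: "z \<in> L2 \<Omega>"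
  shows "L2norm \<Omega> (\<lambda>x. u x - v x) \<le> L2norm \<Omega> (\<lambda>x. u x - z x) + L2norm \<Omega> (\<lambda>x. z x - v x)"
  using L2norm_triangle[OF L2_diff[OF u z] L2_diff[OF z v]] by simp

lemma L2norm_diff_le:
  fixes u v :: "'a \<Rightarrow> 'b::euclidean_space"
  assumes u: "u \<in> L2 \<Omega>" and v: "v \<in> L2 \<Omega>"
  shows "\<bar>L2norm \<Omega> u - L2norm \<Omega> v\<bar> \<le> L2norm \<Omega> (\<lambda>x. u x - v x)"
  using L2norm_triangle[OF L2_diff[OF u v] v] L2norm_triangle[OF L2_diff[OF v u] u]
  by (simp add: L2norm_minus_commute[of v u])

lemma L2norm_cong:
  assumes "\<And>x. x \<in> \<Omega> \<Longrightarrow> u x = v x"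
  shows "L2norm \<Omega> u = L2norm \<Omega> v"
proof -
  have "L2_inner \<Omega> u u = L2_inner \<Omega> v v"
    unfolding L2_inner_def by (rule Bochner_Integration.integral_cong) (auto simp: assms)
  then show ?thesis by (simp add: L2norm_def)
qed

lemma L2norm_tendsto:
  fixes u :: "'a \<Rightarrow> 'b::euclidean_space"
  assumes "\<And>k. v k \<in> L2 \<Omega>" "u \<in> L2 \<Omega>" "(\<lambda>k. L2norm \<Omega> (\<lambda>x. v k x - u x)) \<longlonglongrightarrow> 0"
  shows "(\<lambda>k. L2norm \<Omega> (v k)) \<longlonglongrightarrow> L2norm \<Omega> u"
  by (rule LIM_zero_cancel, rule tendsto_rabs_zero_cancel,
      rule tendsto_sandwich[OF _ _ tendsto_const assms(3)])
    (auto intro!: L2norm_diff_le assms always_eventually)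

lemma L2_inner_tendsto:
  fixes u z :: "'a \<Rightarrow> 'b::euclidean_space"
  assumes v: "\<And>k. v k \<in> L2 \<Omega>" and u: "u \<in> L2 \<Omega>" and z: "z \<in> L2 \<Omega>"
    and lim: "(\<lambda>k. L2norm \<Omega> (\<lambda>x. v k x - u x)) \<longlonglongrightarrow> 0"
  shows "(\<lambda>k. L2_inner \<Omega> (v k) z) \<longlonglongrightarrow> L2_inner \<Omega> u z"
proof (rule LIM_zero_cancel, rule tendsto_rabs_zero_cancel, rule tendsto_sandwich[OF _ _ tendsto_const])
  show "(\<lambda>k. L2norm \<Omega> (\<lambda>x. v k x - u x) * L2norm \<Omega> z) \<longlonglongrightarrow> 0"
    using tendsto_mult_right[OF lim, of "L2norm \<Omega> z"] by simp
  show "\<forall>\<^sub>F k in sequentially. \<bar>L2_inner \<Omega> (v k) z - L2_inner \<Omega> u z\<bar> \<le> L2norm \<Omega> (\<lambda>x. v k x - u x) * L2norm \<Omega> z"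
    using L2_Cauchy_Schwarz[OF L2_diff[OF v u] z] by (simp add: L2_inner_diff_left v u z)
qed simp

text \<open>
  Pointwise bounds pass to limits in \<open>L\<^sup>2\<close> through such a subsequence.
\<close>

lemma L2_AE_subsequence:
  fixes u :: "'a \<Rightarrow> 'b::euclidean_space"
  assumes v: "\<And>k. v k \<in> L2 \<Omega>" and u: "u \<in> L2 \<Omega>"
    and lim: "(\<lambda>k. L2norm \<Omega> (\<lambda>x. v k x - u x)) \<longlonglongrightarrow> 0"
  obtains r :: "nat \<Rightarrow> nat" where "strict_mono r"
    "AE x in lebesgue_on \<Omega>. (\<lambda>k. v (r k) x) \<longlonglongrightarrow> u x"
proof -
  let ?d = "\<lambda>k x. (norm (v k x - u x))\<^sup>2"
  have "(\<lambda>k. (L2norm \<Omega> (\<lambda>x. v k x - u x))\<^sup>2) \<longlonglongrightarrow> 0"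
    using tendsto_power[OF lim, of 2] by simp
  then have l1: "(\<lambda>k. \<integral>x. norm (?d k x) \<partial>lebesgue_on \<Omega>) \<longlonglongrightarrow> 0"
    by (simp add: L2norm_square)
  obtain r where r: "strict_mono r" "AE x in lebesgue_on \<Omega>. (\<lambda>k. ?d (r k) x) \<longlonglongrightarrow> 0"
    using tendsto_L1_AE_subseq[OF L2_square_integrable[OF L2_diff[OF v u]] l1] by auto
  have "AE x in lebesgue_on \<Omega>. (\<lambda>k. v (r k) x) \<longlonglongrightarrow> u x"
    using r(2)
  proof eventually_elim
    case (elim x)
    then have "(\<lambda>k. sqrt (?d (r k) x)) \<longlonglongrightarrow> 0" using tendsto_real_sqrt by fastforce
    then have "(\<lambda>k. norm (v (r k) x - u x)) \<longlonglongrightarrow> 0" by simp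
    then show ?case by (simp add: tendsto_norm_zero_iff LIM_zero_iff)
  qed
  with r(1) show ?thesis by (rule that)
qed

text \<open>
  Cauchy--Schwarz against the constant one; the domain has finite measure.
\<close>

lemma L2_norm_integral_le:
  fixes u :: "'a \<Rightarrow> real"
  assumes "u \<in> L2 \<Omega>"
  shows "(\<integral>x. \<bar>u x\<bar> \<partial>lebesgue_on \<Omega>) \<le> sqrt (measure lebesgue \<Omega>) * L2norm \<Omega> u"
proof -
  have a: "(\<lambda>x. \<bar>u x\<bar>) \<in> L2 \<Omega>"
    by (rule L2_dominated[OF assms]) (use assms in auto)
  have "L2norm \<Omega> (\<lambda>x. \<bar>u x\<bar>) = L2norm \<Omega> u" by (simp add: L2norm_def L2_inner_def)
  moreover have "L2norm \<Omega> (\<lambda>x. 1::real) = sqrt (measure lebesgue \<Omega>)"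
    by (simp add: L2norm_def L2_inner_def measure_restrict_space)
  ultimately show ?thesis
    using L2_Cauchy_Schwarz[OF L2_const[of "1::real"] a] by (simp add: L2_inner_def)
qed

text \<open>
  A subsequence along which consecutive distances are at most \<open>(1/2)\<^sup>k\<close> has absolutely summable
  increments almost everywhere, as their integrals are summable on a set of finite measure. Its
  pointwise limit is the \<open>L\<^sup>2\<close> limit by Fatou's lemma.
\<close>

lemma L2_complete:
  fixes v :: "nat \<Rightarrow> 'a \<Rightarrow> 'b::euclidean_space"
  assumes v: "\<And>k. v k \<in> L2 \<Omega>"
    and Cauchy: "\<And>e. e > 0 \<Longrightarrow> \<exists>N. \<forall>m\<ge>N. \<forall>n\<ge>N. L2norm \<Omega> (\<lambda>x. v m x - v n x) < e"
  obtains u where "u \<in> L2 \<Omega>" "(\<lambda>k. L2norm \<Omega> (\<lambda>x. v k x - u x)) \<longlonglongrightarrow> 0"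
proof -
  let ?M = "lebesgue_on \<Omega>"
  have "\<exists>r. \<forall>k. (\<forall>m\<ge>r k. \<forall>n\<ge>r k. L2norm \<Omega> (\<lambda>x. v m x - v n x) < (1/2)^k) \<and> r k \<le> r (Suc k)"
  proof (rule dependent_nat_choice)
    show "\<exists>N. \<forall>m\<ge>N. \<forall>n\<ge>N. L2norm \<Omega> (\<lambda>x. v m x - v n x) < (1/2)^0"
      using Cauchy[of 1] by simp
    fix N k
    obtain N' where N': "\<forall>m\<ge>N'. \<forall>n\<ge>N'. L2norm \<Omega> (\<lambda>x. v m x - v n x) < (1/2)^Suc k"
      using Cauchy[of "(1/2)^Suc k"] by auto
    show "\<exists>N'. (\<forall>m\<ge>N'. \<forall>n\<ge>N'. L2norm \<Omega> (\<lambda>x. v m x - v n x) < (1/2)^Suc k) \<and> N \<le> N'"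
      by (intro exI[of _ "max N N'"]) (use N' in auto)
  qed
  then obtain r where r: "\<And>k m n. m \<ge> r k \<Longrightarrow> n \<ge> r k \<Longrightarrow> L2norm \<Omega> (\<lambda>x. v m x - v n x) < (1/2)^k"
    and rmono: "\<And>k. r k \<le> r (Suc k)" by blast
  let ?s = "\<lambda>k. v (r k)"
  let ?C = "sqrt (measure lebesgue \<Omega>)"
  let ?d = "\<lambda>k x. norm (?s (Suc k) x - ?s k x)"
  have dL2: "?d k \<in> L2 \<Omega>" for k
    by (rule L2_dominated[OF L2_diff[OF v v]]) (use v in auto)
  have dint: "(\<integral>x. ?d k x \<partial>?M) \<le> ?C * (1/2)^k" for k
  proof -
    have "L2norm \<Omega> (?d k) = L2norm \<Omega> (\<lambda>x. ?s (Suc k) x - ?s k x)"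
      by (simp add: L2norm_def L2_inner_def power2_norm_eq_inner[symmetric] power2_eq_square[symmetric])
    also have "\<dots> \<le> (1/2)^k" using r[of k "r (Suc k)" "r k"] rmono[of k] by simp
    finally have "?C * L2norm \<Omega> (?d k) \<le> ?C * (1/2)^k" by (intro mult_left_mono) auto
    with L2_norm_integral_le[OF dL2[of k]] show ?thesis by simp
  qed
  have "AE x in ?M. summable (\<lambda>k. ?d k x)"
  proof -
    have [measurable]: "?d k \<in> borel_measurable ?M" for k using dL2 by measurable
    have "(\<integral>\<^sup>+x. (\<Sum>k. ennreal (?d k x)) \<partial>?M) = (\<Sum>k. \<integral>\<^sup>+x. ennreal (?d k x) \<partial>?M)"
      by (rule nn_integral_suminf) measurable
    also have "\<dots> \<le> (\<Sum>k. ennreal (?C * (1/2)^k))"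
    proof (rule suminf_le)
      show "(\<integral>\<^sup>+x. ennreal (?d k x) \<partial>?M) \<le> ennreal (?C * (1/2)^k)" for k
        using dint[of k] by (subst nn_integral_eq_integral[OF L2_integrable[OF dL2]]) (auto intro: ennreal_leI)
    qed auto
    also have "\<dots> = ennreal (\<Sum>k. ?C * (1/2)^k)"
      by (rule suminf_ennreal2) (auto intro: summable_mult)
    also have "\<dots> < \<infinity>" by simp
    finally have "AE x in ?M. (\<Sum>k. ennreal (?d k x)) \<noteq> \<infinity>"
      by (intro nn_integral_noteq_infinite) auto
    then show ?thesis
      by eventually_elim (auto intro: summable_suminf_not_top)
  qed
  then have lim: "AE x in ?M. convergent (\<lambda>k. ?s k x)"
  proof eventually_elim
    case (elim x)
    then have "summable (\<lambda>k. ?s (Suc k) x - ?s k x)" by (rule summable_norm_cancel)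
    moreover have "(\<Sum>i<n. ?s (Suc i) x - ?s i x) = ?s n x - ?s 0 x" for n
      by (rule sum_lessThan_telescope)
    ultimately show ?case by (simp add: summable_iff_convergent convergent_diff_const_right_iff)
  qed
  define u where "u x = lim (\<lambda>k. ?s k x)" for x
  have lim: "AE x in ?M. (\<lambda>k. ?s k x) \<longlonglongrightarrow> u x"
    using lim by eventually_elim (simp add: u_def convergent_LIMSEQ_iff)
  have um[measurable]: "u \<in> borel_measurable ?M"
    unfolding u_def using v by (intro borel_measurable_lim_metric) auto
  have vm[measurable]: "v k \<in> borel_measurable ?M" for k using v by measurable
  have Fatou: "(\<integral>\<^sup>+x. (norm (v k x - u x))\<^sup>2 \<partial>?M) \<le> ennreal (((1/2)^j)\<^sup>2)" if k: "k \<ge> r j" for j k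
  proof -
    have "(\<integral>\<^sup>+x. (norm (v k x - u x))\<^sup>2 \<partial>?M)
        = (\<integral>\<^sup>+x. liminf (\<lambda>m. ennreal ((norm (v k x - ?s m x))\<^sup>2)) \<partial>?M)"
    proof (rule nn_integral_cong_AE, use lim in eventually_elim)
      case (elim x)
      then have "(\<lambda>m. ennreal ((norm (v k x - ?s m x))\<^sup>2)) \<longlonglongrightarrow> ennreal ((norm (v k x - u x))\<^sup>2)"
        by (intro tendsto_ennrealI tendsto_intros)
      then show ?case by (metis lim_imp_Liminf sequentially_bot)
    qed
    also have "\<dots> \<le> liminf (\<lambda>m. \<integral>\<^sup>+x. ennreal ((norm (v k x - ?s m x))\<^sup>2) \<partial>?M)"
      by (rule nn_integral_liminf) measurable
    also have "\<dots> \<le> ennreal (((1/2)^j)\<^sup>2)"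
    proof (rule Liminf_le)
      have "(\<integral>\<^sup>+x. ennreal ((norm (v k x - ?s m x))\<^sup>2) \<partial>?M) \<le> ennreal (((1/2)^j)\<^sup>2)" if "m \<ge> j" for m
      proof -
        have "r j \<le> r m" using rmono that by (simp add: lift_Suc_mono_le)
        then have "(L2norm \<Omega> (\<lambda>x. v k x - ?s m x))\<^sup>2 \<le> ((1/2)^j)\<^sup>2"
          using r[OF k, of "r m"] by (intro power_mono) auto
        then show ?thesis
          using L2_square_integrable[OF L2_diff[OF v v]]
          by (subst nn_integral_eq_integral) (auto intro!: ennreal_leI simp: L2norm_square)
      qed
      then show "\<forall>\<^sub>F m in sequentially. (\<integral>\<^sup>+x. ennreal ((norm (v k x - ?s m x))\<^sup>2) \<partial>?M) \<le> ennreal (((1/2)^j)\<^sup>2)"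
        by (auto simp: eventually_sequentially)
    qed simp
    finally show ?thesis .
  qed
  have diffL2: "(\<lambda>x. v k x - u x) \<in> L2 \<Omega>" if "k \<ge> r j" for j k
  proof -
    have "integrable ?M (\<lambda>x. (norm (v k x - u x))\<^sup>2)"
      by (rule integrableI_bounded) (use Fatou[OF that] in \<open>auto simp: less_top[symmetric] top_unique\<close>)
    then show ?thesis by (simp add: L2_def)
  qed
  have uL2: "u \<in> L2 \<Omega>"
    using L2_diff[OF v diffL2[OF order_refl], of "r 0" 0] by simp
  have est: "L2norm \<Omega> (\<lambda>x. v k x - u x) \<le> (1/2)^j" if "k \<ge> r j" for j k
  proof -
    have "ennreal ((L2norm \<Omega> (\<lambda>x. v k x - u x))\<^sup>2) \<le> ennreal (((1/2)^j)\<^sup>2)"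
      using Fatou[OF that] L2_square_integrable[OF diffL2[OF that]]
      by (subst (asm) nn_integral_eq_integral) (auto simp: L2norm_square)
    then have "(L2norm \<Omega> (\<lambda>x. v k x - u x))\<^sup>2 \<le> ((1/2)^j)\<^sup>2" by (subst (asm) ennreal_le_iff) auto
    then show ?thesis by (rule power2_le_imp_le) simp
  qed
  have "(\<lambda>k. L2norm \<Omega> (\<lambda>x. v k x - u x)) \<longlonglongrightarrow> 0"
  proof (rule LIMSEQ_I)
    fix e :: real assume "e > 0"
    then obtain j where "(1/2::real)^j < e" using real_arch_pow_inv[of e "1/2"] by auto
    then have "\<forall>k\<ge>r j. norm (L2norm \<Omega> (\<lambda>x. v k x - u x) - 0) < e"
      using est by (auto intro: le_less_trans)
    then show "\<exists>N. \<forall>k\<ge>N. norm (L2norm \<Omega> (\<lambda>x. v k x - u x) - 0) < e" by blast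
  qed
  with uL2 show ?thesis by (rule that)
qed

lemma L2norm_squeeze:
  assumes "\<And>k. L2norm \<Omega> (f k) \<le> b k" "b \<longlonglongrightarrow> (0::real)"
  shows "(\<lambda>k. L2norm \<Omega> (f k)) \<longlonglongrightarrow> 0"
  by (rule tendsto_sandwich[OF _ _ tendsto_const assms(2)]) (use assms(1) in auto)

lemma L2_tendsto_add_scaleR:
  fixes u v :: "nat \<Rightarrow> 'a \<Rightarrow> 'b::euclidean_space"
  assumes "\<And>k. u k \<in> L2 \<Omega>" "u0 \<in> L2 \<Omega>" "\<And>k. v k \<in> L2 \<Omega>" "v0 \<in> L2 \<Omega>"
    and "(\<lambda>k. L2norm \<Omega> (\<lambda>x. u k x - u0 x)) \<longlonglongrightarrow> 0" "(\<lambda>k. L2norm \<Omega> (\<lambda>x. v k x - v0 x)) \<longlonglongrightarrow> 0"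
  shows "(\<lambda>k. L2norm \<Omega> (\<lambda>x. (u k x + c *\<^sub>R v k x) - (u0 x + c *\<^sub>R v0 x))) \<longlonglongrightarrow> 0"
proof (rule L2norm_squeeze)
  show "L2norm \<Omega> (\<lambda>x. (u k x + c *\<^sub>R v k x) - (u0 x + c *\<^sub>R v0 x))
      \<le> L2norm \<Omega> (\<lambda>x. u k x - u0 x) + \<bar>c\<bar> * L2norm \<Omega> (\<lambda>x. v k x - v0 x)" for k
    using L2norm_triangle[OF L2_diff[OF assms(1,2)] L2_scaleR[OF L2_diff[OF assms(3,4)]], of k c k]
    unfolding L2norm_scaleR[symmetric] by (simp add: algebra_simps)
  have "(\<lambda>k. L2norm \<Omega> (\<lambda>x. u k x - u0 x) + \<bar>c\<bar> * L2norm \<Omega> (\<lambda>x. v k x - v0 x)) \<longlonglongrightarrow> 0 + \<bar>c\<bar> * 0"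
    by (intro tendsto_intros assms(5,6))
  then show "(\<lambda>k. L2norm \<Omega> (\<lambda>x. u k x - u0 x) + \<bar>c\<bar> * L2norm \<Omega> (\<lambda>x. v k x - v0 x)) \<longlonglongrightarrow> 0" by simp
qed

lemma L2_tendsto_add:
  fixes u v :: "nat \<Rightarrow> 'a \<Rightarrow> 'b::euclidean_space"
  assumes "\<And>k. u k \<in> L2 \<Omega>" "u0 \<in> L2 \<Omega>" "\<And>k. v k \<in> L2 \<Omega>" "v0 \<in> L2 \<Omega>"
    and "(\<lambda>k. L2norm \<Omega> (\<lambda>x. u k x - u0 x)) \<longlonglongrightarrow> 0" "(\<lambda>k. L2norm \<Omega> (\<lambda>x. v k x - v0 x)) \<longlonglongrightarrow> 0"
  shows "(\<lambda>k. L2norm \<Omega> (\<lambda>x. (u k x + v k x) - (u0 x + v0 x))) \<longlonglongrightarrow> 0"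
  using L2_tendsto_add_scaleR[OF assms, of 1] by simp

text \<open>
  A bounded factor that converges uniformly may multiply an \<open>L\<^sup>2\<close> limit: split
  \<open>a\<^sub>k * h\<^sub>k - b * h\<^sub>0 = a\<^sub>k * (h\<^sub>k - h\<^sub>0) + (a\<^sub>k - b) * h\<^sub>0\<close>.
\<close>

lemma L2_tendsto_mult:
  fixes a :: "nat \<Rightarrow> 'a \<Rightarrow> real" and b h0 :: "'a \<Rightarrow> real"
  assumes a: "\<And>k. a k \<in> borel_measurable (lebesgue_on \<Omega>)" and b: "b \<in> borel_measurable (lebesgue_on \<Omega>)"
    and aC: "\<And>k x. x \<in> \<Omega> \<Longrightarrow> \<bar>a k x\<bar> \<le> C" and bC: "\<And>x. x \<in> \<Omega> \<Longrightarrow> \<bar>b x\<bar> \<le> C" and C: "C \<ge> 0"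
    and unif: "\<And>\<epsilon>. \<epsilon> > 0 \<Longrightarrow> \<forall>\<^sub>F k in sequentially. \<forall>x\<in>\<Omega>. \<bar>a k x - b x\<bar> \<le> \<epsilon>"
    and h: "\<And>k. h k \<in> L2 \<Omega>" and h0: "h0 \<in> L2 \<Omega>"
    and lim: "(\<lambda>k. L2norm \<Omega> (\<lambda>x. h k x - h0 x)) \<longlonglongrightarrow> 0"
  shows "(\<lambda>k. L2norm \<Omega> (\<lambda>x. a k x * h k x - b x * h0 x)) \<longlonglongrightarrow> 0"
proof -
  have mult: "(\<lambda>x. c x * q x) \<in> L2 \<Omega> \<and> L2norm \<Omega> (\<lambda>x. c x * q x) \<le> D * L2norm \<Omega> q"
    if "c \<in> borel_measurable (lebesgue_on \<Omega>)" "\<And>x. x \<in> \<Omega> \<Longrightarrow> \<bar>c x\<bar> \<le> D" "q \<in> L2 \<Omega>" "D \<ge> 0"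
    for c q :: "'a \<Rightarrow> real" and D
  proof -
    have m: "(\<lambda>x. c x * q x) \<in> borel_measurable (lebesgue_on \<Omega>)" using that(1) L2_measurable[OF that(3)] by simp
    have le: "AE x in lebesgue_on \<Omega>. norm (c x * q x) \<le> norm (D * q x)"
      using that(2,4) by (intro AE_I2) (auto simp: abs_mult intro!: mult_right_mono)
    show ?thesis
      using L2_dominated[OF L2_mult_const[OF that(3)] m le] L2norm_mono[OF L2_mult_const[OF that(3)] m le]
        L2norm_scaleR[of D q] that(4) by simp
  qed
  have lim2: "(\<lambda>k. L2norm \<Omega> (\<lambda>x. (a k x - b x) * h0 x)) \<longlonglongrightarrow> 0"
  proof (rule LIMSEQ_I)
    fix \<epsilon> :: real assume \<epsilon>: "\<epsilon> > 0"
    define \<delta> where "\<delta> = \<epsilon> / (L2norm \<Omega> h0 + 1)"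
    have n: "L2norm \<Omega> h0 + 1 > 0" using L2norm_nonneg[of h0] by linarith
    have \<delta>: "\<delta> > 0" "\<delta> * L2norm \<Omega> h0 < \<epsilon>"
      using \<epsilon> n by (auto simp: \<delta>_def field_simps)
    have "\<forall>\<^sub>F k in sequentially. norm (L2norm \<Omega> (\<lambda>x. (a k x - b x) * h0 x) - 0) < \<epsilon>"
      using unif[OF \<delta>(1)]
    proof eventually_elim
      case (elim k)
      have "(\<lambda>x. a k x - b x) \<in> borel_measurable (lebesgue_on \<Omega>)" using a b by simp
      from mult[OF this _ h0, of \<delta>] elim \<delta>
      have "L2norm \<Omega> (\<lambda>x. (a k x - b x) * h0 x) \<le> \<delta> * L2norm \<Omega> h0" by simp
      with \<delta>(2) show ?case by simp
    qed
    then show "\<exists>N. \<forall>k\<ge>N. norm (L2norm \<Omega> (\<lambda>x. (a k x - b x) * h0 x) - 0) < \<epsilon>"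
      unfolding eventually_sequentially .
  qed
  show ?thesis
  proof (rule L2norm_squeeze)
    show "L2norm \<Omega> (\<lambda>x. a k x * h k x - b x * h0 x)
        \<le> C * L2norm \<Omega> (\<lambda>x. h k x - h0 x) + L2norm \<Omega> (\<lambda>x. (a k x - b x) * h0 x)" for k
    proof -
      note 1 = mult[OF a[of k] aC L2_diff[OF h[of k] h0] C]
      have "(\<lambda>x. (a k x - b x) * h0 x) \<in> L2 \<Omega>"
      proof -
        have "(\<lambda>x. a k x * h0 x - b x * h0 x) \<in> L2 \<Omega>"
          using mult[OF a[of k] aC h0 C] mult[OF b bC h0 C] by (intro L2_diff) auto
        then show ?thesis by (simp add: left_diff_distrib)
      qed
      note 2 = L2norm_triangle[OF conjunct1[OF 1] this]
      have "(\<lambda>x. a k x * h k x - b x * h0 x) = (\<lambda>x. a k x * (h k x - h0 x) + (a k x - b x) * h0 x)"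
        by (simp add: fun_eq_iff algebra_simps)
      then show ?thesis using 2 conjunct2[OF 1] by simp
    qed
    have "(\<lambda>k. C * L2norm \<Omega> (\<lambda>x. h k x - h0 x) + L2norm \<Omega> (\<lambda>x. (a k x - b x) * h0 x)) \<longlonglongrightarrow> C * 0 + 0"
      by (intro tendsto_intros lim lim2)
    then show "(\<lambda>k. C * L2norm \<Omega> (\<lambda>x. h k x - h0 x) + L2norm \<Omega> (\<lambda>x. (a k x - b x) * h0 x)) \<longlonglongrightarrow> 0" by simp
  qed
qed

lemma L2_tendsto_uniform:
  fixes u :: "nat \<Rightarrow> 'a \<Rightarrow> real"
  assumes u: "\<And>k. u k \<in> L2 \<Omega>" and u0: "u0 \<in> L2 \<Omega>"
    and unif: "\<And>\<epsilon>. \<epsilon> > 0 \<Longrightarrow> \<forall>\<^sub>F k in sequentially. \<forall>x\<in>\<Omega>. \<bar>u k x - u0 x\<bar> \<le> \<epsilon>"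
  shows "(\<lambda>k. L2norm \<Omega> (\<lambda>x. u k x - u0 x)) \<longlonglongrightarrow> 0"
proof (rule LIMSEQ_I)
  fix \<epsilon> :: real assume \<epsilon>: "\<epsilon> > 0"
  define V where "V = L2norm \<Omega> (\<lambda>x. 1 :: real)"
  have V: "V \<ge> 0" by (simp add: V_def)
  define \<delta> where "\<delta> = \<epsilon> / (V + 1)"
  have \<delta>: "\<delta> > 0" "\<delta> * V < \<epsilon>" using \<epsilon> V by (auto simp: \<delta>_def field_simps)
  have "\<forall>\<^sub>F k in sequentially. norm (L2norm \<Omega> (\<lambda>x. u k x - u0 x) - 0) < \<epsilon>"
    using unif[OF \<delta>(1)]
  proof eventually_elim
    case (elim k)
    have "L2norm \<Omega> (\<lambda>x. u k x - u0 x) \<le> L2norm \<Omega> (\<lambda>x. \<delta> *\<^sub>R (1 :: real))"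
      by (rule L2norm_mono[OF L2_const L2_measurable[OF L2_diff[OF u u0]]], rule AE_I2)
        (use elim \<delta> in auto)
    also have "\<dots> = \<delta> * V" unfolding L2norm_scaleR V_def using \<delta> by simp
    finally show ?case using \<delta>(2) by simp
  qed
  then show "\<exists>N. \<forall>k\<ge>N. norm (L2norm \<Omega> (\<lambda>x. u k x - u0 x) - 0) < \<epsilon>"
    unfolding eventually_sequentially .
qed

lemma L2_tendsto_components:
  fixes u :: "nat \<Rightarrow> 'a \<Rightarrow> 'b::euclidean_space"
  assumes u: "\<And>k. u k \<in> L2 \<Omega>" and u0: "u0 \<in> L2 \<Omega>"
    and lim: "\<And>i. i \<in> Basis \<Longrightarrow> (\<lambda>k. L2norm \<Omega> (\<lambda>x. u k x \<bullet> i - u0 x \<bullet> i)) \<longlonglongrightarrow> 0"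
  shows "(\<lambda>k. L2norm \<Omega> (\<lambda>x. u k x - u0 x)) \<longlonglongrightarrow> 0"
proof (rule L2norm_squeeze)
  show "L2norm \<Omega> (\<lambda>x. u k x - u0 x) \<le> (\<Sum>i\<in>Basis. L2norm \<Omega> (\<lambda>x. u k x \<bullet> i - u0 x \<bullet> i))" for k
  proof -
    let ?d = "\<lambda>x. u k x - u0 x"
    have d: "(\<lambda>x. \<bar>?d x \<bullet> i\<bar>) \<in> L2 \<Omega>" if "i \<in> Basis" for i
      by (rule L2_dominated[OF L2_component[OF L2_diff[OF u u0] that, of k]])
        (use L2_measurable[OF L2_component[OF L2_diff[OF u u0] that, of k]] in auto)
    have "L2norm \<Omega> ?d \<le> L2norm \<Omega> (\<lambda>x. \<Sum>i\<in>Basis. \<bar>?d x \<bullet> i\<bar>)"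
    proof (rule L2norm_mono)
      show "(\<lambda>x. \<Sum>i\<in>Basis. \<bar>?d x \<bullet> i\<bar>) \<in> L2 \<Omega>" by (rule L2_sum[OF d])
      show "?d \<in> borel_measurable (lebesgue_on \<Omega>)" by (rule L2_measurable[OF L2_diff[OF u u0]])
      show "AE x in lebesgue_on \<Omega>. norm (?d x) \<le> norm (\<Sum>i\<in>Basis. \<bar>?d x \<bullet> i\<bar>)"
        unfolding real_norm_def by (intro AE_I2 order_trans[OF norm_le_l1 abs_ge_self])
    qed
    also have "\<dots> \<le> (\<Sum>i\<in>Basis. L2norm \<Omega> (\<lambda>x. \<bar>?d x \<bullet> i\<bar>))"
    proof -
      have "finite I \<Longrightarrow> I \<subseteq> Basis \<Longrightarrow>
          L2norm \<Omega> (\<lambda>x. \<Sum>i\<in>I. \<bar>?d x \<bullet> i\<bar>) \<le> (\<Sum>i\<in>I. L2norm \<Omega> (\<lambda>x. \<bar>?d x \<bullet> i\<bar>))" for I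
      proof (induct I rule: finite_induct)
        case empty
        then show ?case by (simp add: L2norm_def L2_inner_def)
      next
        case (insert i I)
        have "(\<lambda>x. \<Sum>i\<in>I. \<bar>?d x \<bullet> i\<bar>) \<in> L2 \<Omega>" by (rule L2_sum[OF d]) (use insert in auto)
        from L2norm_triangle[OF d[of i] this] insert show ?case by simp
      qed
      then show ?thesis by simp
    qed
    also have "\<dots> = (\<Sum>i\<in>Basis. L2norm \<Omega> (\<lambda>x. u k x \<bullet> i - u0 x \<bullet> i))"
      by (simp add: L2norm_def L2_inner_def inner_diff_left)
    finally show ?thesis .
  qed
  have "(\<lambda>k. \<Sum>i\<in>Basis. L2norm \<Omega> (\<lambda>x. u k x \<bullet> i - u0 x \<bullet> i)) \<longlonglongrightarrow> (\<Sum>i\<in>(Basis :: 'b set). 0)"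
    by (intro tendsto_sum lim)
  then show "(\<lambda>k. \<Sum>i\<in>Basis. L2norm \<Omega> (\<lambda>x. u k x \<bullet> i - u0 x \<bullet> i)) \<longlonglongrightarrow> 0" by simp
qed

end

section \<open>Smooth functions and test functions\<close>

definition smooth :: "('a::euclidean_space \<Rightarrow> real) \<Rightarrow> bool" where
  "smooth f \<longleftrightarrow> (\<forall>k. Ck k f)"

definition gradient :: "('a::euclidean_space \<Rightarrow> real) \<Rightarrow> 'a \<Rightarrow> 'a" where
  "gradient f x = (\<Sum>i\<in>Basis. partial_deriv i f x *\<^sub>R i)"

lemma partial_deriv_eqI: "(f has_derivative D) (at x) \<Longrightarrow> partial_deriv i f x = D i"
  unfolding partial_deriv_def by (metis frechet_derivative_at)

lemma has_derivative_gradient: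
  assumes "f differentiable (at x)"
  shows "(f has_derivative (\<lambda>h. gradient f x \<bullet> h)) (at x)"
proof -
  let ?D = "frechet_derivative f (at x)"
  have D: "(f has_derivative ?D) (at x)"
    using assms frechet_derivative_works by blast
  then interpret linear ?D by (rule has_derivative_linear)
  have "?D h = gradient f x \<bullet> h" for h
  proof -
    have "?D h = ?D (\<Sum>i\<in>Basis. (h \<bullet> i) *\<^sub>R i)" by (simp add: euclidean_representation)
    also have "\<dots> = (\<Sum>i\<in>Basis. (h \<bullet> i) * ?D i)" by (simp add: sum scale)
    also have "\<dots> = gradient f x \<bullet> h"
      by (simp add: gradient_def partial_deriv_def inner_sum_left inner_commute[of h] mult.commute)
    finally show ?thesis .
  qed
  then have "?D = (\<lambda>h. gradient f x \<bullet> h)" by blast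
  with D show ?thesis by simp
qed

lemma gradient_inner_Basis: "i \<in> Basis \<Longrightarrow> gradient f x \<bullet> i = partial_deriv i f x"
  by (simp add: gradient_def inner_sum_left inner_Basis if_distrib cong: if_cong)

lemma Ck_differentiable: "Ck (Suc k) f \<Longrightarrow> f differentiable (at x)"
  by simp

text \<open>
  In the closure properties below, the partial derivatives of a product or a composition contain the
  original functions, which therefore have to be of the lower class too.
\<close>

lemma Ck_Suc_imp_Ck: "Ck (Suc k) f \<Longrightarrow> Ck k f"
proof (induct k arbitrary: f)
  case 0
  then show ?case
    by (auto simp: continuous_on_eq_continuous_at intro: differentiable_imp_continuous_within)
next
  case (Suc k)
  then show ?case by (metis Ck.simps(2))
qed

lemma Ck_const: "Ck k (\<lambda>x. c)"
proof (induct k arbitrary: c)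
  case (Suc k)
  have "partial_deriv i (\<lambda>x. c) = (\<lambda>x. 0)" for i :: 'a
    by (rule ext, rule partial_deriv_eqI[where D = "\<lambda>h. 0"]) simp
  then show ?case using Suc[of 0] by simp
qed simp

lemma Ck_inner: "Ck k (\<lambda>x. x \<bullet> b)"
proof (cases k)
  case (Suc k)
  have "partial_deriv i (\<lambda>x. x \<bullet> b) = (\<lambda>x. i \<bullet> b)" for i :: 'a
    by (rule ext, rule partial_deriv_eqI[where D = "\<lambda>h. h \<bullet> b"]) (auto intro!: derivative_eq_intros)
  then show ?thesis using Suc by (simp add: Ck_const)
qed (auto intro: continuous_intros)

lemma partial_deriv_add:
  assumes "f differentiable (at x)" "g differentiable (at x)"
  shows "partial_deriv i (\<lambda>x. f x + g x) x = partial_deriv i f x + partial_deriv i g x"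
  by (rule partial_deriv_eqI[OF has_derivative_add[OF
        assms(1)[unfolded frechet_derivative_works] assms(2)[unfolded frechet_derivative_works]],
      of i, unfolded partial_deriv_def[symmetric]])

lemma Ck_add: "Ck k f \<Longrightarrow> Ck k g \<Longrightarrow> Ck k (\<lambda>x. f x + g x)"
proof (induct k arbitrary: f g)
  case (Suc k)
  have "partial_deriv i (\<lambda>x. f x + g x) = (\<lambda>x. partial_deriv i f x + partial_deriv i g x)" for i :: 'a
    using Suc.prems by (intro ext partial_deriv_add) auto
  then show ?case using Suc by (auto intro: differentiable_add)
qed (auto intro: continuous_intros)

lemma partial_deriv_mult:
  assumes "f differentiable (at x)" "g differentiable (at x)"
  shows "partial_deriv i (\<lambda>x. f x * g x) x = f x * partial_deriv i g x + partial_deriv i f x * g x"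
  by (rule partial_deriv_eqI[OF has_derivative_mult[OF
        assms(1)[unfolded frechet_derivative_works] assms(2)[unfolded frechet_derivative_works]],
      of i, unfolded partial_deriv_def[symmetric]])

lemma Ck_mult: "Ck k f \<Longrightarrow> Ck k g \<Longrightarrow> Ck k (\<lambda>x. f x * g x)"
proof (induct k arbitrary: f g)
  case (Suc k)
  have "partial_deriv i (\<lambda>x. f x * g x) = (\<lambda>x. f x * partial_deriv i g x + partial_deriv i f x * g x)" for i :: 'a
    using Suc.prems by (intro ext partial_deriv_mult) auto
  moreover have "Ck k (\<lambda>x. f x * partial_deriv i g x + partial_deriv i f x * g x)" if "i \<in> Basis" for i
    using Suc.prems that by (intro Ck_add Suc.hyps Ck_Suc_imp_Ck[of k f] Ck_Suc_imp_Ck[of k g]) auto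
  ultimately show ?case using Suc.prems by (auto intro: differentiable_mult)
qed (auto intro: continuous_intros)

lemma partial_deriv_compose:
  fixes T :: "real \<Rightarrow> real"
  assumes "(T has_real_derivative T') (at (f x))" "f differentiable (at x)"
  shows "partial_deriv i (\<lambda>x. T (f x)) x = T' * partial_deriv i f x"
proof -
  have "((\<lambda>x. T (f x)) has_derivative (\<lambda>h. T' * frechet_derivative f (at x) h)) (at x)"
    using has_derivative_compose[OF assms(2)[unfolded frechet_derivative_works]
        assms(1)[unfolded has_field_derivative_def]] by simp
  from partial_deriv_eqI[OF this, of i] show ?thesis by (simp add: partial_deriv_def)
qed

lemma has_real_derivative_partial_deriv:
  fixes T :: "real \<Rightarrow> real"
  assumes "T differentiable (at x)"
  shows "(T has_real_derivative (partial_deriv 1 T x)) (at x)"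
proof -
  obtain D where D: "(T has_real_derivative D) (at x)"
    using assms real_differentiableE by blast
  then have "partial_deriv 1 T x = D"
    using partial_deriv_eqI[OF D[unfolded has_field_derivative_def], of 1] by simp
  with D show ?thesis by simp
qed

lemma Ck_Suc_real:
  fixes T :: "real \<Rightarrow> real"
  assumes "\<And>x. (T has_real_derivative T' x) (at x)" "Ck k T'"
  shows "Ck (Suc k) T"
proof -
  have "partial_deriv 1 T = T'"
    by (rule ext) (use partial_deriv_eqI[OF assms(1)[unfolded has_field_derivative_def], of 1] in simp)
  then show ?thesis using assms by (simp, metis real_differentiable_def)
qed

lemma Ck_compose:
  fixes T :: "real \<Rightarrow> real"
  shows "Ck k T \<Longrightarrow> Ck k f \<Longrightarrow> Ck k (\<lambda>x. T (f x))"
proof (induct k arbitrary: T)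
  case (Suc k)
  have "partial_deriv i (\<lambda>x. T (f x)) = (\<lambda>x. partial_deriv 1 T (f x) * partial_deriv i f x)" for i
    by (rule ext, rule partial_deriv_compose, rule has_real_derivative_partial_deriv) (use Suc.prems in auto)
  moreover have "Ck k (\<lambda>x. partial_deriv 1 T (f x) * partial_deriv i f x)" if "i \<in> Basis" for i
  proof (rule Ck_mult)
    show "Ck k (\<lambda>x. partial_deriv 1 T (f x))"
      by (rule Suc.hyps) (use Suc.prems Ck_Suc_imp_Ck[of k f] in auto)
  qed (use Suc.prems that in auto)
  moreover have "(\<lambda>x. T (f x)) differentiable (at x)" for x
    by (rule differentiable_compose[of T]) (use Suc.prems in auto)
  ultimately show ?case by simp
next
  case 0
  then show ?case using continuous_on_compose2[of UNIV T UNIV f] by simp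
qed

lemma partial_deriv_affine:
  assumes "f differentiable (at (a + c *\<^sub>R x))"
  shows "partial_deriv i (\<lambda>x. f (a + c *\<^sub>R x)) x = c * partial_deriv i f (a + c *\<^sub>R x)"
proof -
  let ?D = "frechet_derivative f (at (a + c *\<^sub>R x))"
  have D: "(f has_derivative ?D) (at (a + c *\<^sub>R x))"
    using assms by (simp add: frechet_derivative_works)
  have "((\<lambda>x. f (a + c *\<^sub>R x)) has_derivative (\<lambda>h. ?D (c *\<^sub>R h))) (at x)"
    by (rule has_derivative_compose[where g = f and f = "\<lambda>x. a + c *\<^sub>R x", OF _ D]) (auto intro!: derivative_eq_intros)
  then have "partial_deriv i (\<lambda>x. f (a + c *\<^sub>R x)) x = ?D (c *\<^sub>R i)" by (rule partial_deriv_eqI)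
  also have "\<dots> = c * ?D i" using linear_scale[OF has_derivative_linear[OF D]] by simp
  finally show ?thesis by (simp add: partial_deriv_def)
qed

text \<open>
  Covers rescaling, translation and the reflection \<open>y \<mapsto> x - y\<close> needed for convolutions.
\<close>

lemma Ck_affine: "Ck k f \<Longrightarrow> Ck k (\<lambda>x. f (a + c *\<^sub>R x))"
proof (induct k arbitrary: f)
  case (Suc k)
  have "partial_deriv i (\<lambda>x. f (a + c *\<^sub>R x)) = (\<lambda>x. c * partial_deriv i f (a + c *\<^sub>R x))" for i :: 'a
    by (rule ext, rule partial_deriv_affine) (use Suc.prems in auto)
  moreover have "(\<lambda>x. f (a + c *\<^sub>R x)) differentiable (at x)" for x
    by (rule differentiable_compose[of f]) (use Suc.prems in \<open>auto intro!: derivative_intros\<close>)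
  ultimately show ?case using Suc by (auto intro!: Ck_mult Ck_const)
next
  case 0
  then have "continuous_on UNIV f" by simp
  from continuous_on_compose2[OF this, of UNIV "\<lambda>x. a + c *\<^sub>R x"] show ?case
    by (simp add: continuous_intros)
qed

lemma smooth_const: "smooth (\<lambda>x. c)" by (simp add: smooth_def Ck_const)
lemma smooth_inner: "smooth (\<lambda>x. x \<bullet> b)" by (simp add: smooth_def Ck_inner)
lemma smooth_add: "smooth f \<Longrightarrow> smooth g \<Longrightarrow> smooth (\<lambda>x. f x + g x)" by (simp add: smooth_def Ck_add)
lemma smooth_mult: "smooth f \<Longrightarrow> smooth g \<Longrightarrow> smooth (\<lambda>x. f x * g x)" by (simp add: smooth_def Ck_mult)
lemma smooth_diff: "smooth f \<Longrightarrow> smooth g \<Longrightarrow> smooth (\<lambda>x. f x - g x)"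
  using smooth_add[OF _ smooth_mult[OF smooth_const[of "-1"]], of f g] by simp
lemma smooth_sum: "(\<And>i. i \<in> I \<Longrightarrow> smooth (f i)) \<Longrightarrow> smooth (\<lambda>x. \<Sum>i\<in>I. f i x)"
  by (induction I rule: infinite_finite_induct) (auto intro: smooth_add smooth_const)
lemma smooth_compose: "smooth T \<Longrightarrow> smooth f \<Longrightarrow> smooth (\<lambda>x. T (f x))"
  for T :: "real \<Rightarrow> real" by (simp add: smooth_def Ck_compose)
lemma smooth_affine: "smooth f \<Longrightarrow> smooth (\<lambda>x. f (a + c *\<^sub>R x))" by (simp add: smooth_def Ck_affine)
lemma smooth_differentiable: "smooth f \<Longrightarrow> f differentiable (at x)"
  unfolding smooth_def by (metis Ck_differentiable)
lemma smooth_partial_deriv: "smooth f \<Longrightarrow> i \<in> Basis \<Longrightarrow> smooth (partial_deriv i f)"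
  unfolding smooth_def by (metis Ck.simps(2))
lemma smooth_continuous: "smooth f \<Longrightarrow> continuous_on A f"
  unfolding smooth_def by (metis Ck.simps(1) continuous_on_subset subset_UNIV)

text \<open>
  The smooth function \<open>exp (-1/t)\<close> glued to zero, with a polynomial factor in \<open>1/t\<close>: these factors make
  the family closed under differentiation, which gives all derivatives at once.
\<close>

definition flat :: "real poly \<Rightarrow> real \<Rightarrow> real" where
  "flat p t = (if t > 0 then poly p (1 / t) * exp (- (1 / t)) else 0)"

lemma poly_times_exp_tendsto_0: "((\<lambda>y. poly p y * exp (- y)) \<longlongrightarrow> (0::real)) at_top"
proof -
  have "((\<lambda>y. \<Sum>i\<le>degree p. coeff p i * (y ^ i / exp y)) \<longlongrightarrow> (\<Sum>i\<le>degree p. coeff p i * 0)) at_top"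
    by (intro tendsto_intros tendsto_power_div_exp_0)
  moreover have "(\<Sum>i\<le>degree p. coeff p i * (y ^ i / exp y)) = poly p y * exp (- y)" for y :: real
    by (simp add: poly_altdef sum_distrib_right exp_minus divide_inverse mult.assoc)
  ultimately show ?thesis by simp
qed

lemma flat_tendsto_0: "(flat p \<longlongrightarrow> 0) (at 0)"
proof -
  have "((\<lambda>t. poly p (inverse t) * exp (- inverse t)) \<longlongrightarrow> 0) (at_right 0)"
    by (rule filterlim_compose[OF poly_times_exp_tendsto_0 filterlim_inverse_at_top_right])
  then have "(flat p \<longlongrightarrow> 0) (at_right 0)"
    by (rule Lim_transform_eventually) (auto simp: eventually_at_filter flat_def inverse_eq_divide)
  moreover have "(flat p \<longlongrightarrow> 0) (at_left 0)"
    by (rule Lim_transform_eventually[OF tendsto_const]) (auto simp: eventually_at_filter flat_def)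
  ultimately show ?thesis by (simp add: filterlim_split_at)
qed

lemma flat_has_derivative:
  "(flat p has_real_derivative flat ([:0, 0, 1:] * (p - pderiv p)) t) (at t)"
proof -
  consider "t > 0" | "t < 0" | "t = 0" by linarith
  then show ?thesis
  proof cases
    case 1
    have "((\<lambda>t. poly p (1 / t) * exp (- (1 / t))) has_real_derivative
        flat ([:0, 0, 1:] * (p - pderiv p)) t) (at t)"
      using 1 by (auto intro!: derivative_eq_intros DERIV_chain2[OF poly_DERIV]
          simp: flat_def field_simps power2_eq_square)
    then show ?thesis
      by (rule has_field_derivative_transform_within_open[where S = "{0<..}"])
        (use 1 in \<open>auto simp: flat_def\<close>)
  next
    case 2
    have "((\<lambda>t. 0) has_real_derivative flat ([:0, 0, 1:] * (p - pderiv p)) t) (at t)"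
      using 2 by (simp add: flat_def)
    then show ?thesis
      by (rule has_field_derivative_transform_within_open[where S = "{..<0}"])
        (use 2 in \<open>auto simp: flat_def\<close>)
  next
    case 3
    have "((\<lambda>h. flat (pCons 0 p) h) \<longlongrightarrow> 0) (at 0)" by (rule flat_tendsto_0)
    then have "((\<lambda>h. (flat p (0 + h) - flat p 0) / h) \<longlongrightarrow> 0) (at 0)"
      by (rule Lim_transform_eventually) (auto simp: eventually_at_filter flat_def)
    then show ?thesis using 3 by (simp add: DERIV_def flat_def)
  qed
qed

lemma smooth_flat: "smooth (flat p)"
proof -
  have "Ck k (flat p)" for k
  proof (induct k arbitrary: p)
    case 0
    then show ?case
      using flat_has_derivative[THEN DERIV_isCont] by (simp add: continuous_on_eq_continuous_at)
  next
    case (Suc k)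
    then show ?case using Ck_Suc_real[OF flat_has_derivative] by blast
  qed
  then show ?thesis by (simp add: smooth_def)
qed

lemma test_functionsI:
  assumes "smooth \<phi>" "compact K" "K \<subseteq> U" "\<And>x. x \<notin> K \<Longrightarrow> \<phi> x = 0"
  shows "\<phi> \<in> test_functions U"
proof -
  have "closure {x. \<phi> x \<noteq> 0} \<subseteq> K"
    using assms(4) compact_imp_closed[OF assms(2)] by (intro closure_minimal) auto
  moreover from this have "compact (closure {x. \<phi> x \<noteq> 0})"
    by (metis Int_absorb1 assms(2) closed_closure compact_Int_closed)
  ultimately show ?thesis
    using assms(1,3) by (auto simp: test_functions_def smooth_def)
qed

lemma test_functionsE:
  assumes "\<phi> \<in> test_functions U"
  obtains K where "smooth \<phi>" "compact K" "K \<subseteq> U" "\<And>x. x \<notin> K \<Longrightarrow> \<phi> x = 0"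
proof (rule that[of "closure {x. \<phi> x \<noteq> 0}"])
  show "\<phi> x = 0" if "x \<notin> closure {x. \<phi> x \<noteq> 0}" for x
    using that closure_subset[of "{x. \<phi> x \<noteq> 0}"] by blast
qed (use assms in \<open>auto simp: test_functions_def smooth_def\<close>)

lemma test_functions_smooth: "\<phi> \<in> test_functions U \<Longrightarrow> smooth \<phi>"
  by (erule test_functionsE)

lemma test_functions_add:
  assumes "\<phi> \<in> test_functions U" "\<psi> \<in> test_functions U"
  shows "(\<lambda>x. \<phi> x + \<psi> x) \<in> test_functions U"
proof -
  obtain K L where "smooth \<phi>" "compact K" "K \<subseteq> U" "\<And>x. x \<notin> K \<Longrightarrow> \<phi> x = 0"
    "smooth \<psi>" "compact L" "L \<subseteq> U" "\<And>x. x \<notin> L \<Longrightarrow> \<psi> x = 0"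
    using assms by (metis test_functionsE)
  then show ?thesis
    by (intro test_functionsI[of _ "K \<union> L"] smooth_add) auto
qed

lemma test_functions_mult:
  assumes "\<phi> \<in> test_functions U" "smooth f"
  shows "(\<lambda>x. \<phi> x * f x) \<in> test_functions U"
  using assms(1)
proof (rule test_functionsE)
  fix K assume "smooth \<phi>" "compact K" "K \<subseteq> U" "\<And>x. x \<notin> K \<Longrightarrow> \<phi> x = 0"
  then show ?thesis using assms(2) by (intro test_functionsI[of _ K] smooth_mult) auto
qed

lemma test_functions_cmult:
  assumes "\<phi> \<in> test_functions U" shows "(\<lambda>x. c * \<phi> x) \<in> test_functions U"
  using test_functions_mult[OF assms smooth_const[of c]] by (simp add: mult.commute)

lemma test_functions_zero: "(\<lambda>x. 0) \<in> test_functions U"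
  by (rule test_functionsI[of _ "{}"]) (auto simp: smooth_const)

lemma partial_deriv_outside:
  assumes "closed K" "\<And>x. x \<notin> K \<Longrightarrow> \<phi> x = 0" "x \<notin> K"
  shows "partial_deriv i \<phi> x = 0"
proof -
  have "(\<phi> has_derivative (\<lambda>h. 0)) (at x)"
    by (rule has_derivative_transform_within_open[OF has_derivative_const open_Compl[OF assms(1)]])
      (use assms in auto)
  then show ?thesis using partial_deriv_eqI by fastforce
qed

lemma test_functions_partial_deriv:
  assumes "\<phi> \<in> test_functions U" "i \<in> Basis"
  shows "partial_deriv i \<phi> \<in> test_functions U"
  using assms(1)
proof (rule test_functionsE)
  fix K assume "smooth \<phi>" "compact K" "K \<subseteq> U" "\<And>x. x \<notin> K \<Longrightarrow> \<phi> x = 0"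
  then show ?thesis using assms(2)
    by (intro test_functionsI[of _ K] smooth_partial_deriv partial_deriv_outside[of K])
      (auto intro: compact_imp_closed)
qed

lemma test_functions_bounded:
  assumes "\<phi> \<in> test_functions U"
  obtains C where "C \<ge> 0" "\<And>x. \<bar>\<phi> x\<bar> \<le> C"
  using assms
proof (rule test_functionsE)
  fix K assume *: "smooth \<phi>" "compact K" "K \<subseteq> U" "\<And>x. x \<notin> K \<Longrightarrow> \<phi> x = 0"
  then have "bounded (\<phi> ` K)"
    by (intro compact_imp_bounded compact_continuous_image smooth_continuous)
  then obtain C where "\<And>x. x \<in> K \<Longrightarrow> \<bar>\<phi> x\<bar> \<le> C"
    unfolding bounded_iff by auto
  then have "\<bar>\<phi> x\<bar> \<le> max C 0" for x using *(4)[of x] by (cases "x \<in> K") fastforce+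
  then show ?thesis by (intro that[of "max C 0"]) auto
qed

lemma test_functions_gradient_bounded:
  assumes "\<phi> \<in> test_functions U"
  obtains C where "C \<ge> 0" "\<And>x. norm (gradient \<phi> x) \<le> C"
proof -
  have "\<exists>C\<ge>0. \<forall>x. \<bar>partial_deriv i \<phi> x\<bar> \<le> C" if "i \<in> Basis" for i
    using test_functions_bounded[OF test_functions_partial_deriv[OF assms that]] by metis
  then obtain C where C: "\<And>i. i \<in> Basis \<Longrightarrow> C i \<ge> 0" "\<And>i x. i \<in> Basis \<Longrightarrow> \<bar>partial_deriv i \<phi> x\<bar> \<le> C i"
    by metis
  have "norm (gradient \<phi> x) \<le> (\<Sum>i\<in>Basis. C i)" for x
    unfolding gradient_def by (rule sum_norm_le) (use C in simp)
  then show ?thesis using C by (intro that[of "\<Sum>i\<in>Basis. C i"]) (auto intro: sum_nonneg)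
qed

lemma onorm_inner_left_le: "onorm (\<lambda>h. a \<bullet> h) \<le> norm a"
  by (rule onorm_bound) (use Cauchy_Schwarz_ineq2 in auto)

lemma test_functions_Lipschitz:
  assumes "\<phi> \<in> test_functions U"
  obtains C where "C \<ge> 0" "\<And>x y. \<bar>\<phi> x - \<phi> y\<bar> \<le> C * norm (x - y)"
proof (rule test_functions_gradient_bounded[OF assms])
  fix C assume C: "C \<ge> 0" "\<And>x. norm (gradient \<phi> x) \<le> C"
  have "norm (\<phi> x - \<phi> y) \<le> C * norm (x - y)" for x y
  proof (rule differentiable_bound[of UNIV])
    show "(\<phi> has_derivative (\<lambda>h. gradient \<phi> x \<bullet> h)) (at x within UNIV)" for x
      using has_derivative_gradient smooth_differentiable test_functions_smooth[OF assms] by blast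
    show "onorm (\<lambda>h. gradient \<phi> x \<bullet> h) \<le> C" for x
      using C onorm_inner_left_le order_trans by blast
  qed auto
  then show ?thesis using C by (intro that) auto
qed

lemma test_functions_gradient_Lipschitz:
  assumes "\<phi> \<in> test_functions U"
  obtains C where "C \<ge> 0" "\<And>x y. norm (gradient \<phi> x - gradient \<phi> y) \<le> C * norm (x - y)"
proof -
  have "\<exists>C\<ge>0. \<forall>x y. \<bar>partial_deriv i \<phi> x - partial_deriv i \<phi> y\<bar> \<le> C * norm (x - y)" if "i \<in> Basis" for i
    using test_functions_Lipschitz[OF test_functions_partial_deriv[OF assms that]] by metis
  then obtain C where C: "\<And>i. i \<in> Basis \<Longrightarrow> C i \<ge> 0"
    "\<And>i x y. i \<in> Basis \<Longrightarrow> \<bar>partial_deriv i \<phi> x - partial_deriv i \<phi> y\<bar> \<le> C i * norm (x - y)"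
    by metis
  have "norm (gradient \<phi> x - gradient \<phi> y) \<le> (\<Sum>i\<in>Basis. C i) * norm (x - y)" for x y
    unfolding gradient_def sum_subtractf[symmetric] sum_distrib_right
    by (rule sum_norm_le) (use C in \<open>simp add: scaleR_left_diff_distrib[symmetric]\<close>)
  then show ?thesis using C by (intro that[of "\<Sum>i\<in>Basis. C i"]) (auto intro: sum_nonneg)
qed

text \<open>
  The gradient of a test function is Lipschitz, because the partial derivatives are test functions
  themselves; so the first-order remainder is quadratic, uniformly in \<open>x\<close>.
\<close>

lemma test_functions_Taylor:
  assumes "\<phi> \<in> test_functions U"
  obtains C where "C \<ge> 0" "\<And>x h. \<bar>\<phi> (x + h) - \<phi> x - gradient \<phi> x \<bullet> h\<bar> \<le> C * (norm h)\<^sup>2"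
proof (rule test_functions_gradient_Lipschitz[OF assms])
  fix C assume C: "C \<ge> 0" "\<And>x y. norm (gradient \<phi> x - gradient \<phi> y) \<le> C * norm (x - y)"
  have "norm (\<phi> (x + h) - \<phi> x - gradient \<phi> x \<bullet> h) \<le> C * (norm h)\<^sup>2" for x h
  proof -
    have "norm (\<phi> (x + h) - \<phi> x - (\<lambda>k. gradient \<phi> x \<bullet> k) (x + h - x)) \<le> norm (x + h - x) * (C * norm h)"
    proof (rule differentiable_bound_linearization[where S = "closed_segment x (x + h)"
          and f' = "\<lambda>z k. gradient \<phi> z \<bullet> k"])
      show "x + t *\<^sub>R (x + h - x) \<in> closed_segment x (x + h)" if "t \<in> {0..1}" for t
        using that by (auto simp: in_segment algebra_simps intro!: exI[of _ t])
      show "(\<phi> has_derivative (\<lambda>k. gradient \<phi> z \<bullet> k)) (at z within closed_segment x (x + h))" for z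
        using has_derivative_gradient smooth_differentiable test_functions_smooth[OF assms]
          has_derivative_at_withinI by blast
      show "onorm ((\<lambda>k. gradient \<phi> z \<bullet> k) - (\<lambda>k. gradient \<phi> x \<bullet> k)) \<le> C * norm h"
        if "z \<in> closed_segment x (x + h)" for z
      proof -
        have "((\<lambda>k. gradient \<phi> z \<bullet> k) - (\<lambda>k. gradient \<phi> x \<bullet> k)) = (\<lambda>k. (gradient \<phi> z - gradient \<phi> x) \<bullet> k)"
          by (auto simp: inner_diff_left)
        moreover have "norm (z - x) \<le> norm h"
          using segment_bound1[OF that] by simp
        then have "norm (gradient \<phi> z - gradient \<phi> x) \<le> C * norm h"
          using C(2)[of z x] mult_left_mono[OF _ C(1)] order_trans by blast
        ultimately show ?thesis using onorm_inner_left_le order_trans by metis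
      qed
    qed auto
    then show ?thesis by (simp add: power2_eq_square mult_ac)
  qed
  then show ?thesis using C by (intro that) auto
qed

section \<open>Convolution and mollifiers\<close>

lemma integral_lborel_translate:
  fixes f :: "'a::euclidean_space \<Rightarrow> real"
  assumes "f \<in> borel_measurable borel"
  shows "(\<integral>x. f (a + x) \<partial>lborel) = (\<integral>x. f x \<partial>lborel)"
proof -
  have "(\<integral>x. f x \<partial>lborel) = (\<integral>x. f x \<partial>distr lborel borel ((+) a))"
    by (simp add: lborel_distr_plus)
  also have "\<dots> = (\<integral>x. f (a + x) \<partial>lborel)"
    by (rule integral_distr) (use assms in auto)
  finally show ?thesis by simp
qed

lemma integrable_lborel_translate:
  fixes f :: "'a::euclidean_space \<Rightarrow> real"
  assumes "integrable lborel f"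
  shows "integrable lborel (\<lambda>x. f (a + x))"
proof -
  have "integrable (distr lborel borel ((+) a)) f"
    using assms by (simp add: lborel_distr_plus)
  then show ?thesis
    by (rule integrable_distr[rotated]) simp
qed

lemma integrable_compact_support:
  fixes f :: "'a::euclidean_space \<Rightarrow> real"
  assumes "continuous_on UNIV f" "compact K" "\<And>x. x \<notin> K \<Longrightarrow> f x = 0"
  shows "integrable lborel f"
proof -
  have "integrable lborel (\<lambda>x. indicator K x *\<^sub>R f x)"
    by (rule borel_integrable_compact) (use assms(2) continuous_on_subset[OF assms(1)] in auto)
  moreover have "(\<lambda>x. indicator K x *\<^sub>R f x) = f"
    using assms(3) by (fastforce simp: indicator_def)
  ultimately show ?thesis by simp
qed

lemma smooth_borel[measurable_dest]: "smooth f \<Longrightarrow> f \<in> borel_measurable borel"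
  by (rule borel_measurable_continuous_onI[OF smooth_continuous])

lemma test_functions_integrable: "\<phi> \<in> test_functions U \<Longrightarrow> integrable lborel \<phi>"
  by (erule test_functionsE, rule integrable_compact_support) (auto intro: smooth_continuous)

lemma test_functions_borel: "\<phi> \<in> test_functions U \<Longrightarrow> \<phi> \<in> borel_measurable borel"
  by (simp add: smooth_borel test_functions_smooth)

text \<open>
  Difference quotients have integral zero by translation invariance, and they converge to the partial
  derivative uniformly on a fixed ball that contains all supports.
\<close>

lemma integral_partial_deriv_eq_0:
  fixes \<phi> :: "'a::euclidean_space \<Rightarrow> real"
  assumes \<phi>: "\<phi> \<in> test_functions U" and i: "i \<in> Basis"
  shows "(\<integral>x. partial_deriv i \<phi> x \<partial>lborel) = 0"
proof (rule test_functionsE[OF \<phi>])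
  fix K assume K: "smooth \<phi>" "compact K" "K \<subseteq> U" "\<And>x. x \<notin> K \<Longrightarrow> \<phi> x = 0"
  obtain R where R: "K \<subseteq> cball 0 R"
    using compact_imp_bounded[OF K(2)] by (auto simp: bounded_iff subset_iff)
  obtain C where C: "C \<ge> 0" "\<And>x h. \<bar>\<phi> (x + h) - \<phi> x - gradient \<phi> x \<bullet> h\<bar> \<le> C * (norm h)\<^sup>2"
    using test_functions_Taylor[OF \<phi>] by metis
  let ?V = "measure lborel (cball (0::'a) (R + 1))"
  have bound: "\<bar>\<integral>x. partial_deriv i \<phi> x \<partial>lborel\<bar> \<le> C * ?V * h" if h: "0 < h" "h \<le> 1" for h
  proof -
    let ?q = "\<lambda>x. (\<phi> (h *\<^sub>R i + x) - \<phi> x) / h"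
    have int: "integrable lborel (\<lambda>x. \<phi> (h *\<^sub>R i + x))" "integrable lborel \<phi>"
      "integrable lborel (partial_deriv i \<phi>)"
      using integrable_lborel_translate test_functions_integrable[OF \<phi>]
        test_functions_integrable[OF test_functions_partial_deriv[OF \<phi> i]] by auto
    have "\<bar>\<integral>x. partial_deriv i \<phi> x \<partial>lborel\<bar> = \<bar>\<integral>x. ?q x - partial_deriv i \<phi> x \<partial>lborel\<bar>"
      using int integral_lborel_translate[OF test_functions_borel[OF \<phi>], of "h *\<^sub>R i"] by simp
    also have "\<dots> \<le> (\<integral>x. C * h * indicator (cball (0::'a) (R + 1)) x \<partial>lborel)"
    proof (rule order_trans[OF integral_abs_bound], rule integral_mono)
      show "integrable lborel (\<lambda>x. \<bar>?q x - partial_deriv i \<phi> x\<bar>)" using int by simp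
      show "integrable lborel (\<lambda>x. C * h * indicator (cball (0::'a) (R + 1)) x)"
        by (intro integrable_mult_right integrable_real_indicator) (use emeasure_lborel_cball_finite[of "0::'a" "R + 1"] in auto)
      show "\<bar>?q x - partial_deriv i \<phi> x\<bar> \<le> C * h * indicator (cball 0 (R + 1)) x" for x
      proof (cases "x \<in> cball 0 (R + 1)")
        case True
        have "\<bar>\<phi> (x + h *\<^sub>R i) - \<phi> x - h * partial_deriv i \<phi> x\<bar> \<le> C * h\<^sup>2"
          using C(2)[of x "h *\<^sub>R i"] i h by (simp add: gradient_inner_Basis norm_Basis)
        moreover have "?q x - partial_deriv i \<phi> x = (\<phi> (x + h *\<^sub>R i) - \<phi> x - h * partial_deriv i \<phi> x) / h"
          using h by (simp add: field_simps add.commute)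
        ultimately have "\<bar>?q x - partial_deriv i \<phi> x\<bar> \<le> C * h\<^sup>2 / h"
          using h by (simp add: abs_divide divide_right_mono)
        then show ?thesis using True h by (simp add: power2_eq_square)
      next
        case False
        have "norm x \<le> norm (h *\<^sub>R i + x) + norm (h *\<^sub>R i)"
          using norm_triangle_sub[of x "- (h *\<^sub>R i)"] by (simp add: add.commute)
        then have "h *\<^sub>R i + x \<notin> K" "x \<notin> K"
          using False R h i by (auto simp: norm_Basis subset_iff)
        then show ?thesis
          using K(4) partial_deriv_outside[OF compact_imp_closed[OF K(2)] K(4)] C h by simp
      qed
    qed
    also have "\<dots> = C * ?V * h" by simp
    finally show ?thesis .
  qed
  have "((\<lambda>h. C * ?V * h) \<longlongrightarrow> C * ?V * 0) (at_right 0)" by (intro tendsto_intros)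
  moreover have "\<forall>\<^sub>F h in at_right 0. \<bar>\<integral>x. partial_deriv i \<phi> x \<partial>lborel\<bar> \<le> C * ?V * h"
    unfolding eventually_at_right_field by (intro exI[of _ 1]) (auto intro: bound)
  ultimately have "\<bar>\<integral>x. partial_deriv i \<phi> x \<partial>lborel\<bar> \<le> C * ?V * 0"
    by (intro tendsto_lowerbound) auto
  then show ?thesis by simp
qed

text \<open>
  The product is a test function, so the integral of its partial derivative vanishes.
\<close>

lemma integration_by_parts:
  fixes \<phi> :: "'a::euclidean_space \<Rightarrow> real"
  assumes \<phi>: "\<phi> \<in> test_functions U" and f: "smooth f" and i: "i \<in> Basis"
  shows "(\<integral>x. f x * partial_deriv i \<phi> x \<partial>lborel) = - (\<integral>x. partial_deriv i f x * \<phi> x \<partial>lborel)"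
proof -
  have 1: "(\<lambda>x. \<phi> x * f x) \<in> test_functions U" by (rule test_functions_mult[OF \<phi> f])
  have "partial_deriv i (\<lambda>x. \<phi> x * f x) = (\<lambda>x. \<phi> x * partial_deriv i f x + partial_deriv i \<phi> x * f x)"
    by (rule ext, rule partial_deriv_mult) (simp_all add: smooth_differentiable test_functions_smooth[OF \<phi>] f)
  with integral_partial_deriv_eq_0[OF 1 i]
  have "(\<integral>x. \<phi> x * partial_deriv i f x + partial_deriv i \<phi> x * f x \<partial>lborel) = 0" by simp
  moreover have "integrable lborel (\<lambda>x. \<phi> x * partial_deriv i f x)" "integrable lborel (\<lambda>x. partial_deriv i \<phi> x * f x)"
    using test_functions_integrable[OF test_functions_mult[OF \<phi> smooth_partial_deriv[OF f i]]]
      test_functions_integrable[OF test_functions_mult[OF test_functions_partial_deriv[OF \<phi> i] f]] by auto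
  ultimately show ?thesis by (simp add: mult.commute)
qed

definition bump :: "'a::euclidean_space \<Rightarrow> real" where
  "bump x = flat 1 (1 - x \<bullet> x)"

lemma smooth_bump: "smooth bump"
proof -
  have "smooth (\<lambda>x::'a. 1 - (\<Sum>i\<in>Basis. (x \<bullet> i) * (x \<bullet> i)))"
    by (intro smooth_diff smooth_sum smooth_mult smooth_inner smooth_const)
  from smooth_compose[OF smooth_flat this] show ?thesis
    unfolding bump_def by (subst euclidean_inner)
qed

lemma bump_nonneg: "0 \<le> bump x"
  by (simp add: bump_def flat_def)

lemma bump_pos_iff: "0 < bump x \<longleftrightarrow> norm x < 1"
  by (simp add: bump_def flat_def power2_norm_eq_inner[symmetric] abs_square_less_1)

lemma bump_eq_0_iff: "bump x = 0 \<longleftrightarrow> norm x \<ge> 1"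
  using bump_pos_iff[of x] bump_nonneg[of x] by linarith

lemma bump_minus: "bump (- x) = bump x"
  by (simp add: bump_def)

definition mollifier :: "real \<Rightarrow> 'a::euclidean_space \<Rightarrow> real" where
  "mollifier e x = bump (x /\<^sub>R e) / (\<integral>y. bump ((y::'a) /\<^sub>R e) \<partial>lborel)"

context
  fixes e :: real
  assumes e: "e > 0"
begin

lemma scaled_bump_test: "(\<lambda>x. bump (x /\<^sub>R e)) \<in> test_functions UNIV"
proof (rule test_functionsI[of _ "cball 0 e"])
  show "smooth (\<lambda>x. bump (x /\<^sub>R e))"
    using smooth_affine[OF smooth_bump, of 0 "inverse e"] by simp
qed (use e in \<open>auto simp: bump_eq_0_iff field_simps\<close>)

lemma scaled_bump_integral_pos: "0 < (\<integral>y. bump ((y::'a::euclidean_space) /\<^sub>R e) \<partial>lborel)"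
proof (rule ccontr)
  assume "\<not> ?thesis"
  moreover have "0 \<le> (\<integral>y. bump ((y::'a) /\<^sub>R e) \<partial>lborel)"
    by (intro integral_nonneg_AE) (simp add: bump_nonneg)
  ultimately have "(\<integral>y. bump ((y::'a) /\<^sub>R e) \<partial>lborel) = 0" by simp
  then have "AE y in lborel. bump ((y::'a) /\<^sub>R e) = 0"
    using test_functions_integrable[OF scaled_bump_test]
    by (subst (asm) integral_nonneg_eq_0_iff_AE) (auto simp: bump_nonneg)
  then have "AE y in lborel. (y::'a) \<notin> ball 0 e"
    by eventually_elim (use e in \<open>auto simp: bump_eq_0_iff field_simps\<close>)
  then have "emeasure lborel (ball (0::'a) e) = 0"
    by (subst (asm) AE_iff_measurable[of "ball 0 e"]) auto
  then show False
    using e unit_ball_vol_pos[of "real DIM('a)"] by (simp add: emeasure_ball)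
qed

lemma mollifier_test: "mollifier e \<in> test_functions UNIV"
  using test_functions_cmult[OF scaled_bump_test] unfolding mollifier_def divide_inverse
  by (subst mult.commute)

lemma mollifier_nonneg: "0 \<le> mollifier e x"
  unfolding mollifier_def using scaled_bump_integral_pos by (simp add: bump_nonneg)

lemma mollifier_eq_0: "norm x \<ge> e \<Longrightarrow> mollifier e x = 0"
  unfolding mollifier_def using e by (simp add: bump_eq_0_iff field_simps)

lemma mollifier_minus_commute: "mollifier e (x - y) = mollifier e (y - x)"
  unfolding mollifier_def using bump_minus[of "(x - y) /\<^sub>R e"] by (simp add: scaleR_right_diff_distrib)

lemma mollifier_integral: "(\<integral>x. mollifier e x \<partial>lborel) = 1"
  unfolding mollifier_def by (simp add: less_imp_neq[OF scaled_bump_integral_pos, symmetric])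

lemma mollifier_borel[measurable]: "mollifier e \<in> borel_measurable borel"
  by (rule test_functions_borel[OF mollifier_test])

lemma mollifier_shift_integrable: "integrable lborel (\<lambda>y. mollifier e (x - y))"
  using integrable_lborel_translate[OF test_functions_integrable[OF mollifier_test], of "- x"]
  by (subst mollifier_minus_commute) simp

lemma mollifier_shift_integral: "(\<integral>y. mollifier e (x - y) \<partial>lborel) = 1"
  using integral_lborel_translate[OF mollifier_borel, of "- x"]
  by (subst mollifier_minus_commute) (simp add: mollifier_integral)

end

definition conv :: "('a::euclidean_space \<Rightarrow> real) \<Rightarrow> ('a \<Rightarrow> real) \<Rightarrow> 'a \<Rightarrow> real" where
  "conv \<phi> F x = (\<integral>y. \<phi> (x - y) * F y \<partial>lborel)"

lemma conv_integrable:
  fixes F :: "'a::euclidean_space \<Rightarrow> real"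
  assumes \<phi>: "\<phi> \<in> test_functions UNIV" and F: "integrable lborel F"
  shows "integrable lborel (\<lambda>y. \<phi> (x - y) * F y)"
proof -
  obtain C where C: "C \<ge> 0" "\<And>x. \<bar>\<phi> x\<bar> \<le> C" using test_functions_bounded[OF \<phi>] by metis
  have [measurable]: "\<phi> \<in> borel_measurable borel" "F \<in> borel_measurable borel"
    using test_functions_borel[OF \<phi>] F by auto
  show ?thesis
  proof (rule Bochner_Integration.integrable_bound)
    show "integrable lborel (\<lambda>y. C * F y)" using F by simp
    show "AE y in lborel. norm (\<phi> (x - y) * F y) \<le> norm (C * F y)"
      using C by (auto simp: abs_mult intro!: mult_right_mono)
  qed measurable
qed

lemma conv_add_scale:
  fixes F :: "'a::euclidean_space \<Rightarrow> real"
  assumes "\<phi> \<in> test_functions UNIV" "integrable lborel F" "integrable lborel G"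
  shows "conv \<phi> (\<lambda>x. F x + c * G x) x = conv \<phi> F x + c * conv \<phi> G x"
proof -
  have "conv \<phi> (\<lambda>x. F x + c * G x) x = (\<integral>y. \<phi> (x - y) * F y + c * (\<phi> (x - y) * G y) \<partial>lborel)"
    unfolding conv_def by (simp add: algebra_simps)
  then show ?thesis
    using conv_integrable[OF assms(1,2), of x] conv_integrable[OF assms(1,3), of x] by (simp add: conv_def)
qed

text \<open>
  The quadratic Taylor remainder of \<open>\<phi>\<close> is integrated against \<open>F\<close>, so the derivative may be taken
  inside the integral.
\<close>

lemma conv_has_derivative:
  fixes F :: "'a::euclidean_space \<Rightarrow> real"
  assumes \<phi>: "\<phi> \<in> test_functions UNIV" and F: "integrable lborel F"
  shows "(conv \<phi> F has_derivative (\<lambda>h. \<Sum>i\<in>Basis. (h \<bullet> i) * conv (partial_deriv i \<phi>) F x)) (at x)"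
proof -
  let ?D = "\<lambda>h. \<Sum>i\<in>Basis. (h \<bullet> i) * conv (partial_deriv i \<phi>) F x"
  obtain C where C: "C \<ge> 0" "\<And>x h. \<bar>\<phi> (x + h) - \<phi> x - gradient \<phi> x \<bullet> h\<bar> \<le> C * (norm h)\<^sup>2"
    using test_functions_Taylor[OF \<phi>] by metis
  let ?A = "\<integral>y. \<bar>F y\<bar> \<partial>lborel"
  have grad: "(\<Sum>i\<in>Basis. (h \<bullet> i) * (partial_deriv i \<phi> z * c)) = (gradient \<phi> z \<bullet> h) * c" for z h c
    by (simp add: gradient_def inner_sum_left sum_distrib_right sum_distrib_left inner_commute[of h] mult_ac)
  have bound: "\<bar>conv \<phi> F (x + h) - conv \<phi> F x - ?D h\<bar> \<le> C * ?A * norm h * norm h" for h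
  proof -
    have int: "integrable lborel (\<lambda>y. \<phi> (x + h - y) * F y)" "integrable lborel (\<lambda>y. \<phi> (x - y) * F y)"
      "\<And>i. i \<in> Basis \<Longrightarrow> integrable lborel (\<lambda>y. partial_deriv i \<phi> (x - y) * F y)"
      using conv_integrable \<phi> F test_functions_partial_deriv by blast+
    have "?D h = (\<integral>y. (\<Sum>i\<in>Basis. (h \<bullet> i) * (partial_deriv i \<phi> (x - y) * F y)) \<partial>lborel)"
      unfolding conv_def using int(3) by (simp add: Bochner_Integration.integral_sum)
    also have "\<dots> = (\<integral>y. (gradient \<phi> (x - y) \<bullet> h) * F y \<partial>lborel)"
      by (simp only: grad)
    finally have D: "?D h = (\<integral>y. (gradient \<phi> (x - y) \<bullet> h) * F y \<partial>lborel)" .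
    have "integrable lborel (\<lambda>y. \<Sum>i\<in>Basis. (h \<bullet> i) * (partial_deriv i \<phi> (x - y) * F y))"
      using int(3) by (intro Bochner_Integration.integrable_sum) auto
    then have "integrable lborel (\<lambda>y. (gradient \<phi> (x - y) \<bullet> h) * F y)"
      by (simp only: grad)
    note int = int(1,2) this
    have "conv \<phi> F (x + h) - conv \<phi> F x - ?D h
        = (\<integral>y. (\<phi> (x + h - y) - \<phi> (x - y) - gradient \<phi> (x - y) \<bullet> h) * F y \<partial>lborel)"
      unfolding D using int by (simp add: conv_def left_diff_distrib)
    also have "\<bar>\<dots>\<bar> \<le> (\<integral>y. C * (norm h)\<^sup>2 * \<bar>F y\<bar> \<partial>lborel)"
    proof (rule order_trans[OF integral_abs_bound], rule integral_mono)
      show "integrable lborel (\<lambda>y. \<bar>(\<phi> (x + h - y) - \<phi> (x - y) - gradient \<phi> (x - y) \<bullet> h) * F y\<bar>)"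
        using int by (intro integrable_abs) (simp add: left_diff_distrib)
      show "\<bar>(\<phi> (x + h - y) - \<phi> (x - y) - gradient \<phi> (x - y) \<bullet> h) * F y\<bar> \<le> C * (norm h)\<^sup>2 * \<bar>F y\<bar>" for y
        using C(2)[of "x - y" h] by (simp add: abs_mult mult_right_mono diff_add_eq)
    qed (use F in simp)
    finally show ?thesis by (simp add: power2_eq_square mult_ac)
  qed
  show ?thesis
    unfolding has_derivative_at
  proof
    show "bounded_linear ?D"
      by (intro bounded_linear_sum bounded_linear_mult_const bounded_linear_inner_left)
    show "(\<lambda>h. norm (conv \<phi> F (x + h) - conv \<phi> F x - ?D h) / norm h) \<midarrow>0\<rightarrow> 0"
    proof (rule tendsto_sandwich[OF _ _ tendsto_const])
      have "((\<lambda>h::'a. C * ?A * norm h) \<longlongrightarrow> C * ?A * norm (0::'a)) (at 0)" by (intro tendsto_intros)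
      then show "((\<lambda>h::'a. C * ?A * norm h) \<longlongrightarrow> 0) (at 0)" by simp
      have "norm (conv \<phi> F (x + h) - conv \<phi> F x - ?D h) / norm h \<le> C * ?A * norm h" if "h \<noteq> 0" for h
        using bound[of h] that by (simp add: divide_le_eq)
      then show "\<forall>\<^sub>F h in at 0. norm (conv \<phi> F (x + h) - conv \<phi> F x - ?D h) / norm h \<le> C * ?A * norm h"
        by (auto simp: eventually_at_filter)
    qed simp
  qed
qed

lemma partial_deriv_conv:
  fixes F :: "'a::euclidean_space \<Rightarrow> real"
  assumes \<phi>: "\<phi> \<in> test_functions UNIV" and F: "integrable lborel F" and i: "i \<in> Basis"
  shows "partial_deriv i (conv \<phi> F) = conv (partial_deriv i \<phi>) F"
proof
  fix x
  have "partial_deriv i (conv \<phi> F) x = (\<Sum>j\<in>Basis. (i \<bullet> j) * conv (partial_deriv j \<phi>) F x)"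
    by (rule partial_deriv_eqI[OF conv_has_derivative[OF \<phi> F]])
  also have "\<dots> = (\<Sum>j\<in>Basis. if i = j then conv (partial_deriv j \<phi>) F x else 0)"
    using i by (intro sum.cong) (auto simp: inner_Basis)
  also have "\<dots> = conv (partial_deriv i \<phi>) F x" using i by simp
  finally show "partial_deriv i (conv \<phi> F) x = conv (partial_deriv i \<phi>) F x" .
qed

lemma smooth_conv:
  fixes F :: "'a::euclidean_space \<Rightarrow> real"
  assumes "\<phi> \<in> test_functions UNIV" and F: "integrable lborel F"
  shows "smooth (conv \<phi> F)"
proof -
  have "Ck k (conv \<phi> F)" for k
    using assms(1)
  proof (induct k arbitrary: \<phi>)
    case 0
    then show ?case
      using has_derivative_continuous[OF conv_has_derivative[OF 0 F]]
      by (simp add: continuous_on_eq_continuous_at)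
  next
    case (Suc k)
    have "conv \<phi> F differentiable (at x)" for x
      using conv_has_derivative[OF Suc.prems F] differentiableI by blast
    then show ?case
      using Suc by (auto simp: partial_deriv_conv F test_functions_partial_deriv)
  qed
  then show ?thesis by (simp add: smooth_def)
qed

text \<open>
  A mollification is an average over a ball of radius \<open>e\<close>: closeness of \<open>F\<close> to a constant on that ball is
  inherited. This one estimate yields uniform convergence, values of cutoff functions and supports.
\<close>

lemma mollify_close:
  fixes F :: "'a::euclidean_space \<Rightarrow> real"
  assumes e: "e > 0" and F: "integrable lborel F" and close: "\<And>y. norm (x - y) < e \<Longrightarrow> \<bar>F y - a\<bar> \<le> s"
  shows "\<bar>conv (mollifier e) F x - a\<bar> \<le> s"
proof -
  note int = mollifier_shift_integrable[OF e, of x] conv_integrable[OF mollifier_test[OF e] F, of x]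
  have "conv (mollifier e) F x - a = (\<integral>y. mollifier e (x - y) * (F y - a) \<partial>lborel)"
    using int by (simp add: conv_def right_diff_distrib mollifier_shift_integral[OF e])
  also have "\<bar>\<dots>\<bar> \<le> (\<integral>y. mollifier e (x - y) * s \<partial>lborel)"
  proof (rule order_trans[OF integral_abs_bound], rule integral_mono)
    show "\<bar>mollifier e (x - y) * (F y - a)\<bar> \<le> mollifier e (x - y) * s" for y
      using close[of y] mollifier_nonneg[OF e, of "x - y"] mollifier_eq_0[OF e, of "x - y"]
      by (cases "norm (x - y) < e") (auto simp: abs_mult intro: mult_left_mono)
  qed (use int in \<open>auto simp: right_diff_distrib\<close>)
  also have "\<dots> = s" by (simp add: mollifier_shift_integral[OF e])
  finally show ?thesis .
qed

text \<open>
  Jensen's inequality for the probability density \<open>y \<mapsto> mollifier e (x - y)\<close>, integrated over \<open>x\<close> with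
  Tonelli's theorem.
\<close>

lemma mollify_L2:
  fixes F :: "'a::euclidean_space \<Rightarrow> real"
  assumes e: "e > 0" and F: "integrable lborel F" and F2: "integrable lborel (\<lambda>x. (F x)\<^sup>2)"
  shows "integrable lborel (\<lambda>x. (conv (mollifier e) F x)\<^sup>2)"
    and "(\<integral>x. (conv (mollifier e) F x)\<^sup>2 \<partial>lborel) \<le> (\<integral>x. (F x)\<^sup>2 \<partial>lborel)"
proof -
  have [measurable]: "F \<in> borel_measurable borel" "mollifier e \<in> borel_measurable (borel :: 'a measure)"
    "conv (mollifier e) F \<in> borel_measurable borel"
    using F mollifier_borel[OF e] smooth_borel[OF smooth_conv[OF mollifier_test[OF e] F]] by auto
  have Jensen: "(conv (mollifier e) F x)\<^sup>2 \<le> (\<integral>y. mollifier e (x - y) * (F y)\<^sup>2 \<partial>lborel)" for x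
  proof -
    let ?m = "conv (mollifier e) F x"
    note int = mollifier_shift_integrable[OF e, of x] conv_integrable[OF mollifier_test[OF e] F, of x]
      conv_integrable[OF mollifier_test[OF e] F2, of x]
    have "0 \<le> (\<integral>y. mollifier e (x - y) * (F y - ?m)\<^sup>2 \<partial>lborel)"
      by (intro integral_nonneg_AE) (simp add: mollifier_nonneg[OF e])
    also have "\<dots> = (\<integral>y. mollifier e (x - y) * (F y)\<^sup>2 + ?m\<^sup>2 * mollifier e (x - y) - 2 * ?m * (mollifier e (x - y) * F y) \<partial>lborel)"
      by (simp add: power2_diff algebra_simps)
    also have "\<dots> = (\<integral>y. mollifier e (x - y) * (F y)\<^sup>2 \<partial>lborel) - ?m\<^sup>2"
      using int by (simp add: mollifier_shift_integral[OF e] conv_def power2_eq_square)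
    finally show ?thesis by simp
  qed
  have "(\<integral>\<^sup>+x. (conv (mollifier e) F x)\<^sup>2 \<partial>lborel) \<le> (\<integral>\<^sup>+x. \<integral>\<^sup>+y. ennreal (mollifier e (x - y) * (F y)\<^sup>2) \<partial>lborel \<partial>lborel)"
  proof (rule nn_integral_mono)
    fix x
    show "ennreal ((conv (mollifier e) F x)\<^sup>2) \<le> (\<integral>\<^sup>+y. ennreal (mollifier e (x - y) * (F y)\<^sup>2) \<partial>lborel)"
      by (subst nn_integral_eq_integral[OF conv_integrable[OF mollifier_test[OF e] F2]])
        (auto simp: mollifier_nonneg[OF e] intro!: ennreal_leI Jensen)
  qed
  also have "\<dots> = (\<integral>\<^sup>+y. \<integral>\<^sup>+x. ennreal (mollifier e (x - y) * (F y)\<^sup>2) \<partial>lborel \<partial>lborel)"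
    by (rule lborel_pair.Fubini') measurable
  also have "\<dots> = (\<integral>\<^sup>+y. ennreal ((F y)\<^sup>2) \<partial>lborel)"
  proof (rule nn_integral_cong)
    fix y :: 'a
    have "(\<integral>\<^sup>+x. ennreal (mollifier e (x - y)) \<partial>lborel) = 1"
      using mollifier_shift_integrable[OF e, of y] mollifier_shift_integral[OF e, of y]
      by (subst (asm) (1 2) mollifier_minus_commute[OF e], subst nn_integral_eq_integral)
        (auto simp: mollifier_nonneg[OF e])
    then show "(\<integral>\<^sup>+x. ennreal (mollifier e (x - y) * (F y)\<^sup>2) \<partial>lborel) = ennreal ((F y)\<^sup>2)"
      by (simp add: ennreal_mult mollifier_nonneg[OF e] nn_integral_multc)
  qed
  also have "\<dots> = ennreal (\<integral>x. (F x)\<^sup>2 \<partial>lborel)"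
    by (rule nn_integral_eq_integral[OF F2]) simp
  finally have le: "(\<integral>\<^sup>+x. (conv (mollifier e) F x)\<^sup>2 \<partial>lborel) \<le> ennreal (\<integral>x. (F x)\<^sup>2 \<partial>lborel)" .
  then show int: "integrable lborel (\<lambda>x. (conv (mollifier e) F x)\<^sup>2)"
    by (intro integrableI_bounded) (auto simp: less_top[symmetric] top_unique)
  show "(\<integral>x. (conv (mollifier e) F x)\<^sup>2 \<partial>lborel) \<le> (\<integral>x. (F x)\<^sup>2 \<partial>lborel)"
    using le by (subst (asm) nn_integral_eq_integral[OF int]) (auto simp: ennreal_le_iff)
qed

text \<open>
  First cut off the values of \<open>F\<close>; the bounded function is an almost everywhere limit of continuous
  functions, which are cut off in value and, by a continuous factor that is one where \<open>F\<close> lives, in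
  space. Both limits are in \<open>L\<^sup>2\<close> by dominated convergence.
\<close>

lemma L2_continuous_dense:
  fixes F :: "'a::euclidean_space \<Rightarrow> real"
  assumes [measurable]: "F \<in> borel_measurable borel" and F2: "integrable lborel (\<lambda>x. (F x)\<^sup>2)"
    and out: "\<And>x. norm x > R \<Longrightarrow> F x = 0" and \<epsilon>: "\<epsilon> > 0"
  obtains c where "continuous_on UNIV c" "\<And>x. norm x > R + 1 \<Longrightarrow> c x = 0"
    "integrable lborel (\<lambda>x. (c x - F x)\<^sup>2)" "(\<integral>x. (c x - F x)\<^sup>2 \<partial>lborel) < \<epsilon>"
proof -
  define T where "T n x = max (- real n) (min (real n) x)" for n x
  have T_cont: "continuous_on UNIV (T n)" for n
    unfolding T_def by (intro continuous_intros)
  have [measurable]: "T n \<in> borel_measurable borel" for n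
    by (rule borel_measurable_continuous_onI[OF T_cont])
  have T_bound: "\<bar>T n x\<bar> \<le> real n" for n x by (auto simp: T_def)
  have T_le: "\<bar>T n x - x\<bar> \<le> \<bar>x\<bar>" for n x by (auto simp: T_def)
  have T_0: "T n 0 = 0" for n by (simp add: T_def)
  have "(\<lambda>n. \<integral>x. (T n (F x) - F x)\<^sup>2 \<partial>lborel) \<longlonglongrightarrow> (\<integral>x. 0 \<partial>(lborel :: 'a measure))"
  proof (rule integral_dominated_convergence[OF _ _ F2])
    have "(\<lambda>n. (T n y - y)\<^sup>2) \<longlonglongrightarrow> 0" for y :: real
    proof (rule tendsto_eventually)
      obtain N where "\<bar>y\<bar> \<le> real N" using real_arch_simple by blast
      then show "\<forall>\<^sub>F n in sequentially. (T n y - y)\<^sup>2 = 0"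
        unfolding eventually_sequentially by (intro exI[of _ N]) (auto simp: T_def)
    qed
    then show "AE x in lborel. (\<lambda>n. (T n (F x) - F x)\<^sup>2) \<longlonglongrightarrow> 0" by simp
    show "AE x in lborel. norm ((T n (F x) - F x)\<^sup>2) \<le> (F x)\<^sup>2" for n
      using T_le[of n] by (auto simp: abs_le_square_iff)
  qed measurable
  then have "\<forall>\<^sub>F n in sequentially. (\<integral>x. (T n (F x) - F x)\<^sup>2 \<partial>lborel) < \<epsilon> / 4"
    using \<epsilon> by (intro order_tendstoD(2)) auto
  then obtain n where n: "(\<integral>x. (T n (F x) - F x)\<^sup>2 \<partial>lborel) < \<epsilon> / 4"
    unfolding eventually_sequentially by blast
  have int1: "integrable lborel (\<lambda>x. (T n (F x) - F x)\<^sup>2)"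
    by (rule Bochner_Integration.integrable_bound[OF F2]) (use T_le[of n] in \<open>auto simp: abs_le_square_iff\<close>)
  have "F measurable_on UNIV"
    by (rule lebesgue_measurable_imp_measurable_on_real) (auto intro!: measurable_completion)
  then obtain N G where N: "negligible N" and G: "\<And>k. continuous_on UNIV (G k)"
    and lim: "\<And>x. x \<notin> N \<Longrightarrow> (\<lambda>k. G k x) \<longlonglongrightarrow> F x"
    unfolding measurable_on_def by auto
  \<comment> \<open>the continuous spatial cutoff: one on the ball of radius \<open>R\<close>, zero off the ball of radius \<open>R + 1\<close>\<close>
  define \<kappa> where "\<kappa> x = max 0 (min 1 (R + 1 - norm x))" for x :: 'a
  have \<kappa>_cont: "continuous_on UNIV \<kappa>" unfolding \<kappa>_def by (intro continuous_intros)
  define c where "c k x = \<kappa> x * T n (G k x)" for k x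
  have c_cont: "continuous_on UNIV (c k)" for k
    unfolding c_def by (intro continuous_intros \<kappa>_cont continuous_on_compose2[OF T_cont G]) auto
  have [measurable]: "c k \<in> borel_measurable borel" for k
    by (rule borel_measurable_continuous_onI[OF c_cont])
  have c_out: "c k x = 0" if "norm x > R + 1" for k x using that by (simp add: c_def \<kappa>_def)
  let ?B = "\<lambda>x::'a. (2 * real n)\<^sup>2 * indicator (cball 0 (R + 1)) x"
  have B_int: "integrable lborel ?B"
    by (intro integrable_mult_right integrable_real_indicator)
      (use emeasure_lborel_cball_finite[of "0::'a" "R + 1"] in auto)
  have B: "\<bar>(c k x - T n (F x))\<^sup>2\<bar> \<le> ?B x" for k x
  proof (cases "norm x \<le> R + 1")
    case True
    have "\<bar>c k x\<bar> \<le> 1 * real n"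
      unfolding c_def abs_mult by (intro mult_mono T_bound) (auto simp: \<kappa>_def)
    then have "\<bar>c k x - T n (F x)\<bar> \<le> 2 * real n" using T_bound[of n "F x"] by linarith
    then have "(c k x - T n (F x))\<^sup>2 \<le> (2 * real n)\<^sup>2" using abs_le_square_iff[of "c k x - T n (F x)" "2 * real n"] by simp
    then show ?thesis using True by simp
  next
    case False
    then show ?thesis using out[of x] c_out[of x k] by (simp add: T_0)
  qed
  have int2: "integrable lborel (\<lambda>x. (c k x - T n (F x))\<^sup>2)" for k
    by (rule Bochner_Integration.integrable_bound[OF B_int]) (use B[of k] in auto)
  have "(\<lambda>k. \<integral>x. (c k x - T n (F x))\<^sup>2 \<partial>lborel) \<longlonglongrightarrow> (\<integral>x. 0 \<partial>(lborel :: 'a measure))"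
  proof (rule integral_dominated_convergence[OF _ _ B_int])
    have "AE x in lebesgue. x \<notin> N"
      using N by (intro AE_not_in) (simp add: negligible_iff_null_sets)
    then have "AE x in lborel. x \<notin> N" by (simp add: AE_completion_iff)
    then show "AE x in lborel. (\<lambda>k. (c k x - T n (F x))\<^sup>2) \<longlonglongrightarrow> 0"
    proof eventually_elim
      case (elim x)
      have "(\<lambda>k. T n (G k x)) \<longlonglongrightarrow> T n (F x)"
        by (rule continuous_on_tendsto_compose[OF T_cont lim[OF elim]]) auto
      then have "(\<lambda>k. c k x) \<longlonglongrightarrow> \<kappa> x * T n (F x)" unfolding c_def by (intro tendsto_intros)
      also have "\<kappa> x * T n (F x) = T n (F x)"
        using out[of x] by (cases "norm x > R") (auto simp: \<kappa>_def T_0)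
      finally have "(\<lambda>k. (c k x - T n (F x))\<^sup>2) \<longlonglongrightarrow> (T n (F x) - T n (F x))\<^sup>2" by (intro tendsto_intros)
      then show ?case by simp
    qed
    show "AE x in lborel. norm ((c k x - T n (F x))\<^sup>2) \<le> ?B x" for k using B[of k] by auto
  qed measurable
  then have "\<forall>\<^sub>F k in sequentially. (\<integral>x. (c k x - T n (F x))\<^sup>2 \<partial>lborel) < \<epsilon> / 4"
    using \<epsilon> by (intro order_tendstoD(2)) auto
  then obtain k where k: "(\<integral>x. (c k x - T n (F x))\<^sup>2 \<partial>lborel) < \<epsilon> / 4"
    unfolding eventually_sequentially by blast
  let ?S = "\<lambda>x. 2 * (c k x - T n (F x))\<^sup>2 + 2 * (T n (F x) - F x)\<^sup>2"
  have S_int: "integrable lborel ?S" using int1 int2[of k] by simp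
  have S: "(c k x - F x)\<^sup>2 \<le> ?S x" for x
    using zero_le_power2[of "(c k x - T n (F x)) - (T n (F x) - F x)"]
    by (simp add: power2_eq_square algebra_simps)
  have int3: "integrable lborel (\<lambda>x. (c k x - F x)\<^sup>2)"
    by (rule Bochner_Integration.integrable_bound[OF S_int]) (use S in auto)
  have "(\<integral>x. (c k x - F x)\<^sup>2 \<partial>lborel) \<le> (\<integral>x. ?S x \<partial>lborel)"
    by (rule integral_mono[OF int3 S_int S])
  also have "\<dots> < \<epsilon>" using int1 int2[of k] n k by simp
  finally have "(\<integral>x. (c k x - F x)\<^sup>2 \<partial>lborel) < \<epsilon>" .
  then show ?thesis by (intro that[OF c_cont[of k] c_out int3])
qed

text \<open>
  Approximate \<open>F\<close> by a continuous \<open>c\<close> of compact support. Mollifications of \<open>c\<close> converge uniformly, and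
  the error of replacing \<open>F\<close> by \<open>c\<close> is not increased by mollification.
\<close>

lemma mollify_tendsto_L2:
  fixes F :: "'a::euclidean_space \<Rightarrow> real"
  assumes F: "integrable lborel F" and F2: "integrable lborel (\<lambda>x. (F x)\<^sup>2)"
    and out: "\<And>x. norm x > R \<Longrightarrow> F x = 0"
  defines "\<rho> \<equiv> \<lambda>k. mollifier (inverse (real (Suc k)))"
  shows "integrable lborel (\<lambda>x. (conv (\<rho> k) F x - F x)\<^sup>2)"
    and "(\<lambda>k. \<integral>x. (conv (\<rho> k) F x - F x)\<^sup>2 \<partial>lborel) \<longlonglongrightarrow> 0"
proof -
  have [measurable]: "F \<in> borel_measurable borel" using F by auto
  have pos: "inverse (real (Suc k)) > 0" for k by simp
  have \<rho>_test: "\<rho> k \<in> test_functions UNIV" for k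
    unfolding \<rho>_def by (rule mollifier_test[OF pos])
  have [measurable]: "conv (\<rho> k) F \<in> borel_measurable borel" for k
    by (rule smooth_borel[OF smooth_conv[OF \<rho>_test F]])
  have conv2: "integrable lborel (\<lambda>x. (conv (\<rho> k) F x)\<^sup>2)" for k
    unfolding \<rho>_def by (rule mollify_L2(1)[OF pos F F2])
  have diff: "integrable lborel (\<lambda>x. (conv (\<rho> k) F x - F x)\<^sup>2)" for k
  proof (rule Bochner_Integration.integrable_bound)
    show "integrable lborel (\<lambda>x. 2 * (conv (\<rho> k) F x)\<^sup>2 + 2 * (F x)\<^sup>2)" using conv2[of k] F2 by simp
    have "(a - b)\<^sup>2 \<le> 2 * a\<^sup>2 + 2 * b\<^sup>2" for a b :: real
      using zero_le_power2[of "a + b"] by (simp add: power2_eq_square algebra_simps)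
    then show "AE x in lborel. norm ((conv (\<rho> k) F x - F x)\<^sup>2) \<le> norm (2 * (conv (\<rho> k) F x)\<^sup>2 + 2 * (F x)\<^sup>2)"
      by simp
  qed measurable
  then show "integrable lborel (\<lambda>x. (conv (\<rho> k) F x - F x)\<^sup>2)" .
  show "(\<lambda>k. \<integral>x. (conv (\<rho> k) F x - F x)\<^sup>2 \<partial>lborel) \<longlonglongrightarrow> 0"
  proof (rule LIMSEQ_I)
    fix \<epsilon> :: real assume \<epsilon>: "\<epsilon> > 0"
    obtain c where c: "continuous_on UNIV c" and c_out: "\<And>x. norm x > R + 1 \<Longrightarrow> c x = 0"
      and cF_int: "integrable lborel (\<lambda>x. (c x - F x)\<^sup>2)" and cF: "(\<integral>x. (c x - F x)\<^sup>2 \<partial>lborel) < \<epsilon> / 12"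
      using L2_continuous_dense[of F R "\<epsilon> / 12"] F2 out \<epsilon> by auto
    have [measurable]: "c \<in> borel_measurable borel" by (rule borel_measurable_continuous_onI[OF c])
    have c_int: "integrable lborel c"
      by (rule integrable_compact_support[OF c, of "cball 0 (R + 1)"]) (auto intro: c_out)
    define V where "V = measure lborel (cball (0::'a) (R + 2))"
    \<comment> \<open>a uniform error \<open>s\<close> on a ball of volume \<open>V\<close> costs at most \<open>\<epsilon> / 12\<close> in the squared norm\<close>
    define s where "s = sqrt (\<epsilon> / (12 * (V + 1)))"
    have V: "V \<ge> 0" by (simp add: V_def)
    then have s: "s > 0" using \<epsilon> by (simp add: s_def)
    have sV: "s\<^sup>2 * V \<le> \<epsilon> / 12"
    proof -
      have "s\<^sup>2 * V = (\<epsilon> / 12) * (V / (V + 1))" using V \<epsilon> by (simp add: s_def)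
      also have "\<dots> \<le> (\<epsilon> / 12) * 1" using V \<epsilon> by (intro mult_left_mono) auto
      finally show ?thesis by simp
    qed
    have "uniformly_continuous_on (cball 0 (R + 3)) c"
      by (rule compact_uniformly_continuous) (auto intro: continuous_on_subset[OF c])
    then obtain d where d: "d > 0"
      "\<And>x y. norm x \<le> R + 3 \<Longrightarrow> norm y \<le> R + 3 \<Longrightarrow> norm (x - y) < d \<Longrightarrow> \<bar>c y - c x\<bar> < s"
      unfolding uniformly_continuous_on_def using s by (auto simp: dist_norm norm_minus_commute)
    obtain k0 where k0: "inverse (real (Suc k0)) < d" using reals_Archimedean[OF d(1)] by blast
    have "norm ((\<integral>x. (conv (\<rho> k) F x - F x)\<^sup>2 \<partial>lborel) - 0) < \<epsilon>" if k: "k \<ge> k0" for k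
    proof -
      let ?e = "inverse (real (Suc k))"
      have "?e \<le> inverse (real (Suc k0))" using k by (intro le_imp_inverse_le) auto
      then have e: "?e < d" using k0 by (rule le_less_trans)
      have e': "?e \<le> 1" by (simp add: field_simps)
      have cc: "(conv (\<rho> k) c x - c x)\<^sup>2 \<le> s\<^sup>2 * indicator (cball 0 (R + 2)) x" for x
      proof (cases "norm x \<le> R + 2")
        case True
        have "\<bar>conv (\<rho> k) c x - c x\<bar> \<le> s"
          unfolding \<rho>_def
        proof (rule mollify_close[OF pos c_int])
          fix y assume y: "norm (x - y) < ?e"
          have "norm y \<le> norm x + norm (x - y)" using norm_triangle_sub[of y x] by (simp add: norm_minus_commute)
          then show "\<bar>c y - c x\<bar> \<le> s" using d(2)[of x y] True y e e' by auto
        qed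
        then show ?thesis using True s by (simp add: abs_le_square_iff[symmetric])
      next
        case False
        have "\<bar>conv (\<rho> k) c x - 0\<bar> \<le> 0"
          unfolding \<rho>_def
        proof (rule mollify_close[OF pos c_int])
          fix y assume y: "norm (x - y) < ?e"
          then have "norm y > R + 1" using norm_triangle_sub[of x y] False e' by auto
          then show "\<bar>c y - 0\<bar> \<le> 0" by (simp add: c_out)
        qed
        then show ?thesis using False c_out[of x] by simp
      qed
      have I_int: "integrable lborel (\<lambda>x::'a. s\<^sup>2 * indicator (cball 0 (R + 2)) x)"
        by (intro integrable_mult_right integrable_real_indicator)
          (use emeasure_lborel_cball_finite[of "0::'a" "R + 2"] in auto)
      let ?D = "\<lambda>x. c x + (- 1) * F x"
      have D_int: "integrable lborel ?D" using c_int F by simp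
      have D2_int: "integrable lborel (\<lambda>x. (?D x)\<^sup>2)" using cF_int by simp
      have convD: "conv (\<rho> k) F x = conv (\<rho> k) c x - conv (\<rho> k) ?D x" for x
        using conv_add_scale[OF \<rho>_test[of k] c_int F, of "-1" x] by (simp del: mult_minus1)
      let ?S = "\<lambda>x. 3 * (conv (\<rho> k) ?D x)\<^sup>2 + 3 * (s\<^sup>2 * indicator (cball 0 (R + 2)) x) + 3 * (c x - F x)\<^sup>2"
      have convD2: "integrable lborel (\<lambda>x. (conv (\<rho> k) ?D x)\<^sup>2)"
          "(\<integral>x. (conv (\<rho> k) ?D x)\<^sup>2 \<partial>lborel) \<le> (\<integral>x. (?D x)\<^sup>2 \<partial>lborel)"
        unfolding \<rho>_def using mollify_L2[OF pos D_int D2_int] by auto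
      have S_int: "integrable lborel ?S"
        by (rule Bochner_Integration.integrable_add[OF Bochner_Integration.integrable_add[OF
              integrable_mult_right integrable_mult_right] integrable_mult_right])
          (rule convD2(1) I_int cF_int)+
      have le: "(\<integral>x. (conv (\<rho> k) F x - F x)\<^sup>2 \<partial>lborel) \<le> (\<integral>x. ?S x \<partial>lborel)"
      proof (rule integral_mono[OF diff S_int])
        fix x
        have sq: "(- a + b + c)\<^sup>2 \<le> 3 * a\<^sup>2 + 3 * b\<^sup>2 + 3 * c\<^sup>2" for a b c :: real
          using zero_le_power2[of "a + b"] zero_le_power2[of "a + c"] zero_le_power2[of "b - c"]
          by (simp add: power2_eq_square algebra_simps)
        have "conv (\<rho> k) F x - F x = - conv (\<rho> k) ?D x + (conv (\<rho> k) c x - c x) + (c x - F x)"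
          by (simp add: convD)
        then have "(conv (\<rho> k) F x - F x)\<^sup>2
            \<le> 3 * (conv (\<rho> k) ?D x)\<^sup>2 + 3 * (conv (\<rho> k) c x - c x)\<^sup>2 + 3 * (c x - F x)\<^sup>2"
          by (simp only: sq)
        then show "(conv (\<rho> k) F x - F x)\<^sup>2 \<le> ?S x" using cc[of x] by linarith
      qed
      have S_eq: "(\<integral>x. ?S x \<partial>lborel) = 3 * (\<integral>x. (conv (\<rho> k) ?D x)\<^sup>2 \<partial>lborel) + 3 * (s\<^sup>2 * V) + 3 * (\<integral>x. (c x - F x)\<^sup>2 \<partial>lborel)"
        using convD2(1) I_int cF_int by (simp add: V_def)
      have "(\<integral>x. (?D x)\<^sup>2 \<partial>lborel) = (\<integral>x. (c x - F x)\<^sup>2 \<partial>lborel)" by simp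
      with convD2(2) sV cF \<epsilon> have "3 * (\<integral>x. (conv (\<rho> k) ?D x)\<^sup>2 \<partial>lborel) + 3 * (s\<^sup>2 * V) + 3 * (\<integral>x. (c x - F x)\<^sup>2 \<partial>lborel) < \<epsilon>"
        by linarith
      with le S_eq show ?thesis by (simp add: integral_nonneg_AE)
    qed
    then show "\<exists>k0. \<forall>k\<ge>k0. norm ((\<integral>x. (conv (\<rho> k) F x - F x)\<^sup>2 \<partial>lborel) - 0) < \<epsilon>" by blast
  qed
qed

section \<open>Weak gradients and functions with zero boundary values\<close>

context bounded_open
begin

lemma domain_norm_bound:
  obtains R where "\<And>x. x \<in> \<Omega> \<Longrightarrow> norm x \<le> R"
  using bounded_domain unfolding bounded_iff by blast

lemma borel_measurable_domain:
  "f \<in> borel_measurable borel \<Longrightarrow> f \<in> borel_measurable (lebesgue_on \<Omega>)"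
  by (intro measurable_restrict_space1 measurable_completion) simp

lemma integrable_domain_iff:
  fixes f :: "'a \<Rightarrow> real"
  assumes "f \<in> borel_measurable borel"
  shows "integrable (lebesgue_on \<Omega>) f \<longleftrightarrow> integrable lborel (\<lambda>x. indicator \<Omega> x * f x)"
  using assms by (subst integrable_restrict_space) (auto simp: integrable_completion)

lemma integral_domain_eq:
  fixes f :: "'a \<Rightarrow> real"
  assumes "f \<in> borel_measurable borel"
  shows "(\<integral>x. f x \<partial>lebesgue_on \<Omega>) = (\<integral>x. indicator \<Omega> x * f x \<partial>lborel)"
  using assms by (subst integral_restrict_space) (auto simp: integral_completion)

text \<open>
  A Borel representative of a class of functions on the domain, extended by zero. Convolutions are taken
  of such representatives, since Tonelli's theorem is applied to the product of Borel spaces.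
\<close>

definition borel_extension :: "('a \<Rightarrow> real) \<Rightarrow> ('a \<Rightarrow> real) \<Rightarrow> bool" where
  "borel_extension v F \<longleftrightarrow> (\<forall>x. x \<notin> \<Omega> \<longrightarrow> F x = 0) \<and> (AE x in lebesgue_on \<Omega>. F x = v x) \<and>
     integrable lborel F \<and> integrable lborel (\<lambda>x. (F x)\<^sup>2)"

lemma borel_extension_exists:
  fixes v :: "'a \<Rightarrow> real"
  assumes v: "v \<in> L2 \<Omega>"
  shows "\<exists>F. borel_extension v F"
proof -
  let ?u = "\<lambda>x. indicator \<Omega> x * v x"
  have "?u \<in> borel_measurable lebesgue"
    using L2_measurable[OF v] by (subst (asm) borel_measurable_restrict_space_iff) auto
  then obtain g where g: "g \<in> borel_measurable lborel" "AE x in lborel. ?u x = g x"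
    using completion_ex_borel_measurable_real by blast
  define F where "F x = indicator \<Omega> x * g x" for x
  have [measurable]: "F \<in> borel_measurable borel" unfolding F_def using g(1) by simp
  have eq: "AE x in lebesgue_on \<Omega>. F x = v x"
  proof -
    have "AE x in lebesgue. ?u x = g x" using g(2) by (rule AE_completion)
    then have "AE x in lebesgue. x \<in> \<Omega> \<longrightarrow> F x = v x" by eventually_elim (auto simp: F_def)
    then show ?thesis by (subst AE_restrict_space_iff) auto
  qed
  have out: "F x = 0" if "x \<notin> \<Omega>" for x using that by (simp add: F_def)
  have Fm: "F \<in> borel_measurable (lebesgue_on \<Omega>)" by (rule borel_measurable_domain) simp
  have F_L2: "F \<in> L2 \<Omega>"
    by (rule L2_dominated[OF v Fm]) (use eq in \<open>eventually_elim, simp\<close>)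
  have "integrable lborel (\<lambda>x. indicator \<Omega> x * F x)" "integrable lborel (\<lambda>x. indicator \<Omega> x * (F x)\<^sup>2)"
    using L2_integrable[OF F_L2] L2_square_integrable[OF F_L2]
    by (auto simp: integrable_domain_iff)
  moreover have "(\<lambda>x. indicator \<Omega> x * F x) = F" "(\<lambda>x. indicator \<Omega> x * (F x)\<^sup>2) = (\<lambda>x. (F x)\<^sup>2)"
    by (auto simp: F_def indicator_def)
  ultimately show ?thesis using eq out by (auto simp: borel_extension_def)
qed

lemma borel_extension_integral:
  fixes v \<phi> :: "'a \<Rightarrow> real"
  assumes v: "v \<in> L2 \<Omega>" and F: "borel_extension v F" and \<phi>: "\<phi> \<in> borel_measurable borel"
  shows "(\<integral>x. v x * \<phi> x \<partial>lebesgue_on \<Omega>) = (\<integral>x. \<phi> x * F x \<partial>lborel)"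
proof -
  have [measurable]: "F \<in> borel_measurable borel" "\<phi> \<in> borel_measurable borel"
    using F \<phi> by (auto simp: borel_extension_def)
  have [measurable]: "F \<in> borel_measurable (lebesgue_on \<Omega>)" "\<phi> \<in> borel_measurable (lebesgue_on \<Omega>)"
    by (auto intro: borel_measurable_domain)
  have [measurable]: "v \<in> borel_measurable (lebesgue_on \<Omega>)" by (rule L2_measurable[OF v])
  have "AE x in lebesgue_on \<Omega>. F x = v x" using F by (simp add: borel_extension_def)
  then have "AE x in lebesgue_on \<Omega>. v x * \<phi> x = \<phi> x * F x" by eventually_elim simp
  then have "(\<integral>x. v x * \<phi> x \<partial>lebesgue_on \<Omega>) = (\<integral>x. \<phi> x * F x \<partial>lebesgue_on \<Omega>)"
    by (intro integral_cong_AE) auto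
  also have "\<dots> = (\<integral>x. indicator \<Omega> x * (\<phi> x * F x) \<partial>lborel)"
    by (rule integral_domain_eq) simp
  also have "(\<lambda>x. indicator \<Omega> x * (\<phi> x * F x)) = (\<lambda>x. \<phi> x * F x)"
    using F by (fastforce simp: borel_extension_def indicator_def)
  finally show ?thesis .
qed

lemma conv_smooth_extension:
  assumes "e > 0" "borel_extension v F"
  shows "smooth (conv (mollifier e) F)"
  using assms by (intro smooth_conv mollifier_test) (auto simp: borel_extension_def)

lemma mollify_tendsto_L2norm:
  fixes v :: "'a \<Rightarrow> real"
  assumes v: "v \<in> L2 \<Omega>" and F: "borel_extension v F"
  defines "u \<equiv> \<lambda>k. conv (mollifier (inverse (real (Suc k)))) F"
  shows "u k \<in> L2 \<Omega>" and "(\<lambda>k. L2norm \<Omega> (\<lambda>x. u k x - v x)) \<longlonglongrightarrow> 0"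
proof -
  have F': "integrable lborel F" "integrable lborel (\<lambda>x. (F x)\<^sup>2)" "\<And>x. x \<notin> \<Omega> \<Longrightarrow> F x = 0"
    and FAE: "AE x in lebesgue_on \<Omega>. F x = v x"
    using F by (auto simp: borel_extension_def)
  obtain R where R: "\<And>x. x \<in> \<Omega> \<Longrightarrow> norm x \<le> R" using domain_norm_bound by blast
  have out: "F x = 0" if "norm x > R" for x using that R[of x] F'(3) by force
  have [measurable]: "F \<in> borel_measurable borel" using F'(1) by auto
  have um[measurable]: "u k \<in> borel_measurable borel" for k
    unfolding u_def by (rule smooth_borel[OF conv_smooth_extension[OF _ F]]) simp
  have um': "u k \<in> borel_measurable (lebesgue_on \<Omega>)" for k by (rule borel_measurable_domain) simp
  have u2: "integrable lborel (\<lambda>x. (u k x)\<^sup>2)" for k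
    unfolding u_def by (rule mollify_L2(1)[OF _ F'(1,2)]) simp
  have "integrable lborel (\<lambda>x. indicator \<Omega> x * (u k x)\<^sup>2)" for k
    by (rule Bochner_Integration.integrable_bound[OF u2[of k]]) (auto simp: indicator_def)
  then show uL2: "u k \<in> L2 \<Omega>" for k
    using um' by (simp add: L2_def integrable_domain_iff)
  have lim: "(\<lambda>k. \<integral>x. (u k x - F x)\<^sup>2 \<partial>lborel) \<longlonglongrightarrow> 0"
    and int: "integrable lborel (\<lambda>x. (u k x - F x)\<^sup>2)" for k
    unfolding u_def using mollify_tendsto_L2[OF F'(1,2) out] by auto
  have "L2norm \<Omega> (\<lambda>x. u k x - v x) \<le> sqrt (\<integral>x. (u k x - F x)\<^sup>2 \<partial>lborel)" for k
  proof (rule real_le_rsqrt)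
    have "(L2norm \<Omega> (\<lambda>x. u k x - v x))\<^sup>2 = (\<integral>x. (u k x - v x)\<^sup>2 \<partial>lebesgue_on \<Omega>)"
      by (simp add: L2norm_square)
    also have "\<dots> = (\<integral>x. (u k x - F x)\<^sup>2 \<partial>lebesgue_on \<Omega>)"
    proof (rule integral_cong_AE)
      show "AE x in lebesgue_on \<Omega>. (u k x - v x)\<^sup>2 = (u k x - F x)\<^sup>2"
        using FAE by eventually_elim simp
      show "(\<lambda>x. (u k x - F x)\<^sup>2) \<in> borel_measurable (lebesgue_on \<Omega>)"
        by (rule borel_measurable_domain) simp
      show "(\<lambda>x. (u k x - v x)\<^sup>2) \<in> borel_measurable (lebesgue_on \<Omega>)"
        using um'[of k] L2_measurable[OF v] by simp
    qed
    also have "\<dots> = (\<integral>x. indicator \<Omega> x * (u k x - F x)\<^sup>2 \<partial>lborel)"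
      by (rule integral_domain_eq) simp
    also have "\<dots> \<le> (\<integral>x. (u k x - F x)\<^sup>2 \<partial>lborel)"
    proof (rule integral_mono[OF _ int])
      show "integrable lborel (\<lambda>x. indicator \<Omega> x * (u k x - F x)\<^sup>2)"
        by (rule Bochner_Integration.integrable_bound[OF int[of k]]) (auto simp: indicator_def)
    qed (auto simp: indicator_def)
    finally show "(L2norm \<Omega> (\<lambda>x. u k x - v x))\<^sup>2 \<le> (\<integral>x. (u k x - F x)\<^sup>2 \<partial>lborel)" .
  qed
  moreover have "(\<lambda>k. sqrt (\<integral>x. (u k x - F x)\<^sup>2 \<partial>lborel)) \<longlonglongrightarrow> 0"
    using tendsto_real_sqrt[OF lim] by simp
  ultimately show "(\<lambda>k. L2norm \<Omega> (\<lambda>x. u k x - v x)) \<longlonglongrightarrow> 0"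
    by (rule L2norm_squeeze)
qed

lemma mollifier_shift_test:
  assumes e: "e > 0" and x: "cball x e \<subseteq> U"
  shows "(\<lambda>y. mollifier e (x - y)) \<in> test_functions U"
proof (rule test_functionsI[of _ "cball x e"])
  show "smooth (\<lambda>y. mollifier e (x - y))"
    using smooth_affine[OF test_functions_smooth[OF mollifier_test[OF e]], of x "-1"] by simp
  show "mollifier e (x - y) = 0" if "y \<notin> cball x e" for y
    using that by (intro mollifier_eq_0[OF e]) (simp add: dist_norm)
qed (use x in auto)

text \<open>
  For a point whose ball of radius \<open>e\<close> lies in the domain, \<open>y \<mapsto> mollifier e (x - y)\<close> is an admissible
  test function in the definition of the weak gradient.
\<close>

lemma partial_deriv_mollified:
  fixes v :: "'a \<Rightarrow> real"
  assumes v: "v \<in> L2 \<Omega>" and G: "is_weak_grad \<Omega> v G" and i: "i \<in> Basis"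
    and F: "borel_extension v F" and H: "borel_extension (\<lambda>x. G x \<bullet> i) H"
    and e: "e > 0" and x: "cball x e \<subseteq> \<Omega>"
  shows "partial_deriv i (conv (mollifier e) F) x = conv (mollifier e) H x"
proof -
  let ?\<psi> = "\<lambda>y. mollifier e (x - y)"
  have \<psi>: "?\<psi> \<in> test_functions \<Omega>" by (rule mollifier_shift_test[OF e x])
  have m: "mollifier e \<in> test_functions UNIV" by (rule mollifier_test[OF e])
  have d: "partial_deriv i ?\<psi> = (\<lambda>y. - partial_deriv i (mollifier e) (x - y))"
  proof
    fix y
    show "partial_deriv i ?\<psi> y = - partial_deriv i (mollifier e) (x - y)"
      using partial_deriv_affine[where f = "mollifier e" and a = x and c = "-1" and x = y and i = i]
        smooth_differentiable[OF test_functions_smooth[OF m], of "x - y"] by simp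
  qed
  have "(\<integral>y. v y * partial_deriv i ?\<psi> y \<partial>lebesgue_on \<Omega>) = - (\<integral>y. (G y \<bullet> i) * ?\<psi> y \<partial>lebesgue_on \<Omega>)"
    using G \<psi> i by (simp add: is_weak_grad_def)
  also have "(\<integral>y. (G y \<bullet> i) * ?\<psi> y \<partial>lebesgue_on \<Omega>) = (\<integral>y. ?\<psi> y * H y \<partial>lborel)"
    using G i by (intro borel_extension_integral[OF L2_component H] test_functions_borel[OF \<psi>])
      (auto simp: is_weak_grad_def)
  also have "(\<integral>y. v y * partial_deriv i ?\<psi> y \<partial>lebesgue_on \<Omega>) = (\<integral>y. partial_deriv i ?\<psi> y * F y \<partial>lborel)"
    by (rule borel_extension_integral[OF v F test_functions_borel[OF test_functions_partial_deriv[OF \<psi> i]]])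
  finally have "conv (partial_deriv i (mollifier e)) F x = conv (mollifier e) H x"
    by (simp add: d conv_def)
  moreover have "partial_deriv i (conv (mollifier e) F) = conv (partial_deriv i (mollifier e)) F"
    using F by (intro partial_deriv_conv[OF m _ i]) (simp add: borel_extension_def)
  ultimately show ?thesis by simp
qed

lemma eventually_cball_subset:
  assumes "x \<in> \<Omega>"
  shows "\<forall>\<^sub>F k in sequentially. cball x (inverse (real (Suc k))) \<subseteq> \<Omega>"
proof -
  obtain d where d: "d > 0" "cball x d \<subseteq> \<Omega>"
    using open_domain assms open_contains_cball by blast
  have "\<forall>\<^sub>F k in sequentially. inverse (real (Suc k)) < d"
    using LIMSEQ_inverse_real_of_nat d(1) by (intro order_tendstoD(2)) auto
  then show ?thesis
    by eventually_elim (use d(2) in force)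
qed

lemma test_function_L2: "\<phi> \<in> test_functions U \<Longrightarrow> \<phi> \<in> L2 \<Omega>"
proof -
  assume \<phi>: "\<phi> \<in> test_functions U"
  obtain C where "\<And>x. \<bar>\<phi> x\<bar> \<le> C" using test_functions_bounded[OF \<phi>] by metis
  then show ?thesis
    by (intro L2_bounded[of _ C] borel_measurable_domain test_functions_borel[OF \<phi>]) auto
qed

lemma gradient_test_function_L2: "\<phi> \<in> test_functions U \<Longrightarrow> gradient \<phi> \<in> L2 \<Omega>"
proof -
  assume \<phi>: "\<phi> \<in> test_functions U"
  have "(\<lambda>x. \<Sum>i\<in>Basis. partial_deriv i \<phi> x *\<^sub>R i) \<in> L2 \<Omega>"
  proof (rule L2_sum)
    fix i :: 'a assume i: "i \<in> Basis"
    have "partial_deriv i \<phi> \<in> L2 \<Omega>" by (rule test_function_L2[OF test_functions_partial_deriv[OF \<phi> i]])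
    moreover from this have "(\<lambda>x. partial_deriv i \<phi> x *\<^sub>R i) \<in> borel_measurable (lebesgue_on \<Omega>)"
      using L2_measurable by measurable
    ultimately show "(\<lambda>x. partial_deriv i \<phi> x *\<^sub>R i) \<in> L2 \<Omega>"
      using i by (elim L2_dominated) auto
  qed
  then show ?thesis unfolding gradient_def .
qed

text \<open>
  The fundamental lemma of the calculus of variations: a shifted mollifier is a test function, so the
  mollifications of \<open>G\<close> at an interior point are eventually zero, while they converge to \<open>G\<close>.
\<close>

lemma L2_orthogonal_test_functions:
  fixes G :: "'a \<Rightarrow> real"
  assumes G: "G \<in> L2 \<Omega>" and orth: "\<And>\<phi>. \<phi> \<in> test_functions \<Omega> \<Longrightarrow> (\<integral>x. G x * \<phi> x \<partial>lebesgue_on \<Omega>) = 0"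
  shows "AE x in lebesgue_on \<Omega>. G x = 0"
proof -
  obtain F where F: "borel_extension G F" using borel_extension_exists[OF G] by blast
  let ?u = "\<lambda>k. conv (mollifier (inverse (real (Suc k)))) F"
  have ev: "\<forall>\<^sub>F k in sequentially. ?u k x = 0" if "x \<in> \<Omega>" for x
    using eventually_cball_subset[OF that]
  proof eventually_elim
    case (elim k)
    let ?\<psi> = "\<lambda>y. mollifier (inverse (real (Suc k))) (x - y)"
    have \<psi>: "?\<psi> \<in> test_functions \<Omega>" by (rule mollifier_shift_test[OF _ elim]) simp
    show ?case
      using orth[OF \<psi>] borel_extension_integral[OF G F test_functions_borel[OF \<psi>]] by (simp add: conv_def)
  qed
  obtain r :: "nat \<Rightarrow> nat" where r: "strict_mono r" "AE x in lebesgue_on \<Omega>. (\<lambda>k. ?u (r k) x) \<longlonglongrightarrow> G x"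
    using L2_AE_subsequence[OF mollify_tendsto_L2norm(1)[OF G F] G mollify_tendsto_L2norm(2)[OF G F]] by blast
  show ?thesis
    using r(2) AE_space
  proof eventually_elim
    case (elim x)
    then have "\<forall>\<^sub>F k in sequentially. ?u (r k) x = 0"
      using eventually_subseq[OF r(1) ev[of x]] by simp
    then have "(\<lambda>k. ?u (r k) x) \<longlonglongrightarrow> 0" by (rule tendsto_eventually)
    with elim(1) show ?case by (rule LIMSEQ_unique)
  qed
qed

lemma is_weak_grad_L2: "is_weak_grad \<Omega> v G \<Longrightarrow> G \<in> L2 \<Omega>"
  by (simp add: is_weak_grad_def)

lemma weak_grad_unique:
  assumes G: "is_weak_grad \<Omega> v G" and H: "is_weak_grad \<Omega> v H"
  shows "AE x in lebesgue_on \<Omega>. G x = H x"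
proof -
  have "AE x in lebesgue_on \<Omega>. (G x - H x) \<bullet> i = 0" if i: "i \<in> Basis" for i
  proof (rule L2_orthogonal_test_functions)
    show "(\<lambda>x. (G x - H x) \<bullet> i) \<in> L2 \<Omega>"
      by (rule L2_component[OF L2_diff[OF is_weak_grad_L2[OF G] is_weak_grad_L2[OF H]] i])
    fix \<phi> assume \<phi>: "\<phi> \<in> test_functions \<Omega>"
    have "integrable (lebesgue_on \<Omega>) (\<lambda>x. (G x \<bullet> i) * \<phi> x)" "integrable (lebesgue_on \<Omega>) (\<lambda>x. (H x \<bullet> i) * \<phi> x)"
      using L2_component i is_weak_grad_L2 G H by (auto intro!: L2_mult_integrable test_function_L2[OF \<phi>])
    moreover have "(\<integral>x. (G x \<bullet> i) * \<phi> x \<partial>lebesgue_on \<Omega>) = (\<integral>x. (H x \<bullet> i) * \<phi> x \<partial>lebesgue_on \<Omega>)"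
      using G H \<phi> i by (simp add: is_weak_grad_def)
    ultimately show "(\<integral>x. ((G x - H x) \<bullet> i) * \<phi> x \<partial>lebesgue_on \<Omega>) = 0"
      by (simp add: inner_diff_left left_diff_distrib)
  qed
  then have "AE x in lebesgue_on \<Omega>. \<forall>i\<in>Basis. (G x - H x) \<bullet> i = 0"
    by (intro AE_finite_allI) auto
  then show ?thesis
    by eventually_elim (metis euclidean_eqI inner_diff_left right_minus_eq)
qed

lemma is_weak_grad_weak_grad: "v \<in> H1 \<Omega> \<Longrightarrow> is_weak_grad \<Omega> v (weak_grad \<Omega> v)"
  unfolding H1_def weak_grad_def by (auto intro: someI[of "is_weak_grad \<Omega> v"])

lemma H1_L2: "v \<in> H1 \<Omega> \<Longrightarrow> v \<in> L2 \<Omega>"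
  by (simp add: H1_def)

lemma H1_weak_grad_L2: "v \<in> H1 \<Omega> \<Longrightarrow> weak_grad \<Omega> v \<in> L2 \<Omega>"
  using is_weak_grad_L2 is_weak_grad_weak_grad by blast

lemma H1I: "v \<in> L2 \<Omega> \<Longrightarrow> is_weak_grad \<Omega> v G \<Longrightarrow> v \<in> H1 \<Omega>"
  by (auto simp: H1_def)

lemma weak_grad_AE_eq:
  "v \<in> L2 \<Omega> \<Longrightarrow> is_weak_grad \<Omega> v G \<Longrightarrow> AE x in lebesgue_on \<Omega>. weak_grad \<Omega> v x = G x"
  using weak_grad_unique is_weak_grad_weak_grad H1I by blast

lemma L2norm_weak_grad:
  assumes "v \<in> L2 \<Omega>" "is_weak_grad \<Omega> v G"
  shows "L2norm \<Omega> (weak_grad \<Omega> v) = L2norm \<Omega> G"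
proof (rule L2norm_cong_AE)
  show "AE x in lebesgue_on \<Omega>. norm (weak_grad \<Omega> v x) = norm (G x)"
    using weak_grad_AE_eq[OF assms] by eventually_elim simp
qed (use L2_measurable is_weak_grad_L2 H1_weak_grad_L2 H1I assms in blast)+

lemma is_weak_grad_add_scale:
  fixes u v :: "'a \<Rightarrow> real"
  assumes u: "u \<in> L2 \<Omega>" and v: "v \<in> L2 \<Omega>"
    and G: "is_weak_grad \<Omega> u G" and H: "is_weak_grad \<Omega> v H"
  shows "is_weak_grad \<Omega> (\<lambda>x. u x + c * v x) (\<lambda>x. G x + c *\<^sub>R H x)"
  unfolding is_weak_grad_def
proof (intro conjI ballI)
  show "(\<lambda>x. G x + c *\<^sub>R H x) \<in> L2 \<Omega>"
    using is_weak_grad_L2[OF G] is_weak_grad_L2[OF H] by (intro L2_add L2_scaleR)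
  fix \<phi> :: "'a \<Rightarrow> real" and i :: 'a
  assume \<phi>: "\<phi> \<in> test_functions \<Omega>" and i: "i \<in> Basis"
  note d = test_function_L2[OF test_functions_partial_deriv[OF \<phi> i]]
  have 1: "(\<integral>x. (u x + c * v x) * partial_deriv i \<phi> x \<partial>lebesgue_on \<Omega>)
      = (\<integral>x. u x * partial_deriv i \<phi> x \<partial>lebesgue_on \<Omega>) + c * (\<integral>x. v x * partial_deriv i \<phi> x \<partial>lebesgue_on \<Omega>)"
    using L2_mult_integrable[OF u d] L2_mult_integrable[OF v d] by (simp add: distrib_right mult.assoc)
  have "integrable (lebesgue_on \<Omega>) (\<lambda>x. (G x \<bullet> i) * \<phi> x)" "integrable (lebesgue_on \<Omega>) (\<lambda>x. (H x \<bullet> i) * \<phi> x)"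
    using L2_component i is_weak_grad_L2 G H by (auto intro!: L2_mult_integrable test_function_L2[OF \<phi>])
  then have 2: "(\<integral>x. ((G x + c *\<^sub>R H x) \<bullet> i) * \<phi> x \<partial>lebesgue_on \<Omega>)
      = (\<integral>x. (G x \<bullet> i) * \<phi> x \<partial>lebesgue_on \<Omega>) + c * (\<integral>x. (H x \<bullet> i) * \<phi> x \<partial>lebesgue_on \<Omega>)"
    by (simp add: inner_add_left distrib_right mult.assoc)
  have "(\<integral>x. u x * partial_deriv i \<phi> x \<partial>lebesgue_on \<Omega>) = - (\<integral>x. (G x \<bullet> i) * \<phi> x \<partial>lebesgue_on \<Omega>)"
    "(\<integral>x. v x * partial_deriv i \<phi> x \<partial>lebesgue_on \<Omega>) = - (\<integral>x. (H x \<bullet> i) * \<phi> x \<partial>lebesgue_on \<Omega>)"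
    using G H \<phi> i by (simp_all add: is_weak_grad_def)
  then show "(\<integral>x. (u x + c * v x) * partial_deriv i \<phi> x \<partial>lebesgue_on \<Omega>)
      = - (\<integral>x. ((G x + c *\<^sub>R H x) \<bullet> i) * \<phi> x \<partial>lebesgue_on \<Omega>)"
    unfolding 1 2 by simp
qed

lemma is_weak_grad_diff:
  fixes u v :: "'a \<Rightarrow> real"
  assumes "u \<in> L2 \<Omega>" "v \<in> L2 \<Omega>" "is_weak_grad \<Omega> u G" "is_weak_grad \<Omega> v H"
  shows "is_weak_grad \<Omega> (\<lambda>x. u x - v x) (\<lambda>x. G x - H x)"
  using is_weak_grad_add_scale[OF assms, of "-1"] by simp

lemma is_weak_grad_add:
  fixes u v :: "'a \<Rightarrow> real"
  assumes "u \<in> L2 \<Omega>" "v \<in> L2 \<Omega>" "is_weak_grad \<Omega> u G" "is_weak_grad \<Omega> v H"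
  shows "is_weak_grad \<Omega> (\<lambda>x. u x + v x) (\<lambda>x. G x + H x)"
  using is_weak_grad_add_scale[OF assms, of 1] by simp

text \<open>
  The classical gradient of a test function is its weak gradient, by partial integration.
\<close>

lemma is_weak_grad_gradient:
  assumes \<phi>: "\<phi> \<in> test_functions \<Omega>"
  shows "is_weak_grad \<Omega> \<phi> (gradient \<phi>)"
  unfolding is_weak_grad_def
proof (intro conjI ballI gradient_test_function_L2[OF \<phi>])
  fix \<psi> :: "'a \<Rightarrow> real" and i :: 'a
  assume \<psi>: "\<psi> \<in> test_functions \<Omega>" and i: "i \<in> Basis"
  have m: "(\<lambda>x. \<phi> x * partial_deriv i \<psi> x) \<in> borel_measurable borel"
    "(\<lambda>x. partial_deriv i \<phi> x * \<psi> x) \<in> borel_measurable borel"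
    using test_functions_borel[OF \<phi>] test_functions_borel[OF \<psi>]
      test_functions_borel[OF test_functions_partial_deriv[OF \<phi> i]]
      test_functions_borel[OF test_functions_partial_deriv[OF \<psi> i]] by auto
  have out: "\<phi> x = 0" "partial_deriv i \<phi> x = 0" if "x \<notin> \<Omega>" for x
    using \<phi> test_functions_partial_deriv[OF \<phi> i] that by (metis test_functionsE subsetD)+
  have ind: "indicator \<Omega> x * (\<phi> x * partial_deriv i \<psi> x) = \<phi> x * partial_deriv i \<psi> x"
    "indicator \<Omega> x * (partial_deriv i \<phi> x * \<psi> x) = partial_deriv i \<phi> x * \<psi> x" for x
    using out[of x] by (auto simp: indicator_def)
  show "(\<integral>x. \<phi> x * partial_deriv i \<psi> x \<partial>lebesgue_on \<Omega>) = - (\<integral>x. gradient \<phi> x \<bullet> i * \<psi> x \<partial>lebesgue_on \<Omega>)"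
    using integration_by_parts[OF \<psi> test_functions_smooth[OF \<phi>] i]
    by (simp only: gradient_inner_Basis[OF i] integral_domain_eq[OF m(1)] integral_domain_eq[OF m(2)] ind)
qed

lemma is_weak_grad_limit:
  fixes v :: "'a \<Rightarrow> real"
  assumes vk: "\<And>k. vk k \<in> L2 \<Omega>" and Gk: "\<And>k. is_weak_grad \<Omega> (vk k) (Gk k)"
    and v: "v \<in> L2 \<Omega>" and G: "G \<in> L2 \<Omega>"
    and limv: "(\<lambda>k. L2norm \<Omega> (\<lambda>x. vk k x - v x)) \<longlonglongrightarrow> 0"
    and limG: "(\<lambda>k. L2norm \<Omega> (\<lambda>x. Gk k x - G x)) \<longlonglongrightarrow> 0"
  shows "is_weak_grad \<Omega> v G"
  unfolding is_weak_grad_def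
proof (intro conjI ballI G)
  fix \<phi> :: "'a \<Rightarrow> real" and i :: 'a
  assume \<phi>: "\<phi> \<in> test_functions \<Omega>" and i: "i \<in> Basis"
  have "(\<lambda>x. \<phi> x *\<^sub>R i) \<in> borel_measurable (lebesgue_on \<Omega>)"
    using L2_measurable[OF test_function_L2[OF \<phi>]] by measurable
  then have \<phi>i: "(\<lambda>x. \<phi> x *\<^sub>R i) \<in> L2 \<Omega>"
    using i by (intro L2_dominated[OF test_function_L2[OF \<phi>]]) auto
  have l1: "(\<lambda>k. \<integral>x. vk k x * partial_deriv i \<phi> x \<partial>lebesgue_on \<Omega>) \<longlonglongrightarrow> (\<integral>x. v x * partial_deriv i \<phi> x \<partial>lebesgue_on \<Omega>)"
    using L2_inner_tendsto[OF vk v test_function_L2[OF test_functions_partial_deriv[OF \<phi> i]] limv]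
    by (simp add: L2_inner_def)
  have l2: "(\<lambda>k. \<integral>x. (Gk k x \<bullet> i) * \<phi> x \<partial>lebesgue_on \<Omega>) \<longlonglongrightarrow> (\<integral>x. (G x \<bullet> i) * \<phi> x \<partial>lebesgue_on \<Omega>)"
    using L2_inner_tendsto[OF is_weak_grad_L2[OF Gk] G \<phi>i limG]
    by (simp add: L2_inner_def mult.commute)
  have "(\<integral>x. vk k x * partial_deriv i \<phi> x \<partial>lebesgue_on \<Omega>) = - (\<integral>x. (Gk k x \<bullet> i) * \<phi> x \<partial>lebesgue_on \<Omega>)" for k
    using Gk[of k] \<phi> i by (simp add: is_weak_grad_def)
  then show "(\<integral>x. v x * partial_deriv i \<phi> x \<partial>lebesgue_on \<Omega>) = - (\<integral>x. (G x \<bullet> i) * \<phi> x \<partial>lebesgue_on \<Omega>)"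
    using LIMSEQ_unique[OF l1] tendsto_minus[OF l2] by simp
qed

text \<open>
  Limits of functions and gradients are controlled separately. With the next lemma this replaces
  \<open>H1_norm\<close>, which is stated through a chosen representative of the weak gradient.
\<close>

lemma H10I:
  fixes v :: "'a \<Rightarrow> real"
  assumes \<phi>: "\<And>k. \<phi> k \<in> test_functions \<Omega>" and v: "v \<in> L2 \<Omega>" and G: "G \<in> L2 \<Omega>"
    and limv: "(\<lambda>k. L2norm \<Omega> (\<lambda>x. \<phi> k x - v x)) \<longlonglongrightarrow> 0"
    and limG: "(\<lambda>k. L2norm \<Omega> (\<lambda>x. gradient (\<phi> k) x - G x)) \<longlonglongrightarrow> 0"
  shows "v \<in> H10 \<Omega>" and "is_weak_grad \<Omega> v G"
proof -
  show wG: "is_weak_grad \<Omega> v G"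
    by (rule is_weak_grad_limit[OF test_function_L2[OF \<phi>] is_weak_grad_gradient[OF \<phi>] v G limv limG])
  have "H1_norm \<Omega> (\<lambda>x. v x - \<phi> k x)
      = sqrt ((L2norm \<Omega> (\<lambda>x. \<phi> k x - v x))\<^sup>2 + (L2norm \<Omega> (\<lambda>x. gradient (\<phi> k) x - G x))\<^sup>2)" for k
    using L2norm_weak_grad[OF L2_diff[OF v test_function_L2[OF \<phi>]]
        is_weak_grad_diff[OF v test_function_L2[OF \<phi>] wG is_weak_grad_gradient[OF \<phi>]], of k]
    by (simp add: H1_norm_def L2_inner_self L2norm_minus_commute[of v] L2norm_minus_commute[of G])
  moreover have "(\<lambda>k. sqrt ((L2norm \<Omega> (\<lambda>x. \<phi> k x - v x))\<^sup>2 + (L2norm \<Omega> (\<lambda>x. gradient (\<phi> k) x - G x))\<^sup>2)) \<longlonglongrightarrow> sqrt (0\<^sup>2 + 0\<^sup>2)"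
    by (intro tendsto_intros limv limG)
  ultimately have "(\<lambda>k. H1_norm \<Omega> (\<lambda>x. v x - \<phi> k x)) \<longlonglongrightarrow> 0" by simp
  then show "v \<in> H10 \<Omega>" using \<phi> H1I[OF v wG] unfolding H10_def by blast
qed

lemma H10_approx:
  fixes v :: "'a \<Rightarrow> real"
  assumes v: "v \<in> H10 \<Omega>" and G: "is_weak_grad \<Omega> v G"
  obtains \<phi> where "\<And>k. \<phi> k \<in> test_functions \<Omega>"
    "(\<lambda>k. L2norm \<Omega> (\<lambda>x. \<phi> k x - v x)) \<longlonglongrightarrow> 0"
    "(\<lambda>k. L2norm \<Omega> (\<lambda>x. gradient (\<phi> k) x - G x)) \<longlonglongrightarrow> 0"
proof -
  obtain \<phi> where \<phi>: "\<And>k. \<phi> k \<in> test_functions \<Omega>" and lim: "(\<lambda>k. H1_norm \<Omega> (\<lambda>x. v x - \<phi> k x)) \<longlonglongrightarrow> 0"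
    using v by (auto simp: H10_def)
  have vL2: "v \<in> L2 \<Omega>" using v by (auto simp: H10_def H1_def)
  have eq: "H1_norm \<Omega> (\<lambda>x. v x - \<phi> k x)
      = sqrt ((L2norm \<Omega> (\<lambda>x. \<phi> k x - v x))\<^sup>2 + (L2norm \<Omega> (\<lambda>x. gradient (\<phi> k) x - G x))\<^sup>2)" for k
    using L2norm_weak_grad[OF L2_diff[OF vL2 test_function_L2[OF \<phi>]]
        is_weak_grad_diff[OF vL2 test_function_L2[OF \<phi>] G is_weak_grad_gradient[OF \<phi>]], of k]
    by (simp add: H1_norm_def L2_inner_self L2norm_minus_commute[of v] L2norm_minus_commute[of G])
  have "L2norm \<Omega> (\<lambda>x. \<phi> k x - v x) \<le> H1_norm \<Omega> (\<lambda>x. v x - \<phi> k x)"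
    "L2norm \<Omega> (\<lambda>x. gradient (\<phi> k) x - G x) \<le> H1_norm \<Omega> (\<lambda>x. v x - \<phi> k x)" for k
    unfolding eq by (auto intro!: real_le_rsqrt)
  then show ?thesis
    by (intro that[OF \<phi>] L2norm_squeeze[OF _ lim])
qed

lemma H10_H1: "v \<in> H10 \<Omega> \<Longrightarrow> v \<in> H1 \<Omega>"
  by (simp add: H10_def)

lemma test_function_H10: "\<phi> \<in> test_functions \<Omega> \<Longrightarrow> \<phi> \<in> H10 \<Omega>"
  by (rule H10I(1)[of "\<lambda>k. \<phi>" _ "gradient \<phi>"])
    (auto intro: test_function_L2 gradient_test_function_L2 simp: L2norm_def L2_inner_def)

lemma H10_add_scale:
  fixes u v :: "'a \<Rightarrow> real"
  assumes u: "u \<in> H10 \<Omega>" and v: "v \<in> H10 \<Omega>"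
  shows "(\<lambda>x. u x + c * v x) \<in> H10 \<Omega>"
proof -
  note uG = is_weak_grad_weak_grad[OF H10_H1[OF u]] and vG = is_weak_grad_weak_grad[OF H10_H1[OF v]]
  note uL = H1_L2[OF H10_H1[OF u]] and vL = H1_L2[OF H10_H1[OF v]]
  obtain \<phi> where \<phi>: "\<And>k. \<phi> k \<in> test_functions \<Omega>"
    "(\<lambda>k. L2norm \<Omega> (\<lambda>x. \<phi> k x - u x)) \<longlonglongrightarrow> 0"
    "(\<lambda>k. L2norm \<Omega> (\<lambda>x. gradient (\<phi> k) x - weak_grad \<Omega> u x)) \<longlonglongrightarrow> 0"
    using H10_approx[OF u uG] by blast
  obtain \<psi> where \<psi>: "\<And>k. \<psi> k \<in> test_functions \<Omega>"
    "(\<lambda>k. L2norm \<Omega> (\<lambda>x. \<psi> k x - v x)) \<longlonglongrightarrow> 0"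
    "(\<lambda>k. L2norm \<Omega> (\<lambda>x. gradient (\<psi> k) x - weak_grad \<Omega> v x)) \<longlonglongrightarrow> 0"
    using H10_approx[OF v vG] by blast
  let ?\<chi> = "\<lambda>k x. \<phi> k x + c * \<psi> k x"
  have \<chi>: "?\<chi> k \<in> test_functions \<Omega>" for k
    by (intro test_functions_add test_functions_cmult \<phi> \<psi>)
  have grad: "gradient (?\<chi> k) x = gradient (\<phi> k) x + c *\<^sub>R gradient (\<psi> k) x" for k x
  proof -
    have d: "\<phi> k differentiable (at x)" "\<psi> k differentiable (at x)"
      using \<phi>(1) \<psi>(1) by (auto intro: smooth_differentiable test_functions_smooth)
    have "partial_deriv i (?\<chi> k) x = partial_deriv i (\<phi> k) x + c * partial_deriv i (\<psi> k) x" for i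
    proof -
      have "partial_deriv i (?\<chi> k) x = partial_deriv i (\<phi> k) x + partial_deriv i (\<lambda>x. c * \<psi> k x) x"
        by (rule partial_deriv_add) (use d in auto)
      also have "partial_deriv i (\<lambda>x. c * \<psi> k x) x = c * partial_deriv i (\<psi> k) x"
        using partial_deriv_mult[of "\<lambda>x. c" x "\<psi> k" i] d partial_deriv_eqI[of "\<lambda>x. c" "\<lambda>h. 0" x i] by simp
      finally show ?thesis .
    qed
    then show ?thesis
      by (simp add: gradient_def scaleR_left_distrib sum.distrib scaleR_sum_right)
  qed
  show ?thesis
  proof (rule H10I(1)[of ?\<chi> _ "\<lambda>x. weak_grad \<Omega> u x + c *\<^sub>R weak_grad \<Omega> v x"])
    show "?\<chi> k \<in> test_functions \<Omega>" for k by (rule \<chi>)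
    show "(\<lambda>x. u x + c * v x) \<in> L2 \<Omega>" by (intro L2_add L2_mult_const uL vL)
    show "(\<lambda>x. weak_grad \<Omega> u x + c *\<^sub>R weak_grad \<Omega> v x) \<in> L2 \<Omega>"
      by (intro L2_add L2_scaleR is_weak_grad_L2[OF uG] is_weak_grad_L2[OF vG])
    show "(\<lambda>k. L2norm \<Omega> (\<lambda>x. ?\<chi> k x - (u x + c * v x))) \<longlonglongrightarrow> 0"
      using L2_tendsto_add_scaleR[OF test_function_L2[OF \<phi>(1)] uL test_function_L2[OF \<psi>(1)] vL \<phi>(2) \<psi>(2)] by simp
    show "(\<lambda>k. L2norm \<Omega> (\<lambda>x. gradient (?\<chi> k) x - (weak_grad \<Omega> u x + c *\<^sub>R weak_grad \<Omega> v x))) \<longlonglongrightarrow> 0"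
      unfolding grad
      by (rule L2_tendsto_add_scaleR[OF gradient_test_function_L2[OF \<phi>(1)] is_weak_grad_L2[OF uG]
            gradient_test_function_L2[OF \<psi>(1)] is_weak_grad_L2[OF vG] \<phi>(3) \<psi>(3)])
  qed
qed

lemma H10_diff:
  fixes u v :: "'a \<Rightarrow> real"
  assumes "u \<in> H10 \<Omega>" "v \<in> H10 \<Omega>" shows "(\<lambda>x. u x - v x) \<in> H10 \<Omega>"
  using H10_add_scale[OF assms, of "-1"] by simp

text \<open>
  A diagonal sequence of test functions approximates the limit.
\<close>

lemma H10_closed:
  fixes v :: "'a \<Rightarrow> real"
  assumes vk: "\<And>k. vk k \<in> H10 \<Omega>" and Gk: "\<And>k. is_weak_grad \<Omega> (vk k) (Gk k)"
    and v: "v \<in> L2 \<Omega>" and G: "G \<in> L2 \<Omega>"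
    and limv: "(\<lambda>k. L2norm \<Omega> (\<lambda>x. vk k x - v x)) \<longlonglongrightarrow> 0"
    and limG: "(\<lambda>k. L2norm \<Omega> (\<lambda>x. Gk k x - G x)) \<longlonglongrightarrow> 0"
  shows "v \<in> H10 \<Omega>" and "is_weak_grad \<Omega> v G"
proof -
  have "\<exists>\<phi>. \<phi> \<in> test_functions \<Omega> \<and> L2norm \<Omega> (\<lambda>x. \<phi> x - vk k x) < inverse (real (Suc k)) \<and>
      L2norm \<Omega> (\<lambda>x. gradient \<phi> x - Gk k x) < inverse (real (Suc k))" for k
  proof -
    obtain \<psi> where \<psi>: "\<And>k. \<psi> k \<in> test_functions \<Omega>"
      "(\<lambda>j. L2norm \<Omega> (\<lambda>x. \<psi> j x - vk k x)) \<longlonglongrightarrow> 0"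
      "(\<lambda>j. L2norm \<Omega> (\<lambda>x. gradient (\<psi> j) x - Gk k x)) \<longlonglongrightarrow> 0"
      using H10_approx[OF vk Gk, of k] by blast
    have "\<forall>\<^sub>F j in sequentially. L2norm \<Omega> (\<lambda>x. \<psi> j x - vk k x) < inverse (real (Suc k)) \<and>
      L2norm \<Omega> (\<lambda>x. gradient (\<psi> j) x - Gk k x) < inverse (real (Suc k))"
      using \<psi>(2,3) by (intro eventually_conj order_tendstoD(2)) auto
    then obtain j where "L2norm \<Omega> (\<lambda>x. \<psi> j x - vk k x) < inverse (real (Suc k))"
      "L2norm \<Omega> (\<lambda>x. gradient (\<psi> j) x - Gk k x) < inverse (real (Suc k))"
      unfolding eventually_sequentially by blast
    then show ?thesis using \<psi>(1) by blast
  qed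
  then obtain \<phi> where \<phi>: "\<And>k. \<phi> k \<in> test_functions \<Omega>"
    and 1: "\<And>k. L2norm \<Omega> (\<lambda>x. \<phi> k x - vk k x) < inverse (real (Suc k))"
    and 2: "\<And>k. L2norm \<Omega> (\<lambda>x. gradient (\<phi> k) x - Gk k x) < inverse (real (Suc k))" by metis
  have tri: "(\<lambda>k. L2norm \<Omega> (\<lambda>x. a k x - c x)) \<longlonglongrightarrow> 0"
    if "\<And>k. a k \<in> L2 \<Omega>" "\<And>k. b k \<in> L2 \<Omega>" "c \<in> L2 \<Omega>" "\<And>k. L2norm \<Omega> (\<lambda>x. a k x - b k x) < inverse (real (Suc k))"
      "(\<lambda>k. L2norm \<Omega> (\<lambda>x. b k x - c x)) \<longlonglongrightarrow> 0"
    for a b :: "nat \<Rightarrow> 'a \<Rightarrow> 'b::euclidean_space" and c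
  proof (rule tendsto_sandwich[OF _ _ tendsto_const])
    have "L2norm \<Omega> (\<lambda>x. a k x - c x) \<le> inverse (real (Suc k)) + L2norm \<Omega> (\<lambda>x. b k x - c x)" for k
      using L2norm_triangle_diff[OF that(1,3,2), of k k] that(4)[of k] by linarith
    then show "\<forall>\<^sub>F k in sequentially. L2norm \<Omega> (\<lambda>x. a k x - c x) \<le> inverse (real (Suc k)) + L2norm \<Omega> (\<lambda>x. b k x - c x)"
      by simp
    show "(\<lambda>k. inverse (real (Suc k)) + L2norm \<Omega> (\<lambda>x. b k x - c x)) \<longlonglongrightarrow> 0"
      using tendsto_add[OF LIMSEQ_inverse_real_of_nat that(5)] by simp
  qed simp
  have l1: "(\<lambda>k. L2norm \<Omega> (\<lambda>x. \<phi> k x - v x)) \<longlonglongrightarrow> 0"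
    by (rule tri[OF test_function_L2[OF \<phi>] H1_L2[OF H10_H1[OF vk]] v 1 limv])
  have l2: "(\<lambda>k. L2norm \<Omega> (\<lambda>x. gradient (\<phi> k) x - G x)) \<longlonglongrightarrow> 0"
    by (rule tri[OF gradient_test_function_L2[OF \<phi>] is_weak_grad_L2[OF Gk] G 2 limG])
  show "v \<in> H10 \<Omega>" "is_weak_grad \<Omega> v G"
    using H10I[OF \<phi> v G l1 l2] by auto
qed

end

text \<open>
  The derivative \<open>T'\<close> is a mollified indicator function: one on \<open>[a, b]\<close>, zero outside \<open>[a/2, 2b]\<close>, with
  values in \<open>[0, 1]\<close>. Integrating it from \<open>a\<close> gives \<open>T\<close>, which is the identity on \<open>[a, b]\<close>, moves every
  other point towards this interval, and is constant outside \<open>[a/2, 2b]\<close>; hence its range.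
\<close>

section \<open>Smooth truncation\<close>

lemma smooth_truncation_exists:
  fixes a b :: real
  assumes a: "0 < a" and ab: "a < b"
  obtains T T' :: "real \<Rightarrow> real" and L :: real
    where "smooth T" "\<And>t. (T has_real_derivative T' t) (at t)"
      "\<And>t. 0 \<le> T' t" "\<And>t. T' t \<le> 1" "L \<ge> 0" "\<And>s t. \<bar>T' s - T' t\<bar> \<le> L * \<bar>s - t\<bar>"
      "\<And>t. a \<le> t \<Longrightarrow> t \<le> b \<Longrightarrow> T t = t" "\<And>t. a \<le> t \<Longrightarrow> t \<le> b \<Longrightarrow> T' t = 1"
      "\<And>t. a / 2 \<le> T t" "\<And>t. T t \<le> 2 * b"
      "\<And>t. t \<le> a \<Longrightarrow> t \<le> T t \<and> T t \<le> a" "\<And>t. b \<le> t \<Longrightarrow> b \<le> T t \<and> T t \<le> t"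
proof -
  let ?e = "a / 4"
  let ?F = "indicator {3 * a / 4..b + a / 4} :: real \<Rightarrow> real"
  define \<tau> where "\<tau> = conv (mollifier ?e) ?F"
  have e: "?e > 0" using a by simp
  have F: "integrable lborel ?F" by (intro integrable_real_indicator) (auto simp: emeasure_lborel_Icc_eq)
  have \<tau>_smooth: "smooth \<tau>" unfolding \<tau>_def by (rule smooth_conv[OF mollifier_test[OF e] F])
  have \<tau>_range: "0 \<le> \<tau> t" "\<tau> t \<le> 1" for t
  proof -
    have "\<bar>\<tau> t - 1 / 2\<bar> \<le> 1 / 2"
      unfolding \<tau>_def by (rule mollify_close[OF e F]) (auto simp: indicator_def)
    then show "0 \<le> \<tau> t" "\<tau> t \<le> 1" by linarith+
  qed
  have \<tau>_1: "\<tau> t = 1" if "a \<le> t" "t \<le> b" for t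
  proof -
    have "\<bar>\<tau> t - 1\<bar> \<le> 0"
      unfolding \<tau>_def by (rule mollify_close[OF e F]) (use that in \<open>auto simp: indicator_def abs_real_def split: if_splits\<close>)
    then show ?thesis by simp
  qed
  have \<tau>_0: "\<tau> t = 0" if "t \<le> a / 2 \<or> 2 * b \<le> t" for t
  proof -
    have "\<bar>\<tau> t - 0\<bar> \<le> 0"
      unfolding \<tau>_def by (rule mollify_close[OF e F]) (use that a ab in \<open>auto simp: indicator_def abs_less_iff\<close>)
    then show ?thesis by simp
  qed
  have "\<tau> \<in> test_functions UNIV"
    by (rule test_functionsI[OF \<tau>_smooth, of "{a / 2..2 * b}"]) (use \<tau>_0 in auto)
  then obtain L where L: "L \<ge> 0" "\<And>s t. \<bar>\<tau> s - \<tau> t\<bar> \<le> L * norm (s - t)"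
    using test_functions_Lipschitz by metis
  define T where "T t = a + (LBINT y=ereal a..ereal t. \<tau> y)" for t
  have T_deriv: "(T has_real_derivative \<tau> t) (at t)" for t
  proof -
    \<comment> \<open>an interval with both \<open>a\<close> and \<open>t\<close> in its interior\<close>
    let ?l = "min a t - 1" and ?r = "max a t + 1"
    have "((\<lambda>u. LBINT y=ereal a..ereal u. \<tau> y) has_vector_derivative \<tau> t) (at t within {?l..?r})"
      by (rule interval_integral_FTC2) (auto intro: smooth_continuous[OF \<tau>_smooth])
    then have "((\<lambda>u. LBINT y=ereal a..ereal u. \<tau> y) has_real_derivative \<tau> t) (at t)"
      by (subst (asm) at_within_interior) (auto simp: has_real_derivative_iff_has_vector_derivative)
    then show ?thesis unfolding T_def by (auto intro!: derivative_eq_intros)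
  qed
  have T_smooth: "smooth T"
    unfolding smooth_def
  proof
    fix k show "Ck k T"
      using Ck_Suc_imp_Ck[OF Ck_Suc_real[OF T_deriv]] \<tau>_smooth by (simp add: smooth_def)
  qed
  have Ta: "T a = a" by (simp add: T_def)
  have mono: "T s \<le> T t" if "s \<le> t" for s t
    using that by (rule DERIV_nonneg_imp_nondecreasing) (use T_deriv \<tau>_range in blast)
  have lip: "T t - T s \<le> t - s" if "s \<le> t" for s t
  proof -
    have "s - T s \<le> t - T t"
      using that
    proof (rule DERIV_nonneg_imp_nondecreasing)
      fix x
      have "((\<lambda>x. x - T x) has_real_derivative 1 - \<tau> x) (at x)"
        by (auto intro!: derivative_eq_intros T_deriv)
      then show "\<exists>y. ((\<lambda>x. x - T x) has_real_derivative y) (at x) \<and> 0 \<le> y"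
        using \<tau>_range(2)[of x] by (intro exI[of _ "1 - \<tau> x"]) auto
    qed
    then show ?thesis by simp
  qed
  have T_id: "T t = t" if t: "a \<le> t" "t \<le> b" for t
  proof -
    have "T a - a \<le> T t - t"
      using t(1)
    proof (rule DERIV_nonneg_imp_nondecreasing)
      fix x assume "a \<le> x" "x \<le> t"
      then have "((\<lambda>x. T x - x) has_real_derivative 0) (at x)"
        using \<tau>_1[of x] t by (auto intro!: derivative_eq_intros T_deriv)
      then show "\<exists>y. ((\<lambda>x. T x - x) has_real_derivative y) (at x) \<and> 0 \<le> y" by blast
    qed
    with lip[OF t(1)] Ta show ?thesis by simp
  qed
  have T_const: "T s = T t" if st: "s \<le> t" and out: "t \<le> a / 2 \<or> 2 * b \<le> s" for s t
  proof (rule antisym[OF mono[OF st]])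
    have "- T s \<le> - T t"
      using st
    proof (rule DERIV_nonneg_imp_nondecreasing)
      fix x assume "s \<le> x" "x \<le> t"
      then have "((\<lambda>x. - T x) has_real_derivative 0) (at x)"
        using \<tau>_0[of x] out T_deriv[of x] by (auto intro!: derivative_eq_intros)
      then show "\<exists>y. ((\<lambda>x. - T x) has_real_derivative y) (at x) \<and> 0 \<le> y" by blast
    qed
    then show "T t \<le> T s" by simp
  qed
  have Tb: "T b = b" using T_id[of b] ab by simp
  have low: "t \<le> T t \<and> T t \<le> a" if "t \<le> a" for t
    using lip[OF that] mono[OF that] Ta by simp
  have up: "b \<le> T t \<and> T t \<le> t" if "b \<le> t" for t
    using lip[OF that] mono[OF that] Tb by simp
  have "a / 2 \<le> T t" for t
    using T_const[of t "a / 2"] low[of "a / 2"] mono[of "a / 2" t] a by (cases "t \<le> a / 2") auto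
  moreover have "T t \<le> 2 * b" for t
    using T_const[of "2 * b" t] up[of "2 * b"] mono[of t "2 * b"] a ab by (cases "t \<le> 2 * b") auto
  ultimately show ?thesis
    using that[OF T_smooth T_deriv \<tau>_range L(1)] L(2) T_id \<tau>_1 low up by auto
qed

text \<open>
  Mollify the indicator function of a neighbourhood of \<open>K\<close>.
\<close>

lemma smooth_cutoff_exists:
  fixes K U :: "'a::euclidean_space set"
  assumes K: "compact K" and U: "open U" and KU: "K \<subseteq> U"
  obtains \<eta> where "\<eta> \<in> test_functions U" "\<And>x. x \<in> K \<Longrightarrow> \<eta> x = 1"
    "\<And>i x. x \<in> K \<Longrightarrow> partial_deriv i \<eta> x = 0"
proof -
  obtain e where e: "e > 0" "(\<Union>x\<in>K. cball x e) \<subseteq> U"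
    using compact_subset_open_imp_cball_epsilon_subset[OF K U KU] by blast
  \<comment> \<open>mollifying the \<open>2 * d\<close>-neighbourhood at scale \<open>d\<close> leaves it one within \<open>d\<close> of \<open>K\<close> and zero beyond \<open>3 * d\<close>\<close>
  define d where "d = e / 3"
  have d: "d > 0" using e by (simp add: d_def)
  have nbhd: "compact (\<Union>x\<in>K. cball x r)" for r
  proof -
    have cball: "cball x r = (\<Union>y\<in>cball 0 r. {x + y})" for x :: 'a
    proof (intro set_eqI iffI)
      fix z assume "z \<in> cball x r"
      then show "z \<in> (\<Union>y\<in>cball 0 r. {x + y})"
        by (intro UN_I[of "z - x"]) (auto simp: dist_norm norm_minus_commute)
    qed (auto simp: dist_norm)
    have "(\<Union>x\<in>K. cball x r) = (\<Union>x\<in>K. \<Union>y\<in>cball 0 r. {x + y})"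
      by (intro SUP_cong refl) (rule cball)
    then show ?thesis using compact_sums'[OF K compact_cball[of 0 r]] by (simp only:)
  qed
  let ?S = "\<Union>x\<in>K. cball x (2 * d)"
  let ?F = "indicator ?S :: 'a \<Rightarrow> real"
  have F: "integrable lborel ?F"
    using emeasure_compact_finite[OF nbhd[of "2 * d"]] borel_compact[OF nbhd[of "2 * d"]]
    by (intro integrable_real_indicator) auto
  define \<eta> where "\<eta> = conv (mollifier d) ?F"
  have \<eta>_1: "\<eta> z = 1" if "x \<in> K" "z \<in> ball x d" for x z
  proof -
    have "\<bar>\<eta> z - 1\<bar> \<le> 0"
      unfolding \<eta>_def
    proof (rule mollify_close[OF d F])
      fix y assume "norm (z - y) < d"
      then have "y \<in> cball x (2 * d)"
        using that(2) dist_triangle[of x y z] by (simp add: dist_norm)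
      then have "y \<in> ?S" using that(1) by blast
      then show "\<bar>?F y - 1\<bar> \<le> 0" by (simp only: indicator_simps)
    qed
    then show ?thesis by simp
  qed
  have \<eta>_0: "\<eta> z = 0" if "z \<notin> (\<Union>x\<in>K. cball x e)" for z
  proof -
    have "\<bar>\<eta> z - 0\<bar> \<le> 0"
      unfolding \<eta>_def
    proof (rule mollify_close[OF d F])
      fix y assume y: "norm (z - y) < d"
      have "y \<notin> ?S"
      proof
        assume "y \<in> ?S"
        then obtain x where x: "x \<in> K" "dist x y \<le> 2 * d" by auto
        then have "dist x z \<le> e" using y dist_triangle[of x z y] by (simp add: d_def dist_norm norm_minus_commute)
        then show False using x that by auto
      qed
      then show "\<bar>?F y - 0\<bar> \<le> 0" by (simp add: indicator_def)
    qed
    then show ?thesis by simp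
  qed
  show ?thesis
  proof (rule that)
    show "\<eta> \<in> test_functions U"
      by (rule test_functionsI[OF _ nbhd e(2) \<eta>_0])
        (simp add: \<eta>_def smooth_conv[OF mollifier_test[OF d] F])
    show "\<eta> x = 1" if "x \<in> K" for x using \<eta>_1[OF that, of x] d by simp
    show "partial_deriv i \<eta> x = 0" if "x \<in> K" for i x
    proof -
      have "(\<eta> has_derivative (\<lambda>h. 0)) (at x)"
      proof (rule has_derivative_transform_within_open[OF has_derivative_const[of 1] open_ball[of x d]])
        show "x \<in> ball x d" using d by simp
        show "1 = \<eta> z" if "z \<in> ball x d" for z using \<eta>_1[OF \<open>x \<in> K\<close> that] by simp
      qed
      from partial_deriv_eqI[OF this] show ?thesis .
    qed
  qed
qed

context bounded_open
begin

lemma continuous_borel_extension: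
  assumes g: "continuous_on (closure \<Omega>) g"
  shows "borel_extension g (\<lambda>x. indicator \<Omega> x * g x)"
proof -
  have "bounded (g ` closure \<Omega>)"
    using g bounded_domain by (intro compact_imp_bounded compact_continuous_image) auto
  then obtain C where "\<forall>y\<in>g ` closure \<Omega>. norm y \<le> C"
    unfolding bounded_iff by blast
  then have C: "\<bar>g x\<bar> \<le> C" if "x \<in> \<Omega>" for x
    using subsetD[OF closure_subset that] by simp
  have [measurable]: "(\<lambda>x. indicator \<Omega> x * g x) \<in> borel_measurable borel"
    using borel_measurable_continuous_on_indicator[OF domain_sets(2) continuous_on_subset[OF g closure_subset]]
    unfolding real_scaleR_def .
  have I: "integrable lborel (\<lambda>x. indicator \<Omega> x * c)" for c :: real
    by (rule integrable_mult_left, rule integrable_real_indicator)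
      (use bounded_domain emeasure_bounded_finite[of \<Omega>] in \<open>auto simp: less_top[symmetric]\<close>)
  have "integrable lborel (\<lambda>x. indicator \<Omega> x * g x)"
    by (rule Bochner_Integration.integrable_bound[OF I[of C]], simp)
      (use order_trans[OF C abs_ge_self] in \<open>auto simp: indicator_def\<close>)
  moreover have "integrable lborel (\<lambda>x. (indicator \<Omega> x * g x)\<^sup>2)"
  proof (rule Bochner_Integration.integrable_bound[OF I[of "C\<^sup>2"]])
    show "AE x in lborel. norm ((indicator \<Omega> x * g x)\<^sup>2) \<le> norm (indicator \<Omega> x * C\<^sup>2)"
    proof (rule AE_I2)
      fix x
      have "(g x)\<^sup>2 \<le> C\<^sup>2" if "x \<in> \<Omega>"
        using C[OF that] by (simp add: abs_le_square_iff[symmetric])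
      then show "norm ((indicator \<Omega> x * g x)\<^sup>2) \<le> norm (indicator \<Omega> x * C\<^sup>2)"
        by (auto simp: indicator_def)
    qed
  qed simp
  ultimately show ?thesis
    by (auto simp: borel_extension_def intro!: AE_I2)
qed

text \<open>
  This is where continuity of \<open>g\<close> up to the boundary enters the approximation: it makes the modulus of
  continuity uniform.
\<close>

lemma mollify_uniform_on_compact:
  assumes g: "continuous_on (closure \<Omega>) g" and S: "compact S" "S \<subseteq> \<Omega>" and \<epsilon>: "\<epsilon> > 0"
  shows "\<forall>\<^sub>F k in sequentially. \<forall>x\<in>S.
    \<bar>conv (mollifier (inverse (real (Suc k)))) (\<lambda>x. indicator \<Omega> x * g x) x - g x\<bar> \<le> \<epsilon>"
proof -
  obtain e where e: "e > 0" "(\<Union>x\<in>S. cball x e) \<subseteq> \<Omega>"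
    using compact_subset_open_imp_cball_epsilon_subset[OF S(1) open_domain S(2)] by blast
  have "uniformly_continuous_on (closure \<Omega>) g"
    using bounded_domain by (intro compact_uniformly_continuous g) simp
  then have "\<exists>d>0. \<forall>x\<in>closure \<Omega>. \<forall>y\<in>closure \<Omega>. dist y x < d \<longrightarrow> dist (g y) (g x) < \<epsilon>"
    using \<epsilon> by (simp add: uniformly_continuous_on_def)
  then obtain d where d: "d > 0"
    and dg: "\<forall>x\<in>closure \<Omega>. \<forall>y\<in>closure \<Omega>. dist y x < d \<longrightarrow> dist (g y) (g x) < \<epsilon>"
    by (elim exE conjE)
  have "\<forall>\<^sub>F k in sequentially. inverse (real (Suc k)) < min d e"
    using LIMSEQ_inverse_real_of_nat d e(1) by (intro order_tendstoD(2)) auto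
  then show ?thesis
  proof eventually_elim
    case (elim k)
    show ?case
    proof
      fix x assume x: "x \<in> S"
      show "\<bar>conv (mollifier (inverse (real (Suc k)))) (\<lambda>x. indicator \<Omega> x * g x) x - g x\<bar> \<le> \<epsilon>"
      proof (rule mollify_close)
        show "integrable lborel (\<lambda>x. indicator \<Omega> x * g x)"
          using continuous_borel_extension[OF g] by (simp add: borel_extension_def)
        fix y assume y: "norm (x - y) < inverse (real (Suc k))"
        then have "y \<in> cball x e" using elim by (simp add: dist_norm)
        then have "y \<in> \<Omega>" using e(2) x by blast
        moreover have "dist (g y) (g x) < \<epsilon>"
        proof -
          have "x \<in> closure \<Omega>" "y \<in> closure \<Omega>"
            using x S(2) \<open>y \<in> \<Omega>\<close> closure_subset by auto
          moreover have "dist y x < d" using y elim by (simp add: dist_norm norm_minus_commute)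
          ultimately show ?thesis using dg by simp
        qed
        ultimately show "\<bar>indicator \<Omega> y * g y - g x\<bar> \<le> \<epsilon>" by (simp add: dist_real_def)
      qed simp
    qed
  qed
qed

text \<open>
  Chain rule and zero boundary values for the truncation of \<open>g + \<phi>\<close>. Outside the compact set \<open>K\<close> the
  truncation changes nothing. With a cutoff function \<open>\<eta>\<close> that is one on \<open>K\<close> and mollifications \<open>g\<^sub>k\<close> of \<open>g\<close>,
  the functions \<open>\<eta> * (T (g\<^sub>k + \<phi>) - g\<^sub>k)\<close> are test functions, and their gradients are given by the classical
  chain rule. On the support of \<open>\<eta>\<close>, \<open>g\<^sub>k\<close> converges uniformly and its gradient is the mollified weak
  gradient of \<open>g\<close>, which converges in \<open>L\<^sup>2\<close>; so all products converge. In the limit \<open>\<eta>\<close> disappears,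
  because \<open>\<eta> = 1\<close> and \<open>\<nabla>\<eta> = 0\<close> on \<open>K\<close>, while \<open>T (g + \<phi>) - g\<close> and the asserted gradient vanish off \<open>K\<close>.
\<close>

lemma smooth_truncation_H10:
  fixes g \<phi> :: "'a \<Rightarrow> real" and T T' :: "real \<Rightarrow> real"
  assumes g: "g \<in> H1 \<Omega>" and g_cont: "continuous_on (closure \<Omega>) g"
    and \<phi>: "\<phi> \<in> test_functions \<Omega>"
    and T: "smooth T" and T': "\<And>t. (T has_real_derivative T' t) (at t)"
    and T'_nonneg: "\<And>t. 0 \<le> T' t" and T'_le: "\<And>t. T' t \<le> 1"
    and L: "L \<ge> 0" and T'_Lip: "\<And>s t. \<bar>T' s - T' t\<bar> \<le> L * \<bar>s - t\<bar>"
    and K: "compact K" "K \<subseteq> \<Omega>"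
    and outK: "\<And>x. x \<in> \<Omega> \<Longrightarrow> x \<notin> K \<Longrightarrow> \<phi> x = 0 \<and> gradient \<phi> x = 0 \<and> T (g x) = g x \<and> T' (g x) = 1"
  shows "(\<lambda>x. T (g x + \<phi> x) - g x) \<in> H10 \<Omega>"
    and "is_weak_grad \<Omega> (\<lambda>x. T (g x + \<phi> x) - g x)
      (\<lambda>x. T' (g x + \<phi> x) *\<^sub>R (weak_grad \<Omega> g x + gradient \<phi> x) - weak_grad \<Omega> g x)"
proof -
  let ?G = "weak_grad \<Omega> g"
  let ?v = "\<lambda>x. g x + \<phi> x"
  let ?\<psi> = "\<lambda>x. T (?v x) - g x"
  let ?\<Psi> = "\<lambda>x. T' (?v x) *\<^sub>R (?G x + gradient \<phi> x) - ?G x"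
  let ?F = "\<lambda>x. indicator \<Omega> x * g x"
  let ?\<rho> = "\<lambda>k. mollifier (inverse (real (Suc k))) :: 'a \<Rightarrow> real"
  have pos: "inverse (real (Suc k)) > 0" for k by simp
  note gL2 = H1_L2[OF g] and GL2 = H1_weak_grad_L2[OF g] and Gw = is_weak_grad_weak_grad[OF g]
  note F = continuous_borel_extension[OF g_cont]
  obtain \<eta> where \<eta>: "\<eta> \<in> test_functions \<Omega>" and \<eta>_1: "\<And>x. x \<in> K \<Longrightarrow> \<eta> x = 1"
    and d\<eta>_0: "\<And>i x. x \<in> K \<Longrightarrow> partial_deriv i \<eta> x = 0"
    using smooth_cutoff_exists[OF K(1) open_domain K(2)] by metis
  obtain S where S: "compact S" "S \<subseteq> \<Omega>" and \<eta>S: "\<And>x. x \<notin> S \<Longrightarrow> \<eta> x = 0"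
    using \<eta> by (metis test_functionsE)
  have d\<eta>S: "partial_deriv i \<eta> x = 0" if "x \<notin> S" for i x
    by (rule partial_deriv_outside[OF compact_imp_closed[OF S(1)] \<eta>S that])
  have "\<forall>i\<in>Basis. \<exists>H. borel_extension (\<lambda>x. ?G x \<bullet> i) H"
    using borel_extension_exists[OF L2_component[OF GL2]] by blast
  then obtain H where H: "\<And>i. i \<in> Basis \<Longrightarrow> borel_extension (\<lambda>x. ?G x \<bullet> i) (H i)" by metis
  define gk where "gk k = conv (?\<rho> k) ?F" for k
  define Gk where "Gk i k = conv (?\<rho> k) (H i)" for i k
  have gk_smooth: "smooth (gk k)" for k
    unfolding gk_def by (rule conv_smooth_extension[OF pos F])
  have GkL2: "Gk i k \<in> L2 \<Omega>" and Gk_lim: "(\<lambda>k. L2norm \<Omega> (\<lambda>x. Gk i k x - ?G x \<bullet> i)) \<longlonglongrightarrow> 0"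
    if "i \<in> Basis" for i k
    unfolding Gk_def using mollify_tendsto_L2norm[OF L2_component[OF GL2 that] H[OF that]] by auto
  have unif: "\<forall>\<^sub>F k in sequentially. \<forall>x\<in>S. \<bar>gk k x - g x\<bar> \<le> \<epsilon>" if "\<epsilon> > 0" for \<epsilon>
    unfolding gk_def by (rule mollify_uniform_on_compact[OF g_cont S that])
  obtain e where e: "e > 0" "(\<Union>x\<in>S. cball x e) \<subseteq> \<Omega>"
    using compact_subset_open_imp_cball_epsilon_subset[OF S(1) open_domain S(2)] by blast
  obtain N where N: "inverse (real (Suc N)) < e" using reals_Archimedean[OF e(1)] by blast
  have d_gk: "partial_deriv i (gk k) x = Gk i k x" if "i \<in> Basis" "k \<ge> N" "x \<in> S" for i k x
  proof -
    have "inverse (real (Suc k)) \<le> inverse (real (Suc N))" using that(2) by (intro le_imp_inverse_le) auto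
    then have "cball x (inverse (real (Suc k))) \<subseteq> cball x e"
      using N by (intro subset_cball) linarith
    also have "\<dots> \<subseteq> \<Omega>" using e(2) that(3) by blast
    finally show ?thesis
      unfolding gk_def Gk_def by (rule partial_deriv_mollified[OF gL2 Gw that(1) F H[OF that(1)] pos])
  qed
  have T_Lip: "\<bar>T s - T t\<bar> \<le> \<bar>s - t\<bar>" for s t
  proof -
    have "norm (T s - T t) \<le> 1 * norm (s - t)"
      by (rule field_differentiable_bound[of UNIV T T'])
        (use T' T'_nonneg T'_le in auto)
    then show ?thesis by simp
  qed
  define \<psi>k where "\<psi>k k x = \<eta> x * (T (gk k x + \<phi> x) - gk k x)" for k x
  have \<psi>k_test: "\<psi>k k \<in> test_functions \<Omega>" for k
    unfolding \<psi>k_def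
    by (intro test_functions_mult[OF \<eta>] smooth_diff smooth_compose[OF T] smooth_add gk_smooth test_functions_smooth[OF \<phi>])
  have d\<psi>k: "partial_deriv i (\<psi>k k) x = partial_deriv i \<eta> x * (T (gk k x + \<phi> x) - gk k x)
      + (\<eta> x * T' (gk k x + \<phi> x)) * (Gk i k x + partial_deriv i \<phi> x) - \<eta> x * Gk i k x"
    if i: "i \<in> Basis" and k: "k \<ge> N" for i k x
  proof -
    have dg: "gk k differentiable (at x)" and d\<phi>: "\<phi> differentiable (at x)" and d\<eta>: "\<eta> differentiable (at x)"
      using gk_smooth \<phi> \<eta> by (auto intro: smooth_differentiable test_functions_smooth)
    have dv: "(\<lambda>x. gk k x + \<phi> x) differentiable (at x)" using dg d\<phi> by simp
    have dT: "(\<lambda>x. T (gk k x + \<phi> x)) differentiable (at x)"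
      using smooth_differentiable[OF smooth_compose[OF T smooth_add[OF gk_smooth test_functions_smooth[OF \<phi>]]]] .
    have m: "(\<lambda>x. - 1 * gk k x) differentiable (at x)" using dg by simp
    have dm: "partial_deriv i (\<lambda>x. - 1 * gk k x) x = - partial_deriv i (gk k) x"
      using partial_deriv_mult[of "\<lambda>x. - 1" x "gk k" i] dg partial_deriv_eqI[of "\<lambda>x. - 1::real" "\<lambda>h. 0" x i] by simp
    have "partial_deriv i (\<lambda>x. T (gk k x + \<phi> x) + - 1 * gk k x) x
        = T' (gk k x + \<phi> x) * (partial_deriv i (gk k) x + partial_deriv i \<phi> x) - partial_deriv i (gk k) x"
      unfolding partial_deriv_add[OF dT m] partial_deriv_compose[OF T' dv] partial_deriv_add[OF dg d\<phi>] dm by simp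
    then have "partial_deriv i (\<psi>k k) x = \<eta> x * (T' (gk k x + \<phi> x) * (partial_deriv i (gk k) x + partial_deriv i \<phi> x)
        - partial_deriv i (gk k) x) + partial_deriv i \<eta> x * (T (gk k x + \<phi> x) - gk k x)"
      unfolding \<psi>k_def using partial_deriv_mult[OF d\<eta> differentiable_add[OF dT m], of i] by simp
    then show ?thesis
      using d_gk[OF i k, of x] \<eta>S[of x] by (cases "x \<in> S") (auto simp: algebra_simps)
  qed
  have g_meas[measurable]: "g \<in> borel_measurable (lebesgue_on \<Omega>)" by (rule L2_measurable[OF gL2])
  have gk_meas[measurable]: "gk k \<in> borel_measurable (lebesgue_on \<Omega>)" for k
    by (rule borel_measurable_domain[OF smooth_borel[OF gk_smooth]])
  have \<phi>_meas[measurable]: "\<phi> \<in> borel_measurable (lebesgue_on \<Omega>)" by (rule L2_measurable[OF test_function_L2[OF \<phi>]])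
  have \<eta>_meas[measurable]: "\<eta> \<in> borel_measurable (lebesgue_on \<Omega>)" by (rule L2_measurable[OF test_function_L2[OF \<eta>]])
  have [measurable]: "T \<in> borel_measurable borel" by (rule smooth_borel[OF T])
  have [measurable]: "T' \<in> borel_measurable borel"
  proof -
    have "T' = partial_deriv 1 T"
      by (rule ext) (use partial_deriv_eqI[OF T'[unfolded has_field_derivative_def], of 1] in simp)
    then show ?thesis using smooth_borel[OF smooth_partial_deriv[OF T, of 1]] by simp
  qed
  obtain C\<eta> where C\<eta>: "C\<eta> \<ge> 0" "\<And>x. \<bar>\<eta> x\<bar> \<le> C\<eta>" using test_functions_bounded[OF \<eta>] by metis
  have T_close: "\<bar>(T (gk k x + \<phi> x) - gk k x) - ?\<psi> x\<bar> \<le> 2 * \<bar>gk k x - g x\<bar>" for k x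
    using T_Lip[of "gk k x + \<phi> x" "?v x"] by (simp add: abs_real_def split: if_splits)
  \<comment> \<open>equality off \<open>S\<close> and control by \<open>gk - g\<close> on \<open>S\<close> give uniform convergence on the whole domain\<close>
  have unif': "\<forall>\<^sub>F k in sequentially. \<forall>x\<in>\<Omega>. \<bar>c k x - c0 x\<bar> \<le> \<epsilon>"
    if "\<epsilon> > 0" "D \<ge> 0" "\<And>k x. x \<in> S \<Longrightarrow> \<bar>c k x - c0 x\<bar> \<le> D * \<bar>gk k x - g x\<bar>"
      "\<And>k x. x \<notin> S \<Longrightarrow> c k x = c0 x" for c c0 and \<epsilon> D :: real
  proof -
    have "\<epsilon> / (D + 1) > 0" using that(1,2) by simp
    from unif[OF this] show ?thesis
    proof eventually_elim
      case (elim k)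
      show ?case
      proof
        fix x assume "x \<in> \<Omega>"
        show "\<bar>c k x - c0 x\<bar> \<le> \<epsilon>"
        proof (cases "x \<in> S")
          case True
          have "\<bar>c k x - c0 x\<bar> \<le> D * \<bar>gk k x - g x\<bar>" by (rule that(3)[OF True])
          also have "\<dots> \<le> (D + 1) * (\<epsilon> / (D + 1))" using elim True that(2) by (intro mult_mono) auto
          also have "\<dots> = \<epsilon>" using that(2) by simp
          finally show ?thesis .
        qed (use that in simp)
      qed
    qed
  qed
  let ?b1 = "\<lambda>x. \<eta> x * T' (?v x)"
  have b1_close: "\<bar>\<eta> x * T' (gk k x + \<phi> x) - ?b1 x\<bar> \<le> C\<eta> * L * \<bar>gk k x - g x\<bar>" for k x
  proof -
    have "\<bar>\<eta> x * T' (gk k x + \<phi> x) - ?b1 x\<bar> = \<bar>\<eta> x\<bar> * \<bar>T' (gk k x + \<phi> x) - T' (?v x)\<bar>"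
      by (simp add: right_diff_distrib[symmetric] abs_mult)
    also have "\<dots> \<le> C\<eta> * (L * \<bar>gk k x - g x\<bar>)"
      using T'_Lip[of "gk k x + \<phi> x" "?v x"] C\<eta> by (intro mult_mono) auto
    finally show ?thesis by simp
  qed
  have \<psi>L2: "?\<psi> \<in> L2 \<Omega>"
  proof -
    have "(\<lambda>x. (\<bar>T 0\<bar> + \<bar>?v x\<bar>) + \<bar>g x\<bar>) \<in> L2 \<Omega>"
    proof (intro L2_add L2_const)
      show "(\<lambda>x. \<bar>?v x\<bar>) \<in> L2 \<Omega>"
        by (rule L2_dominated[OF L2_add[OF gL2 test_function_L2[OF \<phi>]]]) auto
      show "(\<lambda>x. \<bar>g x\<bar>) \<in> L2 \<Omega>" by (rule L2_dominated[OF gL2]) auto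
    qed
    then show ?thesis
    proof (rule L2_dominated)
      have "\<bar>T t\<bar> \<le> \<bar>T 0\<bar> + \<bar>t\<bar>" for t using T_Lip[of t 0] by simp
      then show "AE x in lebesgue_on \<Omega>. norm (?\<psi> x) \<le> norm ((\<bar>T 0\<bar> + \<bar>?v x\<bar>) + \<bar>g x\<bar>)"
        by (intro AE_I2) (smt (verit) real_norm_def)
    qed measurable
  qed
  have \<Psi>L2: "?\<Psi> \<in> L2 \<Omega>"
  proof (rule L2_diff[OF _ GL2])
    have *: "(\<lambda>x. ?G x + gradient \<phi> x) \<in> L2 \<Omega>"
      by (rule L2_add[OF GL2 gradient_test_function_L2[OF \<phi>]])
    show "(\<lambda>x. T' (?v x) *\<^sub>R (?G x + gradient \<phi> x)) \<in> L2 \<Omega>"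
    proof (rule L2_dominated[OF *])
      have [measurable]: "(\<lambda>x. ?G x + gradient \<phi> x) \<in> borel_measurable (lebesgue_on \<Omega>)"
        by (rule L2_measurable[OF *])
      show "(\<lambda>x. T' (?v x) *\<^sub>R (?G x + gradient \<phi> x)) \<in> borel_measurable (lebesgue_on \<Omega>)" by measurable
      show "AE x in lebesgue_on \<Omega>. norm (T' (?v x) *\<^sub>R (?G x + gradient \<phi> x)) \<le> norm (?G x + gradient \<phi> x)"
        using T'_nonneg T'_le by (intro AE_I2) (simp add: mult_left_le_one_le)
    qed
  qed
  have one_L2: "(\<lambda>x. 1 :: real) \<in> L2 \<Omega>" by simp
  have \<eta>\<psi>: "\<eta> x * ?\<psi> x = ?\<psi> x" if "x \<in> \<Omega>" for x
    using outK[OF that] \<eta>_1[of x] by (cases "x \<in> K") auto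
  have lim0: "(\<lambda>k. L2norm \<Omega> (\<lambda>x. \<psi>k k x - ?\<psi> x)) \<longlonglongrightarrow> 0"
  proof (rule L2_tendsto_uniform[OF test_function_L2[OF \<psi>k_test] \<psi>L2])
    fix \<epsilon> :: real assume \<epsilon>: "\<epsilon> > 0"
    have "\<forall>\<^sub>F k in sequentially. \<forall>x\<in>\<Omega>. \<bar>\<psi>k k x - \<eta> x * ?\<psi> x\<bar> \<le> \<epsilon>"
    proof (rule unif'[OF \<epsilon>, of "2 * C\<eta>"])
      show "\<bar>\<psi>k k x - \<eta> x * ?\<psi> x\<bar> \<le> 2 * C\<eta> * \<bar>gk k x - g x\<bar>" for k x
      proof -
        have "\<bar>\<psi>k k x - \<eta> x * ?\<psi> x\<bar> = \<bar>\<eta> x\<bar> * \<bar>(T (gk k x + \<phi> x) - gk k x) - ?\<psi> x\<bar>"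
          unfolding \<psi>k_def by (simp add: right_diff_distrib[symmetric] abs_mult)
        also have "\<dots> \<le> C\<eta> * (2 * \<bar>gk k x - g x\<bar>)" using T_close[of k x] C\<eta> by (intro mult_mono) auto
        finally show ?thesis by simp
      qed
    qed (use C\<eta> \<eta>S in \<open>auto simp: \<psi>k_def\<close>)
    then show "\<forall>\<^sub>F k in sequentially. \<forall>x\<in>\<Omega>. \<bar>\<psi>k k x - ?\<psi> x\<bar> \<le> \<epsilon>"
      by eventually_elim (simp add: \<eta>\<psi>)
  qed
  have lim1: "(\<lambda>k. L2norm \<Omega> (\<lambda>x. gradient (\<psi>k (k + N)) x \<bullet> i - ?\<Psi> x \<bullet> i)) \<longlonglongrightarrow> 0" if i: "i \<in> Basis" for i
  proof -
    let ?d\<eta> = "partial_deriv i \<eta>" and ?d\<phi> = "partial_deriv i \<phi>"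
    obtain Cd where Cd: "Cd \<ge> 0" "\<And>x. \<bar>?d\<eta> x\<bar> \<le> Cd"
      using test_functions_bounded[OF test_functions_partial_deriv[OF \<eta> i]] by metis
    have d\<phi>L2: "?d\<phi> \<in> L2 \<Omega>" by (rule test_function_L2[OF test_functions_partial_deriv[OF \<phi> i]])
    have d\<eta>_meas[measurable]: "?d\<eta> \<in> borel_measurable (lebesgue_on \<Omega>)"
      by (rule L2_measurable[OF test_function_L2[OF test_functions_partial_deriv[OF \<eta> i]]])
    let ?a = "\<lambda>k x. ?d\<eta> x * (T (gk k x + \<phi> x) - gk k x)"
    have GiL2: "(\<lambda>x. ?G x \<bullet> i) \<in> L2 \<Omega>" by (rule L2_component[OF GL2 i])
    have aL2: "?a k \<in> L2 \<Omega>" for k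
      by (rule test_function_L2, rule test_functions_mult[OF test_functions_partial_deriv[OF \<eta> i]])
        (intro smooth_diff smooth_compose[OF T] smooth_add gk_smooth test_functions_smooth[OF \<phi>])
    have a_lim: "(\<lambda>k. L2norm \<Omega> (\<lambda>x. ?a k x - 0)) \<longlonglongrightarrow> 0"
    proof (rule L2_tendsto_uniform[OF aL2 L2_const])
      fix \<epsilon> :: real assume \<epsilon>: "\<epsilon> > 0"
      have ev: "\<forall>\<^sub>F k in sequentially. \<forall>x\<in>\<Omega>. \<bar>?a k x - ?d\<eta> x * ?\<psi> x\<bar> \<le> \<epsilon>"
      proof (rule unif'[OF \<epsilon>, of "2 * Cd"])
        show "\<bar>?a k x - ?d\<eta> x * ?\<psi> x\<bar> \<le> 2 * Cd * \<bar>gk k x - g x\<bar>" for k x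
        proof -
          have "\<bar>?a k x - ?d\<eta> x * ?\<psi> x\<bar> = \<bar>?d\<eta> x\<bar> * \<bar>(T (gk k x + \<phi> x) - gk k x) - ?\<psi> x\<bar>"
            by (simp add: right_diff_distrib[symmetric] abs_mult)
          also have "\<dots> \<le> Cd * (2 * \<bar>gk k x - g x\<bar>)" using T_close[of k x] Cd by (intro mult_mono) auto
          finally show ?thesis by simp
        qed
      qed (use Cd d\<eta>S in auto)
      have zero: "?d\<eta> x * ?\<psi> x = 0" if "x \<in> \<Omega>" for x
        using outK[OF that] d\<eta>_0[of x] by (cases "x \<in> K") auto
      from ev show "\<forall>\<^sub>F k in sequentially. \<forall>x\<in>\<Omega>. \<bar>?a k x - 0\<bar> \<le> \<epsilon>"
      proof eventually_elim
        case (elim k)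
        show ?case
        proof
          fix x assume x: "x \<in> \<Omega>"
          show "\<bar>?a k x - 0\<bar> \<le> \<epsilon>" using bspec[OF elim x] unfolding zero[OF x] .
        qed
      qed
    qed
    let ?b = "\<lambda>k x. \<eta> x * T' (gk k x + \<phi> x)" and ?h = "\<lambda>k x. Gk i k x + ?d\<phi> x"
    have b_le: "\<bar>\<eta> x * T' t\<bar> \<le> C\<eta>" for x t
      using mult_mono[OF C\<eta>(2)[of x] T'_le[of t]] T'_nonneg[of t] C\<eta>(1) by (simp add: abs_mult)
    have hL2: "?h k \<in> L2 \<Omega>" for k by (rule L2_add[OF GkL2[OF i] d\<phi>L2])
    have h0L2: "(\<lambda>x. ?G x \<bullet> i + ?d\<phi> x) \<in> L2 \<Omega>" by (rule L2_add[OF GiL2 d\<phi>L2])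
    have b_lim: "(\<lambda>k. L2norm \<Omega> (\<lambda>x. ?b k x * ?h k x - ?b1 x * (?G x \<bullet> i + ?d\<phi> x))) \<longlonglongrightarrow> 0"
    proof (rule L2_tendsto_mult[where C = C\<eta>])
      show "\<forall>\<^sub>F k in sequentially. \<forall>x\<in>\<Omega>. \<bar>?b k x - ?b1 x\<bar> \<le> \<epsilon>" if "\<epsilon> > 0" for \<epsilon>
        by (rule unif'[OF that, of "C\<eta> * L"]) (use C\<eta> L b1_close \<eta>S in auto)
      show "(\<lambda>k. L2norm \<Omega> (\<lambda>x. ?h k x - (?G x \<bullet> i + ?d\<phi> x))) \<longlonglongrightarrow> 0"
        using Gk_lim[OF i] by simp
    qed (use b_le C\<eta> hL2 h0L2 in auto)
    have c_lim: "(\<lambda>k. L2norm \<Omega> (\<lambda>x. (- \<eta> x) * Gk i k x - (- \<eta> x) * (?G x \<bullet> i))) \<longlonglongrightarrow> 0"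
      by (rule L2_tendsto_mult[where C = C\<eta>]) (use C\<eta> GkL2[OF i] GiL2 Gk_lim[OF i] in auto)
    have multL2: "(\<lambda>x. c x * q x) \<in> L2 \<Omega>"
      if "c \<in> borel_measurable (lebesgue_on \<Omega>)" "\<And>x. \<bar>c x\<bar> \<le> C\<eta>" "q \<in> L2 \<Omega>" for c q :: "'a \<Rightarrow> real"
    proof (rule L2_dominated[OF L2_mult_const[OF that(3), of C\<eta>]])
      show "(\<lambda>x. c x * q x) \<in> borel_measurable (lebesgue_on \<Omega>)" using that(1) L2_measurable[OF that(3)] by simp
      show "AE x in lebesgue_on \<Omega>. norm (c x * q x) \<le> norm (C\<eta> * q x)"
        using that(2) C\<eta>(1) by (intro AE_I2) (simp add: abs_mult mult_right_mono)
    qed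
    have bhL2: "(\<lambda>x. ?b k x * ?h k x) \<in> L2 \<Omega>" for k by (rule multL2) (use b_le hL2 in auto)
    have b1L2: "(\<lambda>x. ?b1 x * (?G x \<bullet> i + ?d\<phi> x)) \<in> L2 \<Omega>" by (rule multL2) (use b_le h0L2 in auto)
    have cL2: "(\<lambda>x. (- \<eta> x) * Gk i k x) \<in> L2 \<Omega>" for k by (rule multL2) (use C\<eta> GkL2[OF i] in auto)
    have c1L2: "(\<lambda>x. (- \<eta> x) * (?G x \<bullet> i)) \<in> L2 \<Omega>" by (rule multL2) (use C\<eta> GiL2 in auto)
    note bc = L2_tendsto_add[OF bhL2 b1L2 cL2 c1L2 b_lim c_lim]
    note abc = L2_tendsto_add[OF aL2 L2_const L2_add[OF bhL2 cL2] L2_add[OF b1L2 c1L2] a_lim bc]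
    have eq: "L2norm \<Omega> (\<lambda>x. (?a (k + N) x + (?b (k + N) x * ?h (k + N) x + (- \<eta> x) * Gk i (k + N) x))
          - (0 + (?b1 x * (?G x \<bullet> i + ?d\<phi> x) + (- \<eta> x) * (?G x \<bullet> i))))
        = L2norm \<Omega> (\<lambda>x. gradient (\<psi>k (k + N)) x \<bullet> i - ?\<Psi> x \<bullet> i)" for k
    proof (rule L2norm_cong)
      fix x assume x: "x \<in> \<Omega>"
      have "0 + (?b1 x * (?G x \<bullet> i + ?d\<phi> x) + (- \<eta> x) * (?G x \<bullet> i)) = ?\<Psi> x \<bullet> i"
      proof (cases "x \<in> K")
        case True
        then show ?thesis
          using \<eta>_1 i by (simp add: inner_diff_left inner_add_left gradient_inner_Basis)
      next
        case False
        then have "?d\<phi> x = 0" using outK[OF x] gradient_inner_Basis[OF i, of \<phi> x] by simp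
        then show ?thesis using outK[OF x False] by (simp add: inner_diff_left inner_add_left)
      qed
      moreover have "?a (k + N) x + (?b (k + N) x * ?h (k + N) x + (- \<eta> x) * Gk i (k + N) x) = gradient (\<psi>k (k + N)) x \<bullet> i"
        using d\<psi>k[OF i, of "k + N" x] by (simp add: gradient_inner_Basis[OF i])
      ultimately show "(?a (k + N) x + (?b (k + N) x * ?h (k + N) x + (- \<eta> x) * Gk i (k + N) x))
          - (0 + (?b1 x * (?G x \<bullet> i + ?d\<phi> x) + (- \<eta> x) * (?G x \<bullet> i)))
          = gradient (\<psi>k (k + N)) x \<bullet> i - ?\<Psi> x \<bullet> i" by (simp only:)
    qed
    show ?thesis using LIMSEQ_ignore_initial_segment[OF abc, of N] unfolding eq .
  qed
  have "(\<lambda>k. L2norm \<Omega> (\<lambda>x. gradient (\<psi>k (k + N)) x - ?\<Psi> x)) \<longlonglongrightarrow> 0"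
    by (rule L2_tendsto_components[OF gradient_test_function_L2[OF \<psi>k_test] \<Psi>L2 lim1])
  from H10I[OF \<psi>k_test \<psi>L2 \<Psi>L2 LIMSEQ_ignore_initial_segment[OF lim0, of N] this]
  show "?\<psi> \<in> H10 \<Omega>" "is_weak_grad \<Omega> ?\<psi> ?\<Psi>" by auto
qed

end

text \<open>
  The left-hand side comes from the second derivative \<open>1/t \<ge> 1/c\<close> of \<open>t ln t\<close> on \<open>(0, c]\<close>. All convexity
  properties of the functional are consequences of this inequality.
\<close>

section \<open>The relative entropy\<close>

lemma entropy_strong_convexity:
  fixes s t c :: real
  assumes t: "0 \<le> t" "t \<le> c" and s: "0 < s" "s \<le> c"
  shows "(t - s)\<^sup>2 / (2 * c) \<le> t * ln (t / s) - t + s"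
proof (cases "t = 0")
  case True
  have "s * s \<le> s * (2 * c)" using s by (intro mult_left_mono) auto
  then show ?thesis using True s by (simp add: divide_le_eq power2_eq_square)
next
  case False
  then have t0: "t > 0" using t by simp
  have c: "c > 0" using s by simp
  let ?p = "\<lambda>t. t * ln (t / s) - t + s - (t - s)\<^sup>2 / (2 * c)"
  have d: "(?p has_real_derivative ln (x / s) - (x - s) / c) (at x)" if "x > 0" for x
    using that s c by (auto intro!: derivative_eq_intros simp: field_simps)
  have "?p s \<le> ?p t"
  proof (cases "s \<le> t")
    case True
    then show ?thesis
    proof (rule DERIV_nonneg_imp_nondecreasing)
      fix x assume x: "s \<le> x" "x \<le> t"
      then have x0: "x > 0" using s by simp
      have "(x - s) / c \<le> (x - s) / x" using x x0 t c by (intro divide_left_mono) auto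
      also have "\<dots> = 1 - s / x" using x0 by (simp add: diff_divide_distrib)
      also have "\<dots> \<le> ln (x / s)"
        using ln_le_minus_one[of "s / x"] x0 s by (simp add: ln_div)
      finally show "\<exists>y. (?p has_real_derivative y) (at x) \<and> 0 \<le> y"
        using d[OF x0] by (intro exI[of _ "ln (x / s) - (x - s) / c"]) auto
    qed
  next
    case False
    then have "t \<le> s" by simp
    then show ?thesis
    proof (rule DERIV_nonpos_imp_nonincreasing)
      fix x assume x: "t \<le> x" "x \<le> s"
      then have x0: "x > 0" using t0 by simp
      have "ln (x / s) \<le> x / s - 1" using x0 s by (intro ln_le_minus_one) auto
      also have "\<dots> = - ((s - x) / s)" using s by (simp add: field_simps)
      also have "\<dots> \<le> - ((s - x) / c)" using x s c by (intro le_imp_neg_le divide_left_mono) auto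
      also have "\<dots> = (x - s) / c" by (simp add: minus_divide_left)
      finally show "\<exists>y. (?p has_real_derivative y) (at x) \<and> y \<le> 0"
        using d[OF x0] by (intro exI[of _ "ln (x / s) - (x - s) / c"]) auto
    qed
  qed
  then show ?thesis using s by simp
qed

definition relative_entropy :: "real \<Rightarrow> real \<Rightarrow> real" where
  "relative_entropy w t = t * ln (t / w) - t + w"

lemma relative_entropy_nonneg: "0 < w \<Longrightarrow> 0 \<le> t \<Longrightarrow> 0 \<le> relative_entropy w t"
  using entropy_strong_convexity[of t "max t w" w] unfolding relative_entropy_def
  by (auto intro: order_trans[rotated])

text \<open>
  The Bregman identity: the relative entropy minus its tangent at \<open>s\<close> is the relative entropy with
  respect to \<open>s\<close>.
\<close>

lemma relative_entropy_expand:
  assumes "0 < w" "0 \<le> t" "0 < s"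
  shows "relative_entropy w t = relative_entropy w s + ln (s / w) * (t - s) + (t * ln (t / s) - t + s)"
proof (cases "t = 0")
  case False
  then show ?thesis using assms by (simp add: relative_entropy_def ln_div algebra_simps)
qed (use assms in \<open>simp add: relative_entropy_def\<close>)

text \<open>
  Convexity in the form used for the maximum principle.
\<close>

lemma relative_entropy_tangent:
  assumes "0 < w" "0 \<le> t" "0 < s"
  shows "relative_entropy w s + ln (s / w) * (t - s) \<le> relative_entropy w t"
  using relative_entropy_expand[OF assms] relative_entropy_nonneg[of s t] assms
  by (simp add: relative_entropy_def)

text \<open>
  The second-order bound for the first variation, by \<open>ln y \<le> y - 1\<close>.
\<close>

lemma relative_entropy_quadratic_upper:
  assumes "0 < w" "0 < s" "0 < s + r"
  shows "relative_entropy w (s + r) \<le> relative_entropy w s + ln (s / w) * r + r\<^sup>2 / s"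
proof -
  have "(s + r) * ln ((s + r) / s) \<le> (s + r) * ((s + r) / s - 1)"
    using assms by (intro mult_left_mono ln_le_minus_one) auto
  also have "\<dots> = r + r\<^sup>2 / s" using assms by (simp add: field_simps power2_eq_square)
  finally show ?thesis using relative_entropy_expand[of w "s + r" s] assms by simp
qed

text \<open>
  Expand both ends around the midpoint; the linear terms cancel.
\<close>

lemma relative_entropy_midpoint:
  assumes w: "0 < w" and s: "0 \<le> s" "s \<le> c" and t: "0 \<le> t" "t \<le> c" and c: "0 < c"
  shows "relative_entropy w ((s + t) / 2) \<le> (relative_entropy w s + relative_entropy w t) / 2 - (s - t)\<^sup>2 / (8 * c)"
proof (cases "s + t = 0")
  case True
  then have "s = 0" "t = 0" using s t by auto
  then show ?thesis by simp
next
  case False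
  define m where "m = (s + t) / 2"
  have m: "0 < m" "m \<le> c" using False s t by (auto simp: m_def)
  have sq: "(s - m)\<^sup>2 / (2 * c) = (s - t)\<^sup>2 / (8 * c)" "(t - m)\<^sup>2 / (2 * c) = (s - t)\<^sup>2 / (8 * c)"
    using c by (auto simp: m_def field_simps power2_eq_square)
  have "(s - t)\<^sup>2 / (8 * c) \<le> s * ln (s / m) - s + m" "(s - t)\<^sup>2 / (8 * c) \<le> t * ln (t / m) - t + m"
    using entropy_strong_convexity[OF s m] entropy_strong_convexity[OF t m] unfolding sq by auto
  then have "2 * ((s - t)\<^sup>2 / (8 * c)) \<le> relative_entropy w s + relative_entropy w t - 2 * relative_entropy w m
      - ln (m / w) * ((s - m) + (t - m))"
    using relative_entropy_expand[OF w s(1) m(1)] relative_entropy_expand[OF w t(1) m(1)]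
    by (simp only: distrib_left)
  also have "(s - m) + (t - m) = 0" by (simp add: m_def)
  finally show ?thesis by (simp add: m_def field_simps)
qed

lemma relative_entropy_upper: "0 < w \<Longrightarrow> 0 \<le> t \<Longrightarrow> relative_entropy w t \<le> t\<^sup>2 / w + w"
proof (cases "t = 0")
  case False
  assume w: "0 < w" and t: "0 \<le> t"
  have "t * ln (t / w) \<le> t * (t / w - 1)"
    using False w t by (intro mult_left_mono ln_le_minus_one) auto
  then show ?thesis using t by (simp add: relative_entropy_def power2_eq_square algebra_simps)
qed (simp add: relative_entropy_def)

lemma relative_entropy_Lipschitz:
  assumes w: "0 < w" and s: "0 < s" and t: "0 < t"
    and \<Lambda>: "\<bar>ln (s / w)\<bar> \<le> \<Lambda>" "\<bar>ln (t / w)\<bar> \<le> \<Lambda>"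
  shows "\<bar>relative_entropy w s - relative_entropy w t\<bar> \<le> \<Lambda> * \<bar>s - t\<bar>"
proof -
  have 1: "relative_entropy w s - relative_entropy w t \<le> - (ln (s / w) * (t - s))"
    using relative_entropy_tangent[OF w _ s, of t] t by simp
  have 2: "relative_entropy w t - relative_entropy w s \<le> - (ln (t / w) * (s - t))"
    using relative_entropy_tangent[OF w _ t, of s] s by simp
  have "\<bar>ln (s / w) * (t - s)\<bar> \<le> \<Lambda> * \<bar>s - t\<bar>" "\<bar>ln (t / w) * (s - t)\<bar> \<le> \<Lambda> * \<bar>s - t\<bar>"
    unfolding abs_mult using \<Lambda> by (auto simp: abs_minus_commute intro: mult_right_mono)
  with 1 2 show ?thesis by linarith
qed

lemma relative_entropy_borel[measurable]:
  assumes [measurable]: "u \<in> borel_measurable M" "v \<in> borel_measurable M"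
  shows "(\<lambda>x. relative_entropy (v x) (u x)) \<in> borel_measurable M"
  unfolding relative_entropy_def by measurable

section \<open>Essential bounds and the affine space of competitors\<close>

context bounded_open
begin

lemma Linfty_bound:
  assumes "f \<in> Linfty \<Omega>"
  obtains C where "C > 0" "AE x in lebesgue_on \<Omega>. \<bar>f x\<bar> \<le> C"
proof -
  have "esssup (lebesgue_on \<Omega>) (\<lambda>x. ereal \<bar>f x\<bar>) \<noteq> \<infinity>" using assms by (simp add: Linfty_def)
  then obtain n :: nat where n: "esssup (lebesgue_on \<Omega>) (\<lambda>x. ereal \<bar>f x\<bar>) < ereal (real n)"
    using less_PInf_Ex_of_nat by blast
  have "AE x in lebesgue_on \<Omega>. ereal \<bar>f x\<bar> \<le> esssup (lebesgue_on \<Omega>) (\<lambda>x. ereal \<bar>f x\<bar>)"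
    by (rule esssup_AE)
  then have "AE x in lebesgue_on \<Omega>. \<bar>f x\<bar> \<le> real n + 1"
  proof eventually_elim
    case (elim x)
    then have "ereal \<bar>f x\<bar> < ereal (real n)" using n by (rule le_less_trans)
    then show ?case by simp
  qed
  then show ?thesis by (intro that[of "real n + 1"]) auto
qed

lemma LinftyI:
  assumes f: "f \<in> borel_measurable (lebesgue_on \<Omega>)" and C: "AE x in lebesgue_on \<Omega>. \<bar>f x\<bar> \<le> C"
  shows "f \<in> Linfty \<Omega>"
proof -
  have "esssup (lebesgue_on \<Omega>) (\<lambda>x. ereal \<bar>f x\<bar>) \<le> ereal C"
    by (rule esssup_I) (use f C in auto)
  then show ?thesis using f le_less_trans[of _ "ereal C" \<infinity>] by (simp add: Linfty_def)
qed

lemma Linfty_measurable: "f \<in> Linfty \<Omega> \<Longrightarrow> f \<in> borel_measurable (lebesgue_on \<Omega>)"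
  by (simp add: Linfty_def)

lemma int_Linfty_plus_bounds:
  assumes w: "w \<in> int_Linfty_plus \<Omega>"
  obtains c C where "0 < c" "c \<le> C" "AE x in lebesgue_on \<Omega>. c \<le> w x \<and> w x \<le> C"
proof -
  let ?e = "esssup (lebesgue_on \<Omega>) (\<lambda>x. - ereal (w x))"
  have wL: "w \<in> Linfty \<Omega>" and "?e < 0"
    using w by (auto simp: int_Linfty_plus_def ess_inf_def ereal_less_uminus_reorder[of 0])
  then obtain r where r: "?e < ereal r" "ereal r < 0" using ereal_dense2 by blast
  have "AE x in lebesgue_on \<Omega>. - ereal (w x) \<le> ?e"
    by (rule esssup_AE)
  then have low: "AE x in lebesgue_on \<Omega>. - r \<le> w x"
  proof eventually_elim
    case (elim x)
    then have "- ereal (w x) < ereal r" using r(1) by (rule le_less_trans)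
    then show ?case by simp
  qed
  obtain C where C: "AE x in lebesgue_on \<Omega>. \<bar>w x\<bar> \<le> C" using Linfty_bound[OF wL] by blast
  have "AE x in lebesgue_on \<Omega>. - r \<le> w x \<and> w x \<le> max C (- r)"
    using low C by eventually_elim auto
  then show ?thesis using r(2) by (intro that[of "- r" "max C (- r)"]) auto
qed

lemma int_Linfty_plusI:
  assumes w: "w \<in> borel_measurable (lebesgue_on \<Omega>)" and c: "0 < c"
    and b: "AE x in lebesgue_on \<Omega>. c \<le> w x \<and> w x \<le> C"
  shows "w \<in> int_Linfty_plus \<Omega>"
proof -
  have "AE x in lebesgue_on \<Omega>. \<bar>w x\<bar> \<le> C" using b by eventually_elim (use c in auto)
  then have "w \<in> Linfty \<Omega>" by (rule LinftyI[OF w])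
  moreover have "esssup (lebesgue_on \<Omega>) (\<lambda>x. - ereal (w x)) \<le> ereal (- c)"
    by (rule esssup_I) (use w in measurable, use b in \<open>eventually_elim, auto\<close>)
  then have "ess_inf \<Omega> w > 0"
    unfolding ess_inf_def using c by (simp add: ereal_less_uminus_reorder[of 0] le_less_trans[of _ "ereal (- c)" 0])
  ultimately show ?thesis by (simp add: int_Linfty_plus_def)
qed

lemma H1g_H1: "g \<in> H1 \<Omega> \<Longrightarrow> v \<in> H1g \<Omega> g \<Longrightarrow> v \<in> H1 \<Omega>"
  using is_weak_grad_add[OF H1_L2 H1_L2 is_weak_grad_weak_grad is_weak_grad_weak_grad] L2_add[OF H1_L2 H1_L2]
  by (auto simp: H1g_def intro!: H1I dest!: H10_H1)

lemma H1g_add_H10: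
  assumes "v \<in> H1g \<Omega> g" "z \<in> H10 \<Omega>"
  shows "(\<lambda>x. v x + c * z x) \<in> H1g \<Omega> g"
proof -
  obtain y where y: "y \<in> H10 \<Omega>" "v = (\<lambda>x. g x + y x)" using assms(1) by (auto simp: H1g_def)
  have "(\<lambda>x. y x + c * z x) \<in> H10 \<Omega>" by (rule H10_add_scale[OF y(1) assms(2)])
  then show ?thesis unfolding H1g_def y(2) by (auto intro!: exI[of _ "\<lambda>x. y x + c * z x"])
qed

lemma H1g_diff_H10:
  assumes "u \<in> H1g \<Omega> g" "v \<in> H1g \<Omega> g"
  shows "(\<lambda>x. u x - v x) \<in> H10 \<Omega>"
  using assms H10_diff by (auto simp: H1g_def)

lemma H1g_midpoint:
  assumes u: "u \<in> H1g \<Omega> g" and v: "v \<in> H1g \<Omega> g"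
  shows "(\<lambda>x. (u x + v x) / 2) \<in> H1g \<Omega> g"
proof -
  have "(\<lambda>x. u x + 1 / 2 * (v x - u x)) \<in> H1g \<Omega> g"
    by (rule H1g_add_H10[OF u H1g_diff_H10[OF v u]])
  moreover have "(\<lambda>x. u x + 1 / 2 * (v x - u x)) = (\<lambda>x. (u x + v x) / 2)" by (auto simp: field_simps)
  ultimately show ?thesis by simp
qed

end

text \<open>
  The essential bounds of the data are kept as parameters: \<open>Fb\<close> for \<open>f\<close>, and \<open>wl\<close>, \<open>wu\<close> for \<open>w\<close>.
\<close>

section \<open>Convexity of the functional and uniqueness\<close>

locale entropic_problem = bounded_open \<Omega>
  for \<Omega> :: "'a::euclidean_space set" +
  fixes f g w :: "'a \<Rightarrow> real" and \<alpha> Fb wl wu :: real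
  assumes g_H1: "g \<in> H1 \<Omega>"
    and f_meas[measurable]: "f \<in> borel_measurable (lebesgue_on \<Omega>)"
    and f_bound: "AE x in lebesgue_on \<Omega>. \<bar>f x\<bar> \<le> Fb" and Fb: "Fb > 0"
    and \<alpha>: "\<alpha> > 0"
    and w_meas[measurable]: "w \<in> borel_measurable (lebesgue_on \<Omega>)"
    and w_bound: "AE x in lebesgue_on \<Omega>. wl \<le> w x \<and> w x \<le> wu" and wl: "0 < wl" "wl \<le> wu"
begin

text \<open>
  The functional is the Dirichlet integral plus the integral of this density, for nonnegative functions.
\<close>

definition energy_density :: "'a \<Rightarrow> real \<Rightarrow> real" where
  "energy_density x t = inverse \<alpha> * relative_entropy (w x) t - f x * t"

definition J :: "('a \<Rightarrow> real) \<Rightarrow> real" where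
  "J v = dirichlet_energy \<Omega> f v + inverse \<alpha> * entropy_divergence \<Omega> v w"

lemma energy_density_borel[measurable]:
  assumes [measurable]: "v \<in> borel_measurable (lebesgue_on \<Omega>)"
  shows "(\<lambda>x. energy_density x (v x)) \<in> borel_measurable (lebesgue_on \<Omega>)"
  unfolding energy_density_def by measurable

lemma f_L2: "f \<in> L2 \<Omega>"
  by (rule L2_bounded[of _ Fb]) (use f_bound in auto)

lemma relative_entropy_integrable:
  assumes v: "v \<in> L2 \<Omega>" and pos: "AE x in lebesgue_on \<Omega>. 0 \<le> v x"
  shows "integrable (lebesgue_on \<Omega>) (\<lambda>x. relative_entropy (w x) (v x))"
proof (rule Bochner_Integration.integrable_bound)
  show "integrable (lebesgue_on \<Omega>) (\<lambda>x. (norm (v x))\<^sup>2 / wl + wu)"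
    using L2_square_integrable[OF v] by simp
  show "(\<lambda>x. relative_entropy (w x) (v x)) \<in> borel_measurable (lebesgue_on \<Omega>)"
    using L2_measurable[OF v] by measurable
  show "AE x in lebesgue_on \<Omega>. norm (relative_entropy (w x) (v x)) \<le> norm ((norm (v x))\<^sup>2 / wl + wu)"
    using pos w_bound
  proof eventually_elim
    case (elim x)
    then have wx: "0 < w x" using wl by auto
    have "relative_entropy (w x) (v x) \<le> (v x)\<^sup>2 / w x + w x" by (rule relative_entropy_upper[OF wx elim(1)])
    also have "\<dots> \<le> (v x)\<^sup>2 / wl + wu" using elim wl wx by (intro add_mono divide_left_mono) auto
    finally show ?case using relative_entropy_nonneg[OF wx elim(1)] by simp
  qed
qed

lemma energy_density_integrable:
  assumes v: "v \<in> L2 \<Omega>" and pos: "AE x in lebesgue_on \<Omega>. 0 \<le> v x"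
  shows "integrable (lebesgue_on \<Omega>) (\<lambda>x. energy_density x (v x))"
  unfolding energy_density_def
  using relative_entropy_integrable[OF v pos] L2_mult_integrable[OF f_L2 v] by simp

text \<open>
  Nonnegativity makes the entropy integrand integrable, by the bounds \<open>0\<close> and \<open>t\<^sup>2 / w + w\<close>; so the
  integrals may be split and recombined.
\<close>

lemma J_eq:
  assumes v: "v \<in> L2 \<Omega>" and G: "is_weak_grad \<Omega> v G" and pos: "AE x in lebesgue_on \<Omega>. 0 \<le> v x"
  shows "J v = (L2norm \<Omega> G)\<^sup>2 / 2 + (\<integral>x. energy_density x (v x) \<partial>lebesgue_on \<Omega>)"
proof -
  have "(\<integral>x. energy_density x (v x) \<partial>lebesgue_on \<Omega>)
      = inverse \<alpha> * (\<integral>x. relative_entropy (w x) (v x) \<partial>lebesgue_on \<Omega>) - (\<integral>x. f x * v x \<partial>lebesgue_on \<Omega>)"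
    unfolding energy_density_def
    using relative_entropy_integrable[OF v pos] L2_mult_integrable[OF f_L2 v] by simp
  moreover have "(\<integral>x. relative_entropy (w x) (v x) \<partial>lebesgue_on \<Omega>) = entropy_divergence \<Omega> v w"
    by (simp add: entropy_divergence_def relative_entropy_def)
  moreover have "dirichlet_energy \<Omega> f v = (L2norm \<Omega> G)\<^sup>2 / 2 - (\<integral>x. f x * v x \<partial>lebesgue_on \<Omega>)"
    using L2norm_square[of "weak_grad \<Omega> v"] L2norm_weak_grad[OF v G] by (simp add: dirichlet_energy_def)
  ultimately show ?thesis by (simp add: J_def)
qed

lemma energy_density_midpoint:
  assumes "0 < w x" "0 \<le> s" "s \<le> c" "0 \<le> t" "t \<le> c" "0 < c"
  shows "energy_density x ((s + t) / 2) \<le> (energy_density x s + energy_density x t) / 2 - inverse \<alpha> * ((s - t)\<^sup>2 / (8 * c))"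
proof -
  have "inverse \<alpha> * relative_entropy (w x) ((s + t) / 2)
      \<le> inverse \<alpha> * ((relative_entropy (w x) s + relative_entropy (w x) t) / 2 - (s - t)\<^sup>2 / (8 * c))"
    using relative_entropy_midpoint[OF assms] \<alpha> by (intro mult_left_mono) auto
  also have "\<dots> = (inverse \<alpha> * relative_entropy (w x) s + inverse \<alpha> * relative_entropy (w x) t) / 2
      - inverse \<alpha> * ((s - t)\<^sup>2 / (8 * c))"
    by (simp only: right_diff_distrib distrib_left times_divide_eq_right)
  finally have 1: "inverse \<alpha> * relative_entropy (w x) ((s + t) / 2) \<le> \<dots>" .
  have "f x * ((s + t) / 2) = (f x * s + f x * t) / 2" by (simp add: distrib_left)
  with 1 show ?thesis unfolding energy_density_def by argo
qed

text \<open>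
  The parallelogram identity for weak gradients.
\<close>

lemma midpoint_gradient:
  assumes u: "u \<in> L2 \<Omega>" and v: "v \<in> L2 \<Omega>" and G: "is_weak_grad \<Omega> u G" and H: "is_weak_grad \<Omega> v H"
  shows "\<exists>M. is_weak_grad \<Omega> (\<lambda>x. (u x + v x) / 2) M \<and>
    (L2norm \<Omega> M)\<^sup>2 / 2 = ((L2norm \<Omega> G)\<^sup>2 / 2 + (L2norm \<Omega> H)\<^sup>2 / 2) / 2 - (L2norm \<Omega> (\<lambda>x. G x - H x))\<^sup>2 / 8"
proof -
  let ?M = "\<lambda>x. G x + (1 / 2) *\<^sub>R (H x - G x)"
  note GL = is_weak_grad_L2[OF G] and HL = is_weak_grad_L2[OF H]
  note D = L2_diff[OF HL GL]
  have "(\<lambda>x. u x + 1 / 2 * (v x - u x)) = (\<lambda>x. (u x + v x) / 2)" by (auto simp: field_simps)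
  then have wg: "is_weak_grad \<Omega> (\<lambda>x. (u x + v x) / 2) ?M"
    using is_weak_grad_add_scale[OF u L2_diff[OF v u] G is_weak_grad_diff[OF v u H G], of "1 / 2"] by simp
  have 1: "(L2norm \<Omega> ?M)\<^sup>2 = (L2norm \<Omega> G)\<^sup>2 + L2_inner \<Omega> G (\<lambda>x. H x - G x) + (L2norm \<Omega> (\<lambda>x. H x - G x))\<^sup>2 / 4"
    using L2norm_add_scaleR_square[OF GL D, of "1 / 2"] by (simp add: power2_eq_square)
  have "(\<lambda>x. G x + 1 *\<^sub>R (H x - G x)) = H" by auto
  then have 2: "(L2norm \<Omega> H)\<^sup>2 = (L2norm \<Omega> G)\<^sup>2 + 2 * L2_inner \<Omega> G (\<lambda>x. H x - G x) + (L2norm \<Omega> (\<lambda>x. H x - G x))\<^sup>2"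
    using L2norm_add_scaleR_square[OF GL D, of 1] by simp
  show ?thesis
    using wg 1 2 by (intro exI[of _ ?M]) (simp add: L2norm_minus_commute[of G])
qed

text \<open>
  At the midpoint of two minimizers the convexity defect of the density is nonnegative with integral at
  most zero, so it vanishes almost everywhere. The defect is at least a positive multiple of
  \<open>(u x - v x)\<^sup>2\<close>, where the factor depends on \<open>x\<close> since the minimizers may be unbounded.
\<close>

lemma minimizer_unique:
  assumes u: "u \<in> obstacle_set \<Omega> g" and v: "v \<in> obstacle_set \<Omega> g"
    and umin: "\<And>z. z \<in> obstacle_set \<Omega> g \<Longrightarrow> J u \<le> J z" and vmin: "\<And>z. z \<in> obstacle_set \<Omega> g \<Longrightarrow> J v \<le> J z"
  shows "AE x in lebesgue_on \<Omega>. v x = u x"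
proof -
  let ?m = "\<lambda>x. (u x + v x) / 2"
  have uH: "u \<in> H1g \<Omega> g" and vH: "v \<in> H1g \<Omega> g"
    and u0: "AE x in lebesgue_on \<Omega>. 0 \<le> u x" and v0: "AE x in lebesgue_on \<Omega>. 0 \<le> v x"
    using u v by (auto simp: obstacle_set_def)
  have m0: "AE x in lebesgue_on \<Omega>. 0 \<le> ?m x" using u0 v0 by eventually_elim simp
  have m: "?m \<in> obstacle_set \<Omega> g" using H1g_midpoint[OF uH vH] m0 by (simp add: obstacle_set_def)
  have uH1: "u \<in> H1 \<Omega>" and vH1: "v \<in> H1 \<Omega>" using H1g_H1[OF g_H1] uH vH by auto
  have mL2: "?m \<in> L2 \<Omega>" using H1_L2[OF H1g_H1[OF g_H1 H1g_midpoint[OF uH vH]]] .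
  note uG = is_weak_grad_weak_grad[OF uH1] and vG = is_weak_grad_weak_grad[OF vH1]
  obtain M where M: "is_weak_grad \<Omega> ?m M"
    "(L2norm \<Omega> M)\<^sup>2 / 2 = ((L2norm \<Omega> (weak_grad \<Omega> u))\<^sup>2 / 2 + (L2norm \<Omega> (weak_grad \<Omega> v))\<^sup>2 / 2) / 2
      - (L2norm \<Omega> (\<lambda>x. weak_grad \<Omega> u x - weak_grad \<Omega> v x))\<^sup>2 / 8"
    using midpoint_gradient[OF H1_L2[OF uH1] H1_L2[OF vH1] uG vG] by blast
  let ?d = "\<lambda>x. (energy_density x (u x) + energy_density x (v x)) / 2 - energy_density x (?m x)"
  note ints = energy_density_integrable[OF H1_L2[OF uH1] u0] energy_density_integrable[OF H1_L2[OF vH1] v0] energy_density_integrable[OF mL2 m0]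
  have d_int: "integrable (lebesgue_on \<Omega>) ?d"
    using ints by (intro Bochner_Integration.integrable_diff integrable_divide Bochner_Integration.integrable_add)
  have d_eq: "(\<integral>x. ?d x \<partial>lebesgue_on \<Omega>) = ((\<integral>x. energy_density x (u x) \<partial>lebesgue_on \<Omega>) + (\<integral>x. energy_density x (v x) \<partial>lebesgue_on \<Omega>)) / 2
      - (\<integral>x. energy_density x (?m x) \<partial>lebesgue_on \<Omega>)"
    using ints by simp
  have low: "AE x in lebesgue_on \<Omega>. inverse \<alpha> * ((u x - v x)\<^sup>2 / (8 * (max (u x) (v x) + 1))) \<le> ?d x"
    using u0 v0 w_bound
  proof eventually_elim
    case (elim x)
    have "0 < w x" "u x \<le> max (u x) (v x) + 1" "v x \<le> max (u x) (v x) + 1" "0 < max (u x) (v x) + 1"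
      using elim wl by auto
    from energy_density_midpoint[OF this(1) elim(1) this(2) elim(2) this(3,4)] show ?case by linarith
  qed
  have d_nonneg: "AE x in lebesgue_on \<Omega>. 0 \<le> ?d x"
    using low u0 v0
  proof eventually_elim
    case (elim x)
    have "0 \<le> inverse \<alpha> * ((u x - v x)\<^sup>2 / (8 * (max (u x) (v x) + 1)))" using elim \<alpha> by simp
    with elim(1) show ?case by linarith
  qed
  have "J u \<le> J ?m" "J v \<le> J ?m" using umin[OF m] vmin[OF m] by auto
  moreover have "(Iu + Iv) / 2 - Im \<le> 0"
    if "A + Iu \<le> (A + B) / 2 - (N :: real)\<^sup>2 / 8 + Im" "B + Iv \<le> (A + B) / 2 - N\<^sup>2 / 8 + Im" for A B N Iu Iv Im
    using that zero_le_power2[of N] by argo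
  ultimately have "(\<integral>x. ?d x \<partial>lebesgue_on \<Omega>) \<le> 0"
    unfolding d_eq J_eq[OF H1_L2[OF uH1] uG u0] J_eq[OF H1_L2[OF vH1] vG v0] J_eq[OF mL2 M(1) m0] M(2)
    by blast
  moreover have "0 \<le> (\<integral>x. ?d x \<partial>lebesgue_on \<Omega>)" by (rule integral_nonneg_AE[OF d_nonneg])
  ultimately have "AE x in lebesgue_on \<Omega>. ?d x = 0"
    using integral_nonneg_eq_0_iff_AE[OF d_int d_nonneg] by simp
  then show ?thesis
    using low u0 v0
  proof eventually_elim
    case (elim x)
    have p: "max (u x) (v x) + 1 > 0" using elim by linarith
    have "inverse \<alpha> * ((u x - v x)\<^sup>2 / (8 * (max (u x) (v x) + 1))) \<le> 0" using elim by simp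
    then have "(u x - v x)\<^sup>2 / (8 * (max (u x) (v x) + 1)) \<le> 0"
      using \<alpha> by (metis inverse_positive_iff_positive mult_pos_pos not_le)
    then have "(u x - v x)\<^sup>2 \<le> 0" using p by (simp add: divide_le_0_iff)
    then show ?case by simp
  qed
qed

text \<open>
  Test the difference of the two equations with \<open>v - u\<close>. Both terms are nonnegative, so the integral
  of \<open>(ln v - ln u) * (v - u)\<close> is zero.
\<close>

lemma weak_solution_unique:
  assumes u: "u \<in> H1g \<Omega> g \<inter> int_Linfty_plus \<Omega>" and v: "v \<in> H1g \<Omega> g \<inter> int_Linfty_plus \<Omega>"
    and uw: "entropic_poisson_weak \<Omega> \<alpha> f w u" and vw: "entropic_poisson_weak \<Omega> \<alpha> f w v"
  shows "AE x in lebesgue_on \<Omega>. v x = u x"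
proof -
  let ?d = "\<lambda>x. v x - u x"
  have d: "?d \<in> H10 \<Omega>" using H1g_diff_H10 u v by blast
  have uH1: "u \<in> H1 \<Omega>" and vH1: "v \<in> H1 \<Omega>" using H1g_H1[OF g_H1] u v by auto
  note L = H1_L2[OF uH1] H1_L2[OF vH1] and GL = H1_weak_grad_L2[OF uH1] H1_weak_grad_L2[OF vH1]
  note dL2 = L2_diff[OF L(2,1)]
  have ln_L2: "(\<lambda>x. ln (z x)) \<in> L2 \<Omega> \<and> (AE x in lebesgue_on \<Omega>. 0 < z x)" if z: "z \<in> int_Linfty_plus \<Omega>" for z
  proof -
    obtain c C where c: "0 < c" "c \<le> C" "AE x in lebesgue_on \<Omega>. c \<le> z x \<and> z x \<le> C"
      using int_Linfty_plus_bounds[OF z] by blast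
    have m: "z \<in> borel_measurable (lebesgue_on \<Omega>)" using z Linfty_measurable by (auto simp: int_Linfty_plus_def)
    have "AE x in lebesgue_on \<Omega>. norm (ln (z x)) \<le> \<bar>ln c\<bar> + \<bar>ln C\<bar>"
      using c(3)
    proof eventually_elim
      case (elim x)
      then have "ln c \<le> ln (z x)" "ln (z x) \<le> ln C" using c by auto
      then show ?case unfolding real_norm_def by linarith
    qed
    then have "(\<lambda>x. ln (z x)) \<in> L2 \<Omega>" using m by (intro L2_bounded) auto
    moreover have "AE x in lebesgue_on \<Omega>. 0 < z x" using c(3) by eventually_elim (use c in auto)
    ultimately show ?thesis by blast
  qed
  have lu: "(\<lambda>x. ln (u x)) \<in> L2 \<Omega>" "AE x in lebesgue_on \<Omega>. 0 < u x"
    and lv: "(\<lambda>x. ln (v x)) \<in> L2 \<Omega>" "AE x in lebesgue_on \<Omega>. 0 < v x"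
    using ln_L2 u v by auto
  note dG = H1_weak_grad_L2[OF H10_H1[OF d]]
  have "L2_inner \<Omega> (\<lambda>x. \<alpha> *\<^sub>R weak_grad \<Omega> v x) (weak_grad \<Omega> ?d) - L2_inner \<Omega> (\<lambda>x. \<alpha> *\<^sub>R weak_grad \<Omega> u x) (weak_grad \<Omega> ?d)
      + (L2_inner \<Omega> (\<lambda>x. ln (v x)) ?d - L2_inner \<Omega> (\<lambda>x. ln (u x)) ?d) = 0"
    using uw vw d unfolding entropic_poisson_weak_def by force
  then have eq: "\<alpha> * L2_inner \<Omega> (\<lambda>x. weak_grad \<Omega> v x - weak_grad \<Omega> u x) (weak_grad \<Omega> ?d)
      + L2_inner \<Omega> (\<lambda>x. ln (v x) - ln (u x)) ?d = 0"
    by (simp only: L2_inner_scaleR_left L2_inner_diff_left[OF GL(2,1) dG] L2_inner_diff_left[OF lv(1) lu(1) dL2]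
        right_diff_distrib)
  have wgd: "AE x in lebesgue_on \<Omega>. weak_grad \<Omega> ?d x = weak_grad \<Omega> v x - weak_grad \<Omega> u x"
    by (rule weak_grad_AE_eq[OF dL2 is_weak_grad_diff[OF L(2,1) is_weak_grad_weak_grad[OF vH1] is_weak_grad_weak_grad[OF uH1]]])
  have "0 \<le> L2_inner \<Omega> (\<lambda>x. weak_grad \<Omega> v x - weak_grad \<Omega> u x) (weak_grad \<Omega> ?d)"
    unfolding L2_inner_def by (rule integral_nonneg_AE, use wgd in eventually_elim) simp
  then have "0 \<le> \<alpha> * L2_inner \<Omega> (\<lambda>x. weak_grad \<Omega> v x - weak_grad \<Omega> u x) (weak_grad \<Omega> ?d)"
    using \<alpha> by simp
  moreover have "L2_inner \<Omega> (\<lambda>x. ln (v x) - ln (u x)) ?d = (\<integral>x. (ln (v x) - ln (u x)) * (v x - u x) \<partial>lebesgue_on \<Omega>)"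
    by (simp add: L2_inner_def)
  ultimately have le: "(\<integral>x. (ln (v x) - ln (u x)) * (v x - u x) \<partial>lebesgue_on \<Omega>) \<le> 0"
    using eq by linarith
  have mono: "0 < s \<Longrightarrow> 0 < t \<Longrightarrow> 0 \<le> (ln s - ln t) * (s - t)" for s t :: real
    by (cases "s \<le> t") (auto intro: mult_nonpos_nonpos mult_nonneg_nonneg)
  have nonneg: "AE x in lebesgue_on \<Omega>. 0 \<le> (ln (v x) - ln (u x)) * (v x - u x)"
    using lu(2) lv(2) by eventually_elim (rule mono)
  have int: "integrable (lebesgue_on \<Omega>) (\<lambda>x. (ln (v x) - ln (u x)) * (v x - u x))"
    by (rule L2_mult_integrable[OF L2_diff[OF lv(1) lu(1)] dL2])
  have "(\<integral>x. (ln (v x) - ln (u x)) * (v x - u x) \<partial>lebesgue_on \<Omega>) = 0"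
    using le integral_nonneg_AE[OF nonneg] by simp
  then have "AE x in lebesgue_on \<Omega>. (ln (v x) - ln (u x)) * (v x - u x) = 0"
    using integral_nonneg_eq_0_iff_AE[OF int nonneg] by simp
  then show ?thesis
    using lu(2) lv(2) by eventually_elim auto
qed

end

text \<open>
  The turning points \<open>w * exp (\<alpha> * f)\<close> of the density lie in \<open>[a, b]\<close>; the last assumption says this
  through the sign of the slope at \<open>a\<close> and at \<open>b\<close>.
\<close>

section \<open>Existence of a minimizer by truncation\<close>

locale bounded_data_problem = entropic_problem +
  fixes a b :: real
  assumes a: "0 < a" and ab: "a < b"
    and g_cont: "continuous_on (closure \<Omega>) g"
    and g_boundary: "\<And>x. x \<in> frontier \<Omega> \<Longrightarrow> a < g x" and g_le: "\<And>x. x \<in> closure \<Omega> \<Longrightarrow> g x \<le> b"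
    and slopes: "AE x in lebesgue_on \<Omega>. ln (a / w x) \<le> \<alpha> * f x \<and> \<alpha> * f x \<le> ln (b / w x)"
begin

text \<open>
  The competitors among which a minimizing sequence is chosen; the margins \<open>a/2\<close> and \<open>2 * b\<close> leave room for
  the smooth truncation.
\<close>

definition band :: "('a \<Rightarrow> real) set" where
  "band = {v \<in> H1g \<Omega> g. AE x in lebesgue_on \<Omega>. a / 2 \<le> v x \<and> v x \<le> 2 * b}"

lemma band_obstacle: "v \<in> band \<Longrightarrow> v \<in> obstacle_set \<Omega> g"
  using a by (auto simp: band_def obstacle_set_def elim!: eventually_mono)

lemma band_nonneg: "v \<in> band \<Longrightarrow> AE x in lebesgue_on \<Omega>. 0 \<le> v x"
  using a by (auto simp: band_def elim!: eventually_mono)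

lemma band_H1: "v \<in> band \<Longrightarrow> v \<in> H1 \<Omega>"
  using H1g_H1[OF g_H1] by (auto simp: band_def)

text \<open>
  The set where \<open>g \<le> a\<close> is closed in the closure of the domain and does not meet the boundary, so it is a
  compact subset of the domain. Away from it and from the support of \<open>\<phi>\<close>, \<open>g + \<phi> = g\<close> takes values in
  \<open>[a, b]\<close>, where the truncation is the identity.
\<close>

lemma truncated_competitors:
  obtains T where "T \<in> borel_measurable borel" "\<And>s t. \<bar>T s - T t\<bar> \<le> \<bar>s - t\<bar>"
    "\<And>t. a / 2 \<le> T t" "\<And>t. T t \<le> 2 * b"
    "\<And>t. a \<le> t \<Longrightarrow> t \<le> b \<Longrightarrow> T t = t" "\<And>t. t \<le> a \<Longrightarrow> t \<le> T t \<and> T t \<le> a" "\<And>t. b \<le> t \<Longrightarrow> b \<le> T t \<and> T t \<le> t"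
    "\<And>\<phi>. \<phi> \<in> test_functions \<Omega> \<Longrightarrow> (\<lambda>x. T (g x + \<phi> x)) \<in> band \<and>
      (\<exists>G. is_weak_grad \<Omega> (\<lambda>x. T (g x + \<phi> x)) G \<and>
        L2norm \<Omega> G \<le> L2norm \<Omega> (\<lambda>x. weak_grad \<Omega> g x + gradient \<phi> x))"
proof -
  obtain T T' :: "real \<Rightarrow> real" and L where T: "smooth T" "\<And>t. (T has_real_derivative T' t) (at t)"
      "\<And>t. 0 \<le> T' t" "\<And>t. T' t \<le> 1" "L \<ge> 0" "\<And>s t. \<bar>T' s - T' t\<bar> \<le> L * \<bar>s - t\<bar>"
    and T_id: "\<And>t. a \<le> t \<Longrightarrow> t \<le> b \<Longrightarrow> T t = t" and T'_1: "\<And>t. a \<le> t \<Longrightarrow> t \<le> b \<Longrightarrow> T' t = 1"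
    and range: "\<And>t. a / 2 \<le> T t" "\<And>t. T t \<le> 2 * b"
    and sides: "\<And>t. t \<le> a \<Longrightarrow> t \<le> T t \<and> T t \<le> a" "\<And>t. b \<le> t \<Longrightarrow> b \<le> T t \<and> T t \<le> t"
    by (rule smooth_truncation_exists[OF a ab]) (rule that, assumption+)
  have T_Lip: "\<bar>T s - T t\<bar> \<le> \<bar>s - t\<bar>" for s t
  proof -
    have "norm (T s - T t) \<le> 1 * norm (s - t)"
      by (rule field_differentiable_bound[of UNIV T T']) (use T in auto)
    then show ?thesis by simp
  qed
  have "(\<lambda>x. T (g x + \<phi> x)) \<in> band \<and> (\<exists>G. is_weak_grad \<Omega> (\<lambda>x. T (g x + \<phi> x)) G \<and>
        L2norm \<Omega> G \<le> L2norm \<Omega> (\<lambda>x. weak_grad \<Omega> g x + gradient \<phi> x))"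
    if \<phi>: "\<phi> \<in> test_functions \<Omega>" for \<phi>
  proof -
    obtain S where S: "compact S" "S \<subseteq> \<Omega>" "\<And>x. x \<notin> S \<Longrightarrow> \<phi> x = 0" using \<phi> by (metis test_functionsE)
    let ?A = "{x \<in> closure \<Omega>. g x \<le> a}"
    have "compact (closure \<Omega>)" using bounded_domain by simp
    moreover have "closed ?A"
      by (rule continuous_closed_preimage[OF g_cont closed_closure, of "{..a}", unfolded vimage_def Int_def, simplified])
    ultimately have A: "compact ?A" using compact_Int_closed[of "closure \<Omega>" ?A] by (simp add: Int_def)
    have A_sub: "?A \<subseteq> \<Omega>"
    proof
      fix x assume x: "x \<in> ?A"
      show "x \<in> \<Omega>"
      proof (rule ccontr)
        assume "x \<notin> \<Omega>"
        then have "x \<in> frontier \<Omega>" using x open_domain by (simp add: frontier_def interior_open)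
        then show False using g_boundary[of x] x by simp
      qed
    qed
    have out: "\<phi> x = 0 \<and> gradient \<phi> x = 0 \<and> T (g x) = g x \<and> T' (g x) = 1"
      if x: "x \<in> \<Omega>" "x \<notin> ?A \<union> S" for x
    proof -
      have "x \<in> closure \<Omega>" using x(1) closure_subset by blast
      then have "a \<le> g x" "g x \<le> b" using x g_le[of x] by auto
      moreover have "gradient \<phi> x = 0"
        unfolding gradient_def using partial_deriv_outside[OF compact_imp_closed[OF S(1)] S(3)] x by simp
      ultimately show ?thesis using T_id T'_1 S(3)[of x] x by simp
    qed
    have K: "compact (?A \<union> S)" "?A \<union> S \<subseteq> \<Omega>" using A A_sub S by auto
    note tr = smooth_truncation_H10[OF g_H1 g_cont \<phi> T K out]
    let ?v = "\<lambda>x. T (g x + \<phi> x)"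
    let ?G = "\<lambda>x. T' (g x + \<phi> x) *\<^sub>R (weak_grad \<Omega> g x + gradient \<phi> x)"
    have "?v \<in> H1g \<Omega> g"
      unfolding H1g_def using tr(1) by (auto intro!: exI[of _ "\<lambda>x. ?v x - g x"])
    then have band: "?v \<in> band" using range by (simp add: band_def)
    have "is_weak_grad \<Omega> (\<lambda>x. g x + (?v x - g x)) (\<lambda>x. weak_grad \<Omega> g x + (?G x - weak_grad \<Omega> g x))"
      by (rule is_weak_grad_add[OF H1_L2[OF g_H1] H1_L2[OF H10_H1[OF tr(1)]] is_weak_grad_weak_grad[OF g_H1] tr(2)])
    then have G: "is_weak_grad \<Omega> ?v ?G" by simp
    have "L2norm \<Omega> ?G \<le> L2norm \<Omega> (\<lambda>x. weak_grad \<Omega> g x + gradient \<phi> x)"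
    proof (rule L2norm_mono)
      show "(\<lambda>x. weak_grad \<Omega> g x + gradient \<phi> x) \<in> L2 \<Omega>"
        by (rule L2_add[OF H1_weak_grad_L2[OF g_H1] gradient_test_function_L2[OF \<phi>]])
      show "?G \<in> borel_measurable (lebesgue_on \<Omega>)" by (rule L2_measurable[OF is_weak_grad_L2[OF G]])
      show "AE x in lebesgue_on \<Omega>. norm (?G x) \<le> norm (weak_grad \<Omega> g x + gradient \<phi> x)"
        using T(3,4) by (intro AE_I2) (simp add: mult_left_le_one_le)
    qed
    with band G show ?thesis by blast
  qed
  with smooth_borel[OF T(1)] T_Lip range T_id sides show ?thesis by (rule that)
qed

definition slope_bound :: real where
  "slope_bound = inverse \<alpha> * (\<bar>ln (a / 2 / wu)\<bar> + \<bar>ln (2 * b / wl)\<bar>) + Fb"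

lemma slope_bound_nonneg: "0 \<le> slope_bound"
  using \<alpha> Fb by (simp add: slope_bound_def)

text \<open>
  On the band the slope \<open>ln (t / w) / \<alpha> - f\<close> is bounded.
\<close>

lemma energy_density_Lipschitz:
  "AE x in lebesgue_on \<Omega>. \<forall>s t. a / 2 \<le> s \<and> s \<le> 2 * b \<and> a / 2 \<le> t \<and> t \<le> 2 * b \<longrightarrow>
     \<bar>energy_density x s - energy_density x t\<bar> \<le> slope_bound * \<bar>s - t\<bar>"
  using w_bound f_bound
proof eventually_elim
  case (elim x)
  let ?\<Lambda> = "\<bar>ln (a / 2 / wu)\<bar> + \<bar>ln (2 * b / wl)\<bar>"
  have wx: "0 < w x" using elim wl by simp
  have ln_bound: "\<bar>ln (s / w x)\<bar> \<le> ?\<Lambda>" if "a / 2 \<le> s" "s \<le> 2 * b" for s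
  proof -
    have s: "0 < s" using that a by simp
    have "a / 2 / wu \<le> s / w x" by (rule frac_le) (use that elim a wx s in auto)
    moreover have "s / w x \<le> 2 * b / wl" by (rule frac_le) (use that elim wl s in auto)
    moreover have "0 < a / 2 / wu" "0 < s / w x" using a wl wx s by auto
    ultimately have "ln (a / 2 / wu) \<le> ln (s / w x)" "ln (s / w x) \<le> ln (2 * b / wl)"
      by (metis ln_le_cancel_iff order_less_le_trans)+
    then show ?thesis by linarith
  qed
  show ?case
  proof (intro allI impI)
    fix s t assume st: "a / 2 \<le> s \<and> s \<le> 2 * b \<and> a / 2 \<le> t \<and> t \<le> 2 * b"
    have "\<bar>relative_entropy (w x) s - relative_entropy (w x) t\<bar> \<le> ?\<Lambda> * \<bar>s - t\<bar>"
      using st a by (intro relative_entropy_Lipschitz wx ln_bound) auto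
    then have 1: "\<bar>inverse \<alpha> * (relative_entropy (w x) s - relative_entropy (w x) t)\<bar> \<le> inverse \<alpha> * ?\<Lambda> * \<bar>s - t\<bar>"
      using \<alpha> by (simp add: abs_mult mult.assoc mult_left_mono)
    have 2: "\<bar>f x * (s - t)\<bar> \<le> Fb * \<bar>s - t\<bar>"
      using elim by (simp add: abs_mult mult_right_mono)
    have "energy_density x s - energy_density x t
        = inverse \<alpha> * (relative_entropy (w x) s - relative_entropy (w x) t) - f x * (s - t)"
      by (simp add: energy_density_def algebra_simps)
    then have "\<bar>energy_density x s - energy_density x t\<bar> \<le> inverse \<alpha> * ?\<Lambda> * \<bar>s - t\<bar> + Fb * \<bar>s - t\<bar>"
      using 1 2 by linarith
    then show "\<bar>energy_density x s - energy_density x t\<bar> \<le> slope_bound * \<bar>s - t\<bar>"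
      by (simp add: slope_bound_def distrib_right)
  qed
qed

lemma energy_density_integral_tendsto:
  assumes vk: "\<And>k. vk k \<in> L2 \<Omega>" and v: "v \<in> L2 \<Omega>"
    and vk_band: "\<And>k. AE x in lebesgue_on \<Omega>. a / 2 \<le> vk k x \<and> vk k x \<le> 2 * b"
    and v_band: "AE x in lebesgue_on \<Omega>. a / 2 \<le> v x \<and> v x \<le> 2 * b"
    and lim: "(\<lambda>k. L2norm \<Omega> (\<lambda>x. vk k x - v x)) \<longlonglongrightarrow> 0"
  shows "(\<lambda>k. \<integral>x. energy_density x (vk k x) \<partial>lebesgue_on \<Omega>) \<longlonglongrightarrow> (\<integral>x. energy_density x (v x) \<partial>lebesgue_on \<Omega>)"
proof (rule LIM_zero_cancel, rule tendsto_rabs_zero_cancel, rule tendsto_sandwich[OF _ _ tendsto_const])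
  let ?C = "slope_bound * sqrt (measure lebesgue \<Omega>)"
  show "(\<lambda>k. ?C * L2norm \<Omega> (\<lambda>x. vk k x - v x)) \<longlonglongrightarrow> 0"
    using tendsto_mult_left[OF lim, of ?C] by simp
  have "\<bar>(\<integral>x. energy_density x (vk k x) \<partial>lebesgue_on \<Omega>) - (\<integral>x. energy_density x (v x) \<partial>lebesgue_on \<Omega>)\<bar>
      \<le> ?C * L2norm \<Omega> (\<lambda>x. vk k x - v x)" for k
  proof -
    have vk0: "AE x in lebesgue_on \<Omega>. 0 \<le> vk k x" using vk_band[of k] by eventually_elim (use a in simp)
    have v0: "AE x in lebesgue_on \<Omega>. 0 \<le> v x" using v_band by eventually_elim (use a in simp)
    note int = energy_density_integrable[OF vk vk0] energy_density_integrable[OF v v0]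
    note dL2 = L2_diff[OF vk v, of k]
    have "\<bar>(\<integral>x. energy_density x (vk k x) \<partial>lebesgue_on \<Omega>) - (\<integral>x. energy_density x (v x) \<partial>lebesgue_on \<Omega>)\<bar>
        = \<bar>\<integral>x. energy_density x (vk k x) - energy_density x (v x) \<partial>lebesgue_on \<Omega>\<bar>"
      using int by simp
    also have "\<dots> \<le> (\<integral>x. slope_bound * \<bar>vk k x - v x\<bar> \<partial>lebesgue_on \<Omega>)"
    proof (rule order_trans[OF integral_abs_bound], rule integral_mono_AE)
      show "integrable (lebesgue_on \<Omega>) (\<lambda>x. \<bar>energy_density x (vk k x) - energy_density x (v x)\<bar>)" using int by simp
      show "integrable (lebesgue_on \<Omega>) (\<lambda>x. slope_bound * \<bar>vk k x - v x\<bar>)" using L2_integrable[OF dL2] by simp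
      show "AE x in lebesgue_on \<Omega>. \<bar>energy_density x (vk k x) - energy_density x (v x)\<bar> \<le> slope_bound * \<bar>vk k x - v x\<bar>"
        using energy_density_Lipschitz vk_band[of k] v_band by eventually_elim simp
    qed
    also have "\<dots> = slope_bound * (\<integral>x. \<bar>vk k x - v x\<bar> \<partial>lebesgue_on \<Omega>)" by simp
    also have "\<dots> \<le> slope_bound * (sqrt (measure lebesgue \<Omega>) * L2norm \<Omega> (\<lambda>x. vk k x - v x))"
      by (rule mult_left_mono[OF L2_norm_integral_le[OF dL2] slope_bound_nonneg])
    finally show ?thesis by (simp add: mult.assoc)
  qed
  then show "\<forall>\<^sub>F k in sequentially. \<bar>(\<integral>x. energy_density x (vk k x) \<partial>lebesgue_on \<Omega>)
      - (\<integral>x. energy_density x (v x) \<partial>lebesgue_on \<Omega>)\<bar> \<le> ?C * L2norm \<Omega> (\<lambda>x. vk k x - v x)" by simp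
qed simp

lemma band_J:
  assumes "v \<in> band"
  shows "J v = (L2norm \<Omega> (weak_grad \<Omega> v))\<^sup>2 / 2 + (\<integral>x. energy_density x (v x) \<partial>lebesgue_on \<Omega>)"
  using J_eq[OF H1_L2[OF band_H1[OF assms]] is_weak_grad_weak_grad[OF band_H1[OF assms]] band_nonneg[OF assms]] .

lemma J_bounded_below_on_band: "bdd_below (J ` band)"
proof (rule bdd_belowI2)
  fix v assume v: "v \<in> band"
  have vb: "AE x in lebesgue_on \<Omega>. a / 2 \<le> v x \<and> v x \<le> 2 * b" using v by (simp add: band_def)
  have "(\<integral>x. - (Fb * (2 * b)) \<partial>lebesgue_on \<Omega>) \<le> (\<integral>x. energy_density x (v x) \<partial>lebesgue_on \<Omega>)"
  proof (rule integral_mono_AE[OF integrable_const_domain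
        energy_density_integrable[OF H1_L2[OF band_H1[OF v]] band_nonneg[OF v]]])
    show "AE x in lebesgue_on \<Omega>. - (Fb * (2 * b)) \<le> energy_density x (v x)"
      using vb w_bound f_bound
    proof eventually_elim
      case (elim x)
      have "0 \<le> inverse \<alpha> * relative_entropy (w x) (v x)"
        using elim wl a \<alpha> by (intro mult_nonneg_nonneg relative_entropy_nonneg) auto
      moreover have "\<bar>f x * v x\<bar> \<le> Fb * (2 * b)"
        unfolding abs_mult using elim a by (intro mult_mono) auto
      ultimately show ?case unfolding energy_density_def by linarith
    qed
  qed
  then show "(\<integral>x. - (Fb * (2 * b)) \<partial>lebesgue_on \<Omega>) \<le> J v"
    unfolding band_J[OF v] by (rule order_trans) simp
qed

text \<open>
  The gradients contribute the parallelogram identity; on the band, where functions are at most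
  \<open>2 * b\<close>, the density contributes its convexity defect.
\<close>

lemma J_midpoint:
  assumes u: "u \<in> band" and v: "v \<in> band"
  shows "(\<lambda>x. (u x + v x) / 2) \<in> band"
    and "J (\<lambda>x. (u x + v x) / 2) \<le> (J u + J v) / 2
      - (L2norm \<Omega> (\<lambda>x. weak_grad \<Omega> u x - weak_grad \<Omega> v x))\<^sup>2 / 8
      - inverse \<alpha> / (16 * b) * (L2norm \<Omega> (\<lambda>x. u x - v x))\<^sup>2"
proof -
  let ?m = "\<lambda>x. (u x + v x) / 2"
  have ub: "AE x in lebesgue_on \<Omega>. a / 2 \<le> u x \<and> u x \<le> 2 * b" and vb: "AE x in lebesgue_on \<Omega>. a / 2 \<le> v x \<and> v x \<le> 2 * b"
    and H: "u \<in> H1g \<Omega> g" "v \<in> H1g \<Omega> g"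
    using u v by (auto simp: band_def)
  have "AE x in lebesgue_on \<Omega>. a / 2 \<le> ?m x \<and> ?m x \<le> 2 * b" using ub vb by eventually_elim auto
  then show m: "?m \<in> band" using H1g_midpoint[OF H] unfolding band_def by blast
  note uL2 = H1_L2[OF band_H1[OF u]] and vL2 = H1_L2[OF band_H1[OF v]] and mL2 = H1_L2[OF band_H1[OF m]]
  obtain M where M: "is_weak_grad \<Omega> ?m M"
    "(L2norm \<Omega> M)\<^sup>2 / 2 = ((L2norm \<Omega> (weak_grad \<Omega> u))\<^sup>2 / 2 + (L2norm \<Omega> (weak_grad \<Omega> v))\<^sup>2 / 2) / 2
      - (L2norm \<Omega> (\<lambda>x. weak_grad \<Omega> u x - weak_grad \<Omega> v x))\<^sup>2 / 8"
    using midpoint_gradient[OF uL2 vL2 is_weak_grad_weak_grad[OF band_H1[OF u]] is_weak_grad_weak_grad[OF band_H1[OF v]]] by blast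
  let ?\<kappa> = "inverse \<alpha> / (16 * b)"
  note ints = energy_density_integrable[OF uL2 band_nonneg[OF u]] energy_density_integrable[OF vL2 band_nonneg[OF v]]
    energy_density_integrable[OF mL2 band_nonneg[OF m]]
  note sq = L2_square_integrable[OF L2_diff[OF uL2 vL2]]
  have "(\<integral>x. energy_density x (?m x) \<partial>lebesgue_on \<Omega>)
      \<le> (\<integral>x. (energy_density x (u x) + energy_density x (v x)) / 2 - ?\<kappa> * (norm (u x - v x))\<^sup>2 \<partial>lebesgue_on \<Omega>)"
  proof (rule integral_mono_AE[OF ints(3)])
    show "integrable (lebesgue_on \<Omega>) (\<lambda>x. (energy_density x (u x) + energy_density x (v x)) / 2 - ?\<kappa> * (norm (u x - v x))\<^sup>2)"
      using ints sq by (intro Bochner_Integration.integrable_diff integrable_divide Bochner_Integration.integrable_add integrable_mult_right)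
    show "AE x in lebesgue_on \<Omega>. energy_density x (?m x)
        \<le> (energy_density x (u x) + energy_density x (v x)) / 2 - ?\<kappa> * (norm (u x - v x))\<^sup>2"
      using ub vb w_bound
    proof eventually_elim
      case (elim x)
      have "energy_density x (?m x) \<le> (energy_density x (u x) + energy_density x (v x)) / 2
          - inverse \<alpha> * ((u x - v x)\<^sup>2 / (8 * (2 * b)))"
        using elim a ab wl by (intro energy_density_midpoint) auto
      then show ?case by simp
    qed
  qed
  also have "\<dots> = ((\<integral>x. energy_density x (u x) \<partial>lebesgue_on \<Omega>) + (\<integral>x. energy_density x (v x) \<partial>lebesgue_on \<Omega>)) / 2
      - ?\<kappa> * (L2norm \<Omega> (\<lambda>x. u x - v x))\<^sup>2"
    using ints sq unfolding L2norm_square by simp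
  finally have d: "(\<integral>x. energy_density x (?m x) \<partial>lebesgue_on \<Omega>) \<le> \<dots>" .
  have comb: "GU / 2 + DU = JU \<Longrightarrow> GV / 2 + DV = JV \<Longrightarrow> DM \<le> (DU + DV) / 2 - X \<Longrightarrow>
      (GU / 2 + GV / 2) / 2 - Y + DM \<le> (JU + JV) / 2 - Y - X" for GU GV DU DV DM JU JV X Y :: real
    by argo
  show "J ?m \<le> (J u + J v) / 2 - (L2norm \<Omega> (\<lambda>x. weak_grad \<Omega> u x - weak_grad \<Omega> v x))\<^sup>2 / 8
      - ?\<kappa> * (L2norm \<Omega> (\<lambda>x. u x - v x))\<^sup>2"
    unfolding J_eq[OF mL2 M(1) band_nonneg[OF m]] M(2)
    by (rule comb[OF band_J[OF u, symmetric] band_J[OF v, symmetric] d])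
qed

text \<open>
  By uniform convexity a minimizing sequence and its gradients are Cauchy in \<open>L\<^sup>2\<close>. The limit keeps the
  boundary values since \<open>H\<^sup>1\<^sub>0\<close> is closed, and the bounds by almost everywhere convergence of a
  subsequence. The functional is continuous along the sequence.
\<close>

lemma band_minimizer_exists:
  obtains u where "u \<in> band" "\<And>v. v \<in> band \<Longrightarrow> J u \<le> J v"
proof -
  have ne: "band \<noteq> {}"
  proof (rule truncated_competitors, goal_cases)
    case (1 T)
    then show ?case using 1(8)[OF test_functions_zero] by blast
  qed
  define m where "m = Inf (J ` band)"
  have m_le: "m \<le> J v" if "v \<in> band" for v
    unfolding m_def using that J_bounded_below_on_band by (intro cInf_lower) auto
  have "\<exists>v. v \<in> band \<and> J v < m + inverse (real (Suc k))" for k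
  proof -
    have "Inf (J ` band) < m + inverse (real (Suc k))" unfolding m_def by simp
    then show ?thesis using ne J_bounded_below_on_band by (subst (asm) cInf_less_iff) auto
  qed
  then obtain vk where vk: "\<And>k. vk k \<in> band" and Jvk: "\<And>k. J (vk k) < m + inverse (real (Suc k))" by metis
  let ?G = "\<lambda>k. weak_grad \<Omega> (vk k)"
  have vkL2: "vk k \<in> L2 \<Omega>" and GkL2: "?G k \<in> L2 \<Omega>" for k
    using band_H1[OF vk[of k]] H1_L2 H1_weak_grad_L2 by auto
  let ?\<kappa> = "inverse \<alpha> / (16 * b)"
  have \<kappa>: "?\<kappa> > 0" using \<alpha> a ab by simp
  have est: "(L2norm \<Omega> (\<lambda>x. ?G k x - ?G l x))\<^sup>2 / 8 + ?\<kappa> * (L2norm \<Omega> (\<lambda>x. vk k x - vk l x))\<^sup>2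
      \<le> inverse (real (Suc N))" if "k \<ge> N" "l \<ge> N" for k l N
  proof -
    have e: "inverse (real (Suc k)) \<le> inverse (real (Suc N))" "inverse (real (Suc l)) \<le> inverse (real (Suc N))"
      using that by (auto intro!: le_imp_inverse_le)
    have comb: "A + B \<le> e"
      if "JM \<le> (Jk + Jl) / 2 - A - B" "m \<le> JM" "Jk < m + ek" "Jl < m + el" "ek \<le> e" "el \<le> e"
      for A B JM Jk Jl ek el e :: real
      using that by argo
    show ?thesis
      by (rule comb[OF J_midpoint(2)[OF vk[of k] vk[of l]] m_le[OF J_midpoint(1)[OF vk[of k] vk[of l]]]
            Jvk[of k] Jvk[of l] e])
  qed
  have small: "\<exists>N. \<forall>k\<ge>N. \<forall>l\<ge>N. q k l < e"
    if e: "e > 0" and c: "c > 0" and q: "\<And>N k l. k \<ge> N \<Longrightarrow> l \<ge> N \<Longrightarrow> c * (q k l)\<^sup>2 \<le> inverse (real (Suc N))"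
      and q0: "\<And>k l. 0 \<le> q k l" for q :: "nat \<Rightarrow> nat \<Rightarrow> real" and c e
  proof -
    obtain N where N: "inverse (real (Suc N)) < c * e\<^sup>2" using reals_Archimedean[of "c * e\<^sup>2"] e c by auto
    have "q k l < e" if "k \<ge> N" "l \<ge> N" for k l
    proof -
      have "c * (q k l)\<^sup>2 < c * e\<^sup>2" using q[OF that] N by linarith
      then have "(q k l)\<^sup>2 < e\<^sup>2" using c by simp
      then show ?thesis using e by (intro power2_less_imp_less[of "q k l" e]) auto
    qed
    then show ?thesis by blast
  qed
  have Cauchy_vk: "\<exists>N. \<forall>k\<ge>N. \<forall>l\<ge>N. L2norm \<Omega> (\<lambda>x. vk k x - vk l x) < e" if "e > 0" for e
  proof (rule small[OF that \<kappa>])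
    fix N k l :: nat assume "k \<ge> N" "l \<ge> N"
    from est[OF this] show "?\<kappa> * (L2norm \<Omega> (\<lambda>x. vk k x - vk l x))\<^sup>2 \<le> inverse (real (Suc N))"
      using zero_le_power2[of "L2norm \<Omega> (\<lambda>x. ?G k x - ?G l x)"] by linarith
  qed simp
  obtain u where uL2: "u \<in> L2 \<Omega>" and limu: "(\<lambda>k. L2norm \<Omega> (\<lambda>x. vk k x - u x)) \<longlonglongrightarrow> 0"
    by (rule L2_complete[OF vkL2 Cauchy_vk]) (assumption, rule that)
  have Cauchy_Gk: "\<exists>N. \<forall>k\<ge>N. \<forall>l\<ge>N. L2norm \<Omega> (\<lambda>x. ?G k x - ?G l x) < e" if "e > 0" for e
  proof (rule small[OF that, of "1 / 8"])
    fix N k l :: nat assume kl: "k \<ge> N" "l \<ge> N"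
    have "0 \<le> ?\<kappa> * (L2norm \<Omega> (\<lambda>x. vk k x - vk l x))\<^sup>2" using \<kappa> by (intro mult_nonneg_nonneg) auto
    with est[OF kl] show "1 / 8 * (L2norm \<Omega> (\<lambda>x. ?G k x - ?G l x))\<^sup>2 \<le> inverse (real (Suc N))" by linarith
  qed auto
  obtain G where GL2: "G \<in> L2 \<Omega>" and limG: "(\<lambda>k. L2norm \<Omega> (\<lambda>x. ?G k x - G x)) \<longlonglongrightarrow> 0"
    by (rule L2_complete[OF GkL2 Cauchy_Gk]) (assumption, rule that)
  have wG: "is_weak_grad \<Omega> u G"
    by (rule is_weak_grad_limit[OF vkL2 is_weak_grad_weak_grad[OF band_H1[OF vk]] uL2 GL2 limu limG])
  note gL2 = H1_L2[OF g_H1] and wg = is_weak_grad_weak_grad[OF g_H1]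
  have "(\<lambda>x. u x - g x) \<in> H10 \<Omega>"
  proof (rule H10_closed(1))
    show "(\<lambda>x. vk k x - g x) \<in> H10 \<Omega>" for k using vk[of k] by (auto simp: band_def H1g_def)
    show "is_weak_grad \<Omega> (\<lambda>x. vk k x - g x) (\<lambda>x. ?G k x - weak_grad \<Omega> g x)" for k
      by (rule is_weak_grad_diff[OF vkL2 gL2 is_weak_grad_weak_grad[OF band_H1[OF vk]] wg])
    show "(\<lambda>x. u x - g x) \<in> L2 \<Omega>" by (rule L2_diff[OF uL2 gL2])
    show "(\<lambda>x. G x - weak_grad \<Omega> g x) \<in> L2 \<Omega>" by (rule L2_diff[OF GL2 is_weak_grad_L2[OF wg]])
  qed (use limu limG in simp_all)
  then have uH: "u \<in> H1g \<Omega> g"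
    unfolding H1g_def by (auto intro!: exI[of _ "\<lambda>x. u x - g x"])
  obtain r :: "nat \<Rightarrow> nat" where r: "AE x in lebesgue_on \<Omega>. (\<lambda>k. vk (r k) x) \<longlonglongrightarrow> u x"
    using L2_AE_subsequence[OF vkL2 uL2 limu] by blast
  have vkb: "AE x in lebesgue_on \<Omega>. a / 2 \<le> vk k x \<and> vk k x \<le> 2 * b" for k using vk[of k] by (simp add: band_def)
  have "AE x in lebesgue_on \<Omega>. \<forall>k. a / 2 \<le> vk (r k) x \<and> vk (r k) x \<le> 2 * b"
    using vkb by (simp add: AE_all_countable)
  with r have ub: "AE x in lebesgue_on \<Omega>. a / 2 \<le> u x \<and> u x \<le> 2 * b"
  proof eventually_elim
    case (elim x)
    then show ?case
      using LIMSEQ_le_const[OF elim(1), of "a / 2"] LIMSEQ_le_const2[OF elim(1), of "2 * b"] by blast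
  qed
  have u: "u \<in> band" using uH ub by (simp add: band_def)
  have "(\<lambda>k. (L2norm \<Omega> (?G k))\<^sup>2 / 2 + (\<integral>x. energy_density x (vk k x) \<partial>lebesgue_on \<Omega>))
      \<longlonglongrightarrow> (L2norm \<Omega> G)\<^sup>2 / 2 + (\<integral>x. energy_density x (u x) \<partial>lebesgue_on \<Omega>)"
    by (rule tendsto_add[OF tendsto_divide[OF tendsto_power[OF L2norm_tendsto[OF GkL2 GL2 limG]] tendsto_const]
          energy_density_integral_tendsto[OF vkL2 uL2 vkb ub limu]]) simp
  then have Jlim: "(\<lambda>k. J (vk k)) \<longlonglongrightarrow> J u"
    unfolding band_J[OF vk] J_eq[OF uL2 wG band_nonneg[OF u]] .
  have "(\<lambda>k. m + inverse (real (Suc k))) \<longlonglongrightarrow> m + 0"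
    by (intro tendsto_add tendsto_const LIMSEQ_inverse_real_of_nat)
  then have "J u \<le> m + 0"
    by (rule LIMSEQ_le[OF Jlim]) (intro exI[of _ 0] allI impI less_imp_le Jvk)
  then have "J u \<le> J v" if "v \<in> band" for v using m_le[OF that] by simp
  with u show ?thesis by (rule that)
qed

text \<open>
  If \<open>t \<le> s \<le> a\<close>, the slope of the density at \<open>s\<close> is at most zero; if \<open>b \<le> s \<le> t\<close>, it is at least zero.
  In both cases the tangent at \<open>s\<close> takes at \<open>t\<close> a value that is at least the density at \<open>s\<close>, and
  the graph lies above its tangent.
\<close>

lemma energy_density_truncation:
  assumes "0 < w x" "0 \<le> t" and sl: "ln (a / w x) \<le> \<alpha> * f x" "\<alpha> * f x \<le> ln (b / w x)"
    and id: "a \<le> t \<Longrightarrow> t \<le> b \<Longrightarrow> s = t" and low: "t \<le> a \<Longrightarrow> t \<le> s \<and> s \<le> a" and up: "b \<le> t \<Longrightarrow> b \<le> s \<and> s \<le> t"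
    and s: "0 < s"
  shows "energy_density x s \<le> energy_density x t"
proof -
  have "0 \<le> (ln (s / w x) - \<alpha> * f x) * (t - s)"
  proof -
    consider "t \<le> a" | "a \<le> t" "t \<le> b" | "b \<le> t" by linarith
    then show ?thesis
    proof cases
      case 1
      have "ln (s / w x) \<le> ln (a / w x)"
        using low[OF 1] s assms(1) by (intro ln_mono divide_right_mono) auto
      then show ?thesis using sl(1) low[OF 1] by (intro mult_nonpos_nonpos) auto
    next
      case 2
      then show ?thesis using id by simp
    next
      case 3
      have "ln (b / w x) \<le> ln (s / w x)"
        using up[OF 3] a ab assms(1) by (intro ln_mono divide_right_mono) auto
      then show ?thesis using sl(2) up[OF 3] by (intro mult_nonneg_nonneg) auto
    qed
  qed
  then have "\<alpha> * f x * (t - s) \<le> ln (s / w x) * (t - s)" by (simp add: left_diff_distrib)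
  also have "\<dots> \<le> relative_entropy (w x) t - relative_entropy (w x) s"
    using relative_entropy_tangent[OF assms(1,2) s] by simp
  finally have "inverse \<alpha> * (\<alpha> * f x * (t - s)) \<le> inverse \<alpha> * (relative_entropy (w x) t - relative_entropy (w x) s)"
    using \<alpha> by (intro mult_left_mono) auto
  moreover have "inverse \<alpha> * (\<alpha> * f x * (t - s)) = f x * (t - s)" using \<alpha> by simp
  ultimately show ?thesis by (simp add: energy_density_def right_diff_distrib)
qed

text \<open>
  Approximate \<open>v = g + z\<close> by \<open>g + \<phi>\<^sub>k\<close> and truncate. The truncated gradients are bounded by those of
  \<open>g + \<phi>\<^sub>k\<close>, which converge to the gradient of \<open>v\<close>. The lower-order terms converge to those of \<open>T v\<close>,
  which are at most those of \<open>v\<close>.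
\<close>

lemma band_minimizer_global:
  assumes u: "\<And>v. v \<in> band \<Longrightarrow> J u \<le> J v" and v: "v \<in> obstacle_set \<Omega> g"
  shows "J u \<le> J v"
proof -
  obtain T where Tm[measurable]: "T \<in> borel_measurable borel" and T_Lip: "\<And>s t. \<bar>T s - T t\<bar> \<le> \<bar>s - t\<bar>"
    and range: "\<And>t. a / 2 \<le> T t" "\<And>t. T t \<le> 2 * b"
    and sides: "\<And>t. a \<le> t \<Longrightarrow> t \<le> b \<Longrightarrow> T t = t" "\<And>t. t \<le> a \<Longrightarrow> t \<le> T t \<and> T t \<le> a" "\<And>t. b \<le> t \<Longrightarrow> b \<le> T t \<and> T t \<le> t"
    and comp: "\<And>\<phi>. \<phi> \<in> test_functions \<Omega> \<Longrightarrow> (\<lambda>x. T (g x + \<phi> x)) \<in> band \<and>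
      (\<exists>G. is_weak_grad \<Omega> (\<lambda>x. T (g x + \<phi> x)) G \<and>
        L2norm \<Omega> G \<le> L2norm \<Omega> (\<lambda>x. weak_grad \<Omega> g x + gradient \<phi> x))"
    by (rule truncated_competitors) (rule that, assumption+)
  obtain z where z: "z \<in> H10 \<Omega>" and vz: "v = (\<lambda>x. g x + z x)" using v by (auto simp: obstacle_set_def H1g_def)
  have v0: "AE x in lebesgue_on \<Omega>. 0 \<le> v x" using v by (simp add: obstacle_set_def)
  note zG = is_weak_grad_weak_grad[OF H10_H1[OF z]] and gG = is_weak_grad_weak_grad[OF g_H1]
  note zL2 = H1_L2[OF H10_H1[OF z]] and gL2 = H1_L2[OF g_H1]
  have vL2: "v \<in> L2 \<Omega>" unfolding vz by (rule L2_add[OF gL2 zL2])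
  let ?V = "\<lambda>x. weak_grad \<Omega> g x + weak_grad \<Omega> z x"
  have vG: "is_weak_grad \<Omega> v ?V" unfolding vz by (rule is_weak_grad_add[OF gL2 zL2 gG zG])
  obtain \<phi> where \<phi>: "\<And>k. \<phi> k \<in> test_functions \<Omega>"
    and lim: "(\<lambda>k. L2norm \<Omega> (\<lambda>x. \<phi> k x - z x)) \<longlonglongrightarrow> 0"
    and limG: "(\<lambda>k. L2norm \<Omega> (\<lambda>x. gradient (\<phi> k) x - weak_grad \<Omega> z x)) \<longlonglongrightarrow> 0"
    using H10_approx[OF z zG] by blast
  let ?vk = "\<lambda>k x. T (g x + \<phi> k x)" and ?Vk = "\<lambda>k x. weak_grad \<Omega> g x + gradient (\<phi> k) x"
  have vk: "?vk k \<in> band" for k using comp[OF \<phi>] by blast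
  have vkL2: "?vk k \<in> L2 \<Omega>" for k by (rule H1_L2[OF band_H1[OF vk]])
  have VkL2: "?Vk k \<in> L2 \<Omega>" for k by (rule L2_add[OF is_weak_grad_L2[OF gG] gradient_test_function_L2[OF \<phi>]])
  have Tv_meas: "(\<lambda>x. T (v x)) \<in> borel_measurable (lebesgue_on \<Omega>)" using L2_measurable[OF vL2] by measurable
  have TvL2: "(\<lambda>x. T (v x)) \<in> L2 \<Omega>"
  proof (rule L2_bounded[OF Tv_meas])
    have "norm (T t) \<le> 2 * b" for t using range[of t] a by (simp add: abs_le_iff)
    then show "AE x in lebesgue_on \<Omega>. norm (T (v x)) \<le> 2 * b" by simp
  qed
  have Tlim: "(\<lambda>k. L2norm \<Omega> (\<lambda>x. ?vk k x - T (v x))) \<longlonglongrightarrow> 0"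
  proof (rule L2norm_squeeze[OF _ lim])
    show "L2norm \<Omega> (\<lambda>x. ?vk k x - T (v x)) \<le> L2norm \<Omega> (\<lambda>x. \<phi> k x - z x)" for k
    proof (rule L2norm_mono[OF L2_diff[OF test_function_L2[OF \<phi>] zL2] L2_measurable[OF L2_diff[OF vkL2 TvL2]]])
      show "AE x in lebesgue_on \<Omega>. norm (?vk k x - T (v x)) \<le> norm (\<phi> k x - z x)"
      proof (rule AE_I2)
        fix x show "norm (?vk k x - T (v x)) \<le> norm (\<phi> k x - z x)"
          using T_Lip[of "g x + \<phi> k x" "v x"] by (simp add: vz)
      qed
    qed
  qed
  have Vlim: "(\<lambda>k. L2norm \<Omega> (?Vk k)) \<longlonglongrightarrow> L2norm \<Omega> ?V"
    by (rule L2norm_tendsto[OF VkL2 is_weak_grad_L2[OF vG]]) (use limG in simp)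
  have "(\<lambda>k. (L2norm \<Omega> (?Vk k))\<^sup>2 / 2 + (\<integral>x. energy_density x (?vk k x) \<partial>lebesgue_on \<Omega>))
      \<longlonglongrightarrow> (L2norm \<Omega> ?V)\<^sup>2 / 2 + (\<integral>x. energy_density x (T (v x)) \<partial>lebesgue_on \<Omega>)"
    by (rule tendsto_add[OF tendsto_divide[OF tendsto_power[OF Vlim] tendsto_const]
          energy_density_integral_tendsto[OF vkL2 TvL2 _ _ Tlim]]) (use range in auto)
  moreover have "J u \<le> (L2norm \<Omega> (?Vk k))\<^sup>2 / 2 + (\<integral>x. energy_density x (?vk k x) \<partial>lebesgue_on \<Omega>)" for k
  proof -
    obtain G where G: "is_weak_grad \<Omega> (?vk k) G" "L2norm \<Omega> G \<le> L2norm \<Omega> (?Vk k)" using comp[OF \<phi>] by blast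
    have "J u \<le> J (?vk k)" by (rule u[OF vk])
    also have "\<dots> = (L2norm \<Omega> G)\<^sup>2 / 2 + (\<integral>x. energy_density x (?vk k x) \<partial>lebesgue_on \<Omega>)"
      by (rule J_eq[OF vkL2 G(1) band_nonneg[OF vk]])
    also have "(L2norm \<Omega> G)\<^sup>2 \<le> (L2norm \<Omega> (?Vk k))\<^sup>2" using G(2) by (intro power_mono) auto
    finally show ?thesis by simp
  qed
  ultimately have "J u \<le> (L2norm \<Omega> ?V)\<^sup>2 / 2 + (\<integral>x. energy_density x (T (v x)) \<partial>lebesgue_on \<Omega>)"
    by (intro LIMSEQ_le_const) auto
  also have "(\<integral>x. energy_density x (T (v x)) \<partial>lebesgue_on \<Omega>) \<le> (\<integral>x. energy_density x (v x) \<partial>lebesgue_on \<Omega>)"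
  proof (rule integral_mono_AE)
    have Tpos: "0 < T t" for t using range(1)[of t] a by linarith
    show "integrable (lebesgue_on \<Omega>) (\<lambda>x. energy_density x (T (v x)))"
      using Tpos by (intro energy_density_integrable[OF TvL2]) (auto intro: less_imp_le)
    show "integrable (lebesgue_on \<Omega>) (\<lambda>x. energy_density x (v x))" by (rule energy_density_integrable[OF vL2 v0])
    show "AE x in lebesgue_on \<Omega>. energy_density x (T (v x)) \<le> energy_density x (v x)"
      using v0 w_bound slopes
    proof eventually_elim
      case (elim x)
      show ?case
        by (rule energy_density_truncation) (use elim wl sides Tpos in auto)
    qed
  qed
  finally show ?thesis using J_eq[OF vL2 vG v0] by simp
qed

text \<open>
  For a test function \<open>\<phi>\<close> and small \<open>\<bar>t\<bar>\<close>, the quadratic upper bound for the entropy yields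
  \<open>0 \<le> J (u + t * \<phi>) - J u \<le> t * L + t\<^sup>2 * Q\<close> with the first variation \<open>L\<close>, so \<open>L = 0\<close>. Both sides of the
  equation are continuous in the \<open>H\<^sup>1\<close> norm of the test function, since \<open>ln u\<close>, \<open>ln w\<close> and \<open>f\<close> are
  square-integrable.
\<close>

section \<open>The Euler-Lagrange equation\<close>

lemma minimizer_weak_solution:
  assumes u: "u \<in> band" and umin: "\<And>v. v \<in> obstacle_set \<Omega> g \<Longrightarrow> J u \<le> J v"
  shows "entropic_poisson_weak \<Omega> \<alpha> f w u"
proof -
  let ?G = "weak_grad \<Omega> u"
  note uH1 = band_H1[OF u]
  note uL2 = H1_L2[OF uH1] and wG = is_weak_grad_weak_grad[OF uH1] and u0 = band_nonneg[OF u]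
  note GL2 = is_weak_grad_L2[OF wG]
  have um[measurable]: "u \<in> borel_measurable (lebesgue_on \<Omega>)" by (rule L2_measurable[OF uL2])
  have ub: "AE x in lebesgue_on \<Omega>. a / 2 \<le> u x \<and> u x \<le> 2 * b" and uH: "u \<in> H1g \<Omega> g"
    using u by (auto simp: band_def)
  have lnu: "(\<lambda>x. ln (u x)) \<in> L2 \<Omega>"
  proof (rule L2_bounded[of _ "\<bar>ln (a / 2)\<bar> + \<bar>ln (2 * b)\<bar>"])
    show "AE x in lebesgue_on \<Omega>. norm (ln (u x)) \<le> \<bar>ln (a / 2)\<bar> + \<bar>ln (2 * b)\<bar>"
      using ub
    proof eventually_elim
      case (elim x)
      then have "ln (a / 2) \<le> ln (u x)" "ln (u x) \<le> ln (2 * b)" using a by (auto intro!: ln_mono)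
      then show ?case unfolding real_norm_def by linarith
    qed
  qed measurable
  have lnw: "(\<lambda>x. ln (w x)) \<in> L2 \<Omega>"
  proof (rule L2_bounded[of _ "\<bar>ln wl\<bar> + \<bar>ln wu\<bar>"])
    show "AE x in lebesgue_on \<Omega>. norm (ln (w x)) \<le> \<bar>ln wl\<bar> + \<bar>ln wu\<bar>"
      using w_bound
    proof eventually_elim
      case (elim x)
      then have "ln wl \<le> ln (w x)" "ln (w x) \<le> ln wu" using wl by (auto intro!: ln_mono)
      then show ?case unfolding real_norm_def by linarith
    qed
  qed measurable
  define q where "q x = inverse \<alpha> * (ln (u x) - ln (w x)) - f x" for x
  have qL2: "q \<in> L2 \<Omega>" unfolding q_def by (intro L2_diff L2_mult_const lnu lnw f_L2)
  have EL: "L2_inner \<Omega> ?G (gradient \<phi>) + L2_inner \<Omega> q \<phi> = 0" if \<phi>: "\<phi> \<in> test_functions \<Omega>" for \<phi>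
  proof -
    obtain C where C: "C \<ge> 0" "\<And>x. \<bar>\<phi> x\<bar> \<le> C" using test_functions_bounded[OF \<phi>] by metis
    \<comment> \<open>\<open>\<bar>t * \<phi>\<bar> \<le> a / 4\<close> for \<open>\<bar>t\<bar> \<le> t0\<close>, so \<open>u + t * \<phi>\<close> stays positive\<close>
    define t0 where "t0 = a / 4 / (C + 1)"
    have t0: "t0 > 0" using a C by (simp add: t0_def)
    let ?L = "L2_inner \<Omega> ?G (gradient \<phi>) + L2_inner \<Omega> q \<phi>"
    let ?Q = "(L2norm \<Omega> (gradient \<phi>))\<^sup>2 / 2 + inverse \<alpha> * (2 / a) * (L2norm \<Omega> \<phi>)\<^sup>2"
    note \<phi>L2 = test_function_L2[OF \<phi>] and d\<phi>L2 = gradient_test_function_L2[OF \<phi>]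
    have var: "0 \<le> t * ?L + t\<^sup>2 * ?Q" if t: "\<bar>t\<bar> \<le> t0" for t
    proof -
      let ?v = "\<lambda>x. u x + t * \<phi> x"
      have small: "\<bar>t * \<phi> x\<bar> \<le> a / 4" for x
      proof -
        have "\<bar>t * \<phi> x\<bar> \<le> t0 * (C + 1)" unfolding abs_mult using t C(1) C(2)[of x] t0 by (intro mult_mono) auto
        also have "C + 1 \<noteq> 0" using C(1) by linarith
        then have "t0 * (C + 1) = a / 4" using t0_def nonzero_eq_divide_eq by blast
        finally show ?thesis .
      qed
      have pos: "AE x in lebesgue_on \<Omega>. 0 < u x \<and> a / 2 \<le> u x \<and> 0 < ?v x"
        using ub
      proof eventually_elim
        case (elim x)
        then show ?case using small[of x] a unfolding abs_le_iff by linarith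
      qed
      have v0: "AE x in lebesgue_on \<Omega>. 0 \<le> ?v x" using pos by eventually_elim simp
      have v: "?v \<in> obstacle_set \<Omega> g"
        using H1g_add_H10[OF uH test_function_H10[OF \<phi>]] v0 by (simp add: obstacle_set_def)
      have vL2: "?v \<in> L2 \<Omega>" by (intro L2_add uL2 L2_mult_const \<phi>L2)
      note vG = is_weak_grad_add_scale[OF uL2 \<phi>L2 wG is_weak_grad_gradient[OF \<phi>], of t]
      have "J ?v = ((L2norm \<Omega> ?G)\<^sup>2 + 2 * t * L2_inner \<Omega> ?G (gradient \<phi>) + t\<^sup>2 * (L2norm \<Omega> (gradient \<phi>))\<^sup>2) / 2
          + (\<integral>x. energy_density x (?v x) \<partial>lebesgue_on \<Omega>)"
        unfolding J_eq[OF vL2 vG v0] L2norm_add_scaleR_square[OF GL2 d\<phi>L2] ..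
      moreover have "(\<integral>x. energy_density x (?v x) \<partial>lebesgue_on \<Omega>)
          \<le> (\<integral>x. energy_density x (u x) + t * (q x * \<phi> x) + t\<^sup>2 * (inverse \<alpha> * (2 / a)) * (norm (\<phi> x))\<^sup>2 \<partial>lebesgue_on \<Omega>)"
      proof (rule integral_mono_AE[OF energy_density_integrable[OF vL2 v0]])
        show "integrable (lebesgue_on \<Omega>) (\<lambda>x. energy_density x (u x) + t * (q x * \<phi> x) + t\<^sup>2 * (inverse \<alpha> * (2 / a)) * (norm (\<phi> x))\<^sup>2)"
          by (intro Bochner_Integration.integrable_add integrable_mult_right energy_density_integrable[OF uL2 u0]
              L2_mult_integrable[OF qL2 \<phi>L2] L2_square_integrable[OF \<phi>L2])
        show "AE x in lebesgue_on \<Omega>. energy_density x (?v x)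
            \<le> energy_density x (u x) + t * (q x * \<phi> x) + t\<^sup>2 * (inverse \<alpha> * (2 / a)) * (norm (\<phi> x))\<^sup>2"
          using pos w_bound
        proof eventually_elim
          case (elim x)
          have wx: "0 < w x" using elim wl by simp
          let ?r = "t * \<phi> x"
          have "?r\<^sup>2 / u x \<le> ?r\<^sup>2 / (a / 2)" using elim a by (intro divide_left_mono) auto
          also have "\<dots> = t\<^sup>2 * (2 / a) * (norm (\<phi> x))\<^sup>2" using a by (simp add: power_mult_distrib field_simps)
          finally have "relative_entropy (w x) (?v x) \<le> relative_entropy (w x) (u x) + ln (u x / w x) * ?r + t\<^sup>2 * (2 / a) * (norm (\<phi> x))\<^sup>2"
            using relative_entropy_quadratic_upper[OF wx, of "u x" ?r] elim by linarith
          also have "ln (u x / w x) = ln (u x) - ln (w x)" using elim wx by (simp add: ln_div)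
          finally have "inverse \<alpha> * relative_entropy (w x) (?v x)
              \<le> inverse \<alpha> * (relative_entropy (w x) (u x) + (ln (u x) - ln (w x)) * ?r + t\<^sup>2 * (2 / a) * (norm (\<phi> x))\<^sup>2)"
            using \<alpha> by (intro mult_left_mono) auto
          then show ?case by (simp add: energy_density_def q_def algebra_simps)
        qed
      qed
      moreover have "(\<integral>x. energy_density x (u x) + t * (q x * \<phi> x) + t\<^sup>2 * (inverse \<alpha> * (2 / a)) * (norm (\<phi> x))\<^sup>2 \<partial>lebesgue_on \<Omega>)
          = (\<integral>x. energy_density x (u x) \<partial>lebesgue_on \<Omega>) + t * L2_inner \<Omega> q \<phi> + t\<^sup>2 * (inverse \<alpha> * (2 / a)) * (L2norm \<Omega> \<phi>)\<^sup>2"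
        unfolding L2norm_square L2_inner_def
        using energy_density_integrable[OF uL2 u0] L2_mult_integrable[OF qL2 \<phi>L2] L2_square_integrable[OF \<phi>L2] by simp
      moreover have "J u \<le> J ?v" by (rule umin[OF v])
      moreover have "t * ?L + t\<^sup>2 * ?Q = t * L2_inner \<Omega> ?G (gradient \<phi>) + t * L2_inner \<Omega> q \<phi>
          + t\<^sup>2 * (L2norm \<Omega> (gradient \<phi>))\<^sup>2 / 2 + t\<^sup>2 * (inverse \<alpha> * (2 / a)) * (L2norm \<Omega> \<phi>)\<^sup>2"
        by (simp only: distrib_left mult.assoc times_divide_eq_right times_divide_eq_left add.assoc)
      moreover have "2 * t * L2_inner \<Omega> ?G (gradient \<phi>) = 2 * (t * L2_inner \<Omega> ?G (gradient \<phi>))"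
        by (rule mult.assoc)
      ultimately show ?thesis
        unfolding J_eq[OF uL2 wG u0] by argo
    qed
    show ?thesis
    proof (rule ccontr)
      assume L: "?L \<noteq> 0"
      have Q: "?Q \<ge> 0" using \<alpha> a by simp
      \<comment> \<open>with this step the quadratic term is at most half of the linear term\<close>
      define s where "s = min t0 (\<bar>?L\<bar> / (2 * (?Q + 1)))"
      have s: "0 < s" "s \<le> t0" "s * (?Q + 1) \<le> \<bar>?L\<bar> / 2"
      proof -
        show "0 < s" using t0 L Q by (simp add: s_def)
        show "s \<le> t0" by (simp add: s_def)
        have "s * (?Q + 1) \<le> \<bar>?L\<bar> / (2 * (?Q + 1)) * (?Q + 1)" using Q by (intro mult_right_mono) (auto simp: s_def)
        also have "\<dots> = \<bar>?L\<bar> / 2" using Q by (simp add: field_simps)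
        finally show "s * (?Q + 1) \<le> \<bar>?L\<bar> / 2" .
      qed
      have "0 \<le> (- sgn ?L * s) * ?L + (- sgn ?L * s)\<^sup>2 * ?Q"
        using s by (intro var) (simp add: abs_mult abs_sgn_eq)
      also have "(- sgn ?L * s) * ?L = - (s * \<bar>?L\<bar>)" by (simp add: abs_sgn mult_ac)
      also have "(- sgn ?L * s)\<^sup>2 = s\<^sup>2" using L by (simp add: power_mult_distrib sgn_if)
      finally have "s * \<bar>?L\<bar> \<le> s * (s * ?Q)" by (simp add: power2_eq_square mult.assoc)
      then have "\<bar>?L\<bar> \<le> s * ?Q" using s(1) by (simp only: mult_le_cancel_left_pos)
      also have "\<dots> \<le> s * (?Q + 1)" using s(1) by (intro mult_left_mono) auto
      also have "\<dots> \<le> \<bar>?L\<bar> / 2" by (rule s(3))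
      finally show False using L by simp
    qed
  qed
  show ?thesis
    unfolding entropic_poisson_weak_def
  proof
    fix v assume v: "v \<in> H10 \<Omega>"
    note vG = is_weak_grad_weak_grad[OF H10_H1[OF v]] and vL2 = H1_L2[OF H10_H1[OF v]]
    obtain \<phi> where \<phi>: "\<And>k. \<phi> k \<in> test_functions \<Omega>"
      and lim: "(\<lambda>k. L2norm \<Omega> (\<lambda>x. \<phi> k x - v x)) \<longlonglongrightarrow> 0"
      and limG: "(\<lambda>k. L2norm \<Omega> (\<lambda>x. gradient (\<phi> k) x - weak_grad \<Omega> v x)) \<longlonglongrightarrow> 0"
      using H10_approx[OF v vG] by blast
    have "(\<lambda>k. L2_inner \<Omega> (gradient (\<phi> k)) ?G + L2_inner \<Omega> (\<phi> k) q)
        \<longlonglongrightarrow> L2_inner \<Omega> (weak_grad \<Omega> v) ?G + L2_inner \<Omega> v q"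
      by (intro tendsto_add L2_inner_tendsto[OF gradient_test_function_L2[OF \<phi>] is_weak_grad_L2[OF vG] GL2 limG]
          L2_inner_tendsto[OF test_function_L2[OF \<phi>] vL2 qL2 lim])
    moreover have "L2_inner \<Omega> (gradient (\<phi> k)) ?G + L2_inner \<Omega> (\<phi> k) q = 0" for k
      using EL[OF \<phi>[of k]] by (simp add: L2_inner_commute)
    ultimately have "L2_inner \<Omega> (weak_grad \<Omega> v) ?G + L2_inner \<Omega> v q = 0"
      by (simp add: LIMSEQ_const_iff)
    then have "\<alpha> * L2_inner \<Omega> ?G (weak_grad \<Omega> v) + \<alpha> * L2_inner \<Omega> q v = 0"
      using \<alpha> by (simp add: L2_inner_commute distrib_left[symmetric])
    moreover have "\<alpha> * L2_inner \<Omega> q v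
        = L2_inner \<Omega> (\<lambda>x. ln (u x)) v - L2_inner \<Omega> (\<lambda>x. ln (w x)) v - L2_inner \<Omega> (\<lambda>x. \<alpha> * f x) v"
    proof -
      have "(\<lambda>x. \<alpha> *\<^sub>R q x) = (\<lambda>x. (ln (u x) - ln (w x)) - \<alpha> * f x)"
        using \<alpha> by (simp add: fun_eq_iff q_def right_diff_distrib mult.assoc[symmetric])
      then have "\<alpha> * L2_inner \<Omega> q v = L2_inner \<Omega> (\<lambda>x. (ln (u x) - ln (w x)) - \<alpha> * f x) v"
        using L2_inner_scaleR_left[of \<alpha> q v] by simp
      then show ?thesis
        by (simp add: L2_inner_diff_left L2_diff lnu lnw L2_mult_const f_L2 vL2)
    qed
    ultimately show "L2_inner \<Omega> (\<lambda>x. \<alpha> *\<^sub>R weak_grad \<Omega> u x) (weak_grad \<Omega> v) + L2_inner \<Omega> (\<lambda>x. ln (u x)) v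
        = L2_inner \<Omega> (\<lambda>x. \<alpha> * f x) v + L2_inner \<Omega> (\<lambda>x. ln (w x)) v"
      by (simp add: L2_inner_scaleR_left)
  qed
qed

end

section \<open>The entropic Poisson problem\<close>

theorem theorem4p7:
  fixes \<Omega> :: "(real ^ 'n) set"
    and f g w :: "real ^ 'n \<Rightarrow> real"
    and \<alpha> :: real
  assumes "open \<Omega>" and "\<Omega> \<noteq> {}" and "bounded \<Omega>" and "lipschitz_boundary \<Omega>"
    and "g \<in> H1 \<Omega>" and "continuous_on (closure \<Omega>) g"
    and "(INF x \<in> frontier \<Omega>. g x) > 0"
    and "f \<in> Linfty \<Omega>"
    and "\<alpha> > 0"
    and "w \<in> int_Linfty_plus \<Omega>"
  defines "is_solution \<equiv> is_arg_min
      (\<lambda>v. dirichlet_energy \<Omega> f v + inverse \<alpha> * entropy_divergence \<Omega> v w)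
      (\<lambda>v. v \<in> obstacle_set \<Omega> g)"
  shows "\<exists>u.
      is_solution u \<and>
      (\<forall>v. is_solution v \<longrightarrow> (AE x in lebesgue_on \<Omega>. v x = u x)) \<and>
      u \<in> H1g \<Omega> g \<inter> int_Linfty_plus \<Omega> \<and>
      entropic_poisson_weak \<Omega> \<alpha> f w u \<and>
      (\<forall>v \<in> H1g \<Omega> g \<inter> int_Linfty_plus \<Omega>.
         entropic_poisson_weak \<Omega> \<alpha> f w v \<longrightarrow> (AE x in lebesgue_on \<Omega>. v x = u x))"
proof -
  interpret bounded_open \<Omega> using assms(1,3) by unfold_locales
  obtain Fb where Fb: "Fb > 0" "AE x in lebesgue_on \<Omega>. \<bar>f x\<bar> \<le> Fb"
    using Linfty_bound[OF assms(8)] by blast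
  obtain wl wu where w: "0 < wl" "wl \<le> wu" "AE x in lebesgue_on \<Omega>. wl \<le> w x \<and> w x \<le> wu"
    using int_Linfty_plus_bounds[OF assms(10)] by blast
  have compact_cl: "compact (closure \<Omega>)" using assms(3) by simp
  then have bdd: "bounded (g ` closure \<Omega>)" by (intro compact_imp_bounded compact_continuous_image assms(6))
  then obtain C where "\<forall>y\<in>g ` closure \<Omega>. norm y \<le> C" unfolding bounded_iff by blast
  then have C: "g x \<le> C" if "x \<in> closure \<Omega>" for x using that by (auto simp: abs_le_iff)
  define c where "c = (INF x \<in> frontier \<Omega>. g x)"
  have c: "c > 0" using assms(7) by (simp add: c_def)
  have c_le: "c \<le> g x" if "x \<in> frontier \<Omega>" for x
  proof -
    have "g ` frontier \<Omega> \<subseteq> g ` closure \<Omega>" by (auto simp: frontier_def)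
    then have "bdd_below (g ` frontier \<Omega>)" by (rule bounded_imp_bdd_below[OF bounded_subset[OF bdd]])
    then show ?thesis unfolding c_def using that by (intro cINF_lower)
  qed
  \<comment> \<open>\<open>a\<close> is below the boundary values and below all turning points \<open>w * exp (\<alpha> * f)\<close>, \<open>b\<close> is above\<close>
  define a where "a = min (c / 2) (wl * exp (- (\<alpha> * Fb)))"
  define b where "b = max (a + 1) (max C (wu * exp (\<alpha> * Fb)))"
  have a: "0 < a" using c w by (simp add: a_def)
  have slopes: "AE x in lebesgue_on \<Omega>. ln (a / w x) \<le> \<alpha> * f x \<and> \<alpha> * f x \<le> ln (b / w x)"
    using w(3) Fb(2)
  proof eventually_elim
    case (elim x)
    have wx: "0 < w x" using elim w(1) by simp
    have af: "\<bar>\<alpha> * f x\<bar> \<le> \<alpha> * Fb" using elim assms(9) by (simp add: abs_mult)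
    have "a \<le> wl * exp (- (\<alpha> * Fb))" by (simp add: a_def)
    also have "\<dots> \<le> w x * exp (- (\<alpha> * Fb))" using elim by simp
    finally have "a / w x \<le> exp (- (\<alpha> * Fb))" using wx by (simp add: divide_le_eq mult.commute)
    then have "ln (a / w x) \<le> - (\<alpha> * Fb)"
      using a wx by (metis divide_pos_pos exp_gt_zero ln_exp ln_le_cancel_iff)
    moreover have "w x * exp (\<alpha> * Fb) \<le> b"
    proof -
      have "w x * exp (\<alpha> * Fb) \<le> wu * exp (\<alpha> * Fb)" using elim by simp
      then show ?thesis unfolding b_def by linarith
    qed
    then have "exp (\<alpha> * Fb) \<le> b / w x" using wx by (simp add: le_divide_eq mult.commute)
    then have "\<alpha> * Fb \<le> ln (b / w x)"
      by (metis exp_gt_zero ln_exp ln_le_cancel_iff order_less_le_trans)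
    ultimately show ?case using af by linarith
  qed
  interpret bounded_data_problem \<Omega> f g w \<alpha> Fb wl wu a b
  proof
    show "g \<in> H1 \<Omega>" "\<alpha> > 0" "continuous_on (closure \<Omega>) g" by fact+
    show "f \<in> borel_measurable (lebesgue_on \<Omega>)" by (rule Linfty_measurable[OF assms(8)])
    show "w \<in> borel_measurable (lebesgue_on \<Omega>)"
      using assms(10) by (auto simp: int_Linfty_plus_def intro: Linfty_measurable)
    show "a < b" by (simp add: b_def)
    show "a < g x" if "x \<in> frontier \<Omega>" for x
      using c_le[OF that] c unfolding a_def by linarith
    show "g x \<le> b" if "x \<in> closure \<Omega>" for x
      using C[OF that] unfolding b_def by linarith
  qed (use Fb w a slopes in auto)
  have sol: "is_solution v \<longleftrightarrow> v \<in> obstacle_set \<Omega> g \<and> (\<forall>z\<in>obstacle_set \<Omega> g. J v \<le> J z)" for v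
    unfolding is_solution_def is_arg_min_def J_def by (auto simp: not_less)
  obtain u where u: "u \<in> band" and min: "\<And>v. v \<in> band \<Longrightarrow> J u \<le> J v"
    using band_minimizer_exists by blast
  note glob = band_minimizer_global[OF min]
  note weak = minimizer_weak_solution[OF u glob]
  have u_sol: "is_solution u" using band_obstacle[OF u] glob by (simp add: sol)
  have u_set: "u \<in> H1g \<Omega> g \<inter> int_Linfty_plus \<Omega>"
  proof
    show "u \<in> H1g \<Omega> g" using u by (simp add: band_def)
    show "u \<in> int_Linfty_plus \<Omega>"
      using u a by (intro int_Linfty_plusI[OF L2_measurable[OF H1_L2[OF band_H1[OF u]]], of "a / 2" "2 * b"])
        (auto simp: band_def)
  qed
  show ?thesis
  proof (intro exI[of _ u] conjI allI impI ballI)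
    fix v assume "is_solution v"
    then show "AE x in lebesgue_on \<Omega>. v x = u x"
      using minimizer_unique[of u v] u_sol by (simp add: sol)
  next
    fix v assume "v \<in> H1g \<Omega> g \<inter> int_Linfty_plus \<Omega>" "entropic_poisson_weak \<Omega> \<alpha> f w v"
    then show "AE x in lebesgue_on \<Omega>. v x = u x"
      using weak_solution_unique[OF u_set _ weak] by blast
  qed (use u_sol u_set weak in auto)
qed

end
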